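(* Let $(M,g,\Gamma)$ be a generalised pp-wave with purely axial torsion: $M$ is a connected real 4-manifold, $g$ is a pp-metric on $M$ with associated parallel null vector field $l$ and phase $\varphi$, and $\Gamma$ is the affine connection that is metric compatible ($\nabla g=0$) and whose torsion is $T=*A$, where $A=k(\varphi)\,l$ and $k:\mathbb{R}\to\mathbb{R}$ is an arbitrary smooth real function; i.e. $$T_{\lambda\mu\nu}=\sqrt{|\det g|}\;k(\varphi)\,l^{\alpha}\,\varepsilon_{\alpha\lambda\mu\nu}.$$ Suppose that the Ricci curvature $\{Ric\}$ of the Levi-Civita connection of $g$ is parallel with respect to the Levi-Civita connection, i.e. $\{\nabla\}\{Ric\}=0$. Then $(g,\Gamma)$ satisfies both Euler--Lagrange equations $\partial S/\partial g=0$ and $\partial S/\partial\Gamma=0$ obtained by varying the Yang--Mills action $$S=\int R^{\kappa}{}_{\lambda\mu\nu}R^{\lambda}{}_{\kappa}{}^{\mu\nu}$$ independently with respect to the metric $g$ and the connection $\Gamma$. Explicitly, $(g,\Gamma)$ satisfies the Yang--Mills equation $$\frac{1}{\sqrt{|\det g|}}\,\partial_\nu\!\left(\sqrt{|\det g|}\;R^{\kappa}{}_{\lambda}{}^{\mu\nu}\right)+\Gamma^{\kappa}{}_{\nu\eta}R^{\eta}{}_{\lambda}{}^{\mu\nu}-\Gamma^{\eta}{}_{\nu\lambda}R^{\kappa}{}_{\eta}{}^{\mu\nu}=0$$ and the complementary Yang--Mills equation $$H_\nu{}^{\rho}-\tfrac14\,H_\sigma{}^{\sigma}\,\delta_\nu{}^{\rho}=0,\qquad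 H_\nu{}^{\rho}:=R^{\kappa}{}_{\lambda\mu\nu}R^{\lambda}{}_{\kappa}{}^{\mu\rho},$$ where $R$ is the curvature of the full connection $\Gamma$.
   Context: Conventions. The metric $g$ is Lorentzian of signature $(+,-,-,-)$; indices run over $0,1,2,3$ and are raised and lowered with $g$. For an affine connection $\Gamma$, $\nabla_\mu v^\lambda=\partial_\mu v^\lambda+\Gamma^\lambda{}_{\mu\nu}v^\nu$. Torsion: $T^\lambda{}_{\mu\nu}=\Gamma^\lambda{}_{\mu\nu}-\Gamma^\lambda{}_{\nu\mu}$. Contortion: $K^\lambda{}_{\mu\nu}=\frac12(T^\lambda{}_{\mu\nu}+T_\mu{}^\lambda{}_\nu+T_\nu{}^\lambda{}_\mu)$; a metric compatible connection is $\Gamma^\lambda{}_{\mu\nu}=\left\{{\lambda\atop\mu\nu}\right\}+K^\lambda{}_{\mu\nu}$, where $\left\{{\lambda\atop\mu\nu}\right\}=\frac12 g^{\lambda\kappa}(\partial_\mu g_{\nu\kappa}+\partial_\nu g_{\mu\kappa}-\partial_\kappa g_{\mu\nu})$ is the Christoffel symbol (for totally antisymmetric $T$ one has $K=\frac12T$). Curvature: $R^\kappa{}_{\lambda\mu\nu}=\partial_\mu\Gamma^\kappa{}_{\nu\lambda}-\partial_\nu\Gamma^\kappa{}_{\mu\lambda}+\Gamma^\kappa{}_{\mu\eta}\Gamma^\eta{}_{\nu\lambda}-\Gamma^\kappa{}_{\nu\eta}\Gamma^\eta{}_{\mu\lambda}$. Ricci curvature: $Ric_{\lambda\nu}=R^\kappa{}_{\lambda\kappa\nu}$.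 Curly braces, as in $\{\nabla\}$ and $\{Ric\}$, denote quantities computed from the Levi-Civita connection of $g$. "Parallel" means having identically zero covariant derivative. The Hodge star on a rank $q$ antisymmetric tensor is $( *Q)_{\mu_{q+1}\cdots\mu_4}=(q!)^{-1}\sqrt{|\det g|}\,Q^{\mu_1\cdots\mu_q}\varepsilon_{\mu_1\cdots\mu_4}$, with $\varepsilon$ totally antisymmetric and $\varepsilon_{0123}=+1$. For a scalar $f$, $\int f:=\int f\sqrt{|\det g|}\,dx^0dx^1dx^2dx^3$. Variational setting. The unknowns are the 10 components of $g_{\mu\nu}$ and the 64 connection coefficients $\Gamma^\lambda{}_{\mu\nu}$, varied independently of each other; the particular $g$ and $\Gamma$ are substituted after the variation. pp-metric. A pp-wave is a Riemannian spacetime (a connected real 4-manifold with Lorentzian metric $g$ and its Levi-Civita connection) which admits a nonvanishing spinor field $\chi=\chi^a$ that is parallel with respect to the Levi-Civita connection; its metric is called a pp-metric. The spinor field $\chi$ is fixed. Put $l^\alpha:=\sigma^\alpha{}_{a\dot b}\,\chi^a\bar\chi^{\dot b}$, where $\sigma^\alpha$ are the Pauli matrices; $l$ is a nonvanishing real null vector field that is parallel with respect to the Levi-Civita connection. The phase is the real function $\varphi:M\to\mathbb{R}$, $\varphi(x)=\int l\cdot dx$, i.e. $\partial_\mu\varphi=l_\mu$. It is known that, equivalently, the metric of a pp-wave can be written locally as $$ds^2=2\,dx^0dx^3-(dx^1)^2-(dx^2)^2+f(x^1,x^2,x^3)\,(dx^3)^2$$ for some real function $f$, and the local coordinates are chosen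 so that moreover $\chi^a=(1,0)$ and $l^\mu=(1,0,0,0)$; then $\varphi(x)=x^3+\mathrm{const}$. *)

theory Defs
  imports "HOL-Analysis.Analysis"
begin

text \<open>
  Tensor indices 0, 1, 2, 3 are the elements of the numeral type \<open>4\<close> (in which \<open>4 = 0\<close>), spinor
  indices 0, 1 those of \<open>2\<close>. The arguments of a component function are in the order
  in which the indices are read, e.g. \<open>Gam x \<tau> \<mu> \<nu>\<close> is \<open>\<Gamma>\<^sup>\<tau>\<^sub>\<mu>\<^sub>\<nu>\<close> at \<open>x\<close>;
  the index usually called lambda is written \<open>\<tau>\<close>.
\<close>

type_synonym vec4 = "real ^ 4"
type_synonym metric = "vec4 \<Rightarrow> real ^ 4 ^ 4"
type_synonym conn = "vec4 \<Rightarrow> 4 \<Rightarrow> 4 \<Rightarrow> 4 \<Rightarrow> real"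
type_synonym pauli = "vec4 \<Rightarrow> 4 \<Rightarrow> complex ^ 2 ^ 2"
type_synonym spinor = "vec4 \<Rightarrow> complex ^ 2"

section \<open>Smooth functions\<close>

text \<open>Meant for open sets only.\<close>

primrec Ck_on :: "nat \<Rightarrow> 'a::euclidean_space set \<Rightarrow> ('a \<Rightarrow> 'b::real_normed_vector) \<Rightarrow> bool" where
  "Ck_on 0 U f \<longleftrightarrow> continuous_on U f"
| "Ck_on (Suc n) U f \<longleftrightarrow>
     f differentiable_on U \<and> (\<forall>v\<in>Basis. Ck_on n U (\<lambda>x. frechet_derivative f (at x) v))"

definition smooth_on :: "'a::euclidean_space set \<Rightarrow> ('a \<Rightarrow> 'b::real_normed_vector) \<Rightarrow> bool" where
  "smooth_on U f \<longleftrightarrow> (\<forall>n. Ck_on n U f)"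

definition pd :: "4 \<Rightarrow> (vec4 \<Rightarrow> 'b::real_normed_vector) \<Rightarrow> vec4 \<Rightarrow> 'b" where
  "pd \<mu> f x = frechet_derivative f (at x) (axis \<mu> 1)"

section \<open>Tensor calculus in a coordinate domain\<close>

definition levi_civita :: "4 \<Rightarrow> 4 \<Rightarrow> 4 \<Rightarrow> 4 \<Rightarrow> real" where
  "levi_civita a b c d =
     (let p = (\<lambda>i::4. if i = 0 then a else if i = 1 then b else if i = 2 then c else d)
      in if bij p then of_int (sign p) else 0)"

definition minkowski :: "real ^ 4 ^ 4" where
  "minkowski = (\<chi> i j. if i = j then (if i = 0 then 1 else - 1) else 0)"

text \<open>Signature \<open>(+,-,-,-)\<close>.\<close>

definition lorentzian :: "real ^ 4 ^ 4 \<Rightarrow> bool" where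
  "lorentzian Q \<longleftrightarrow> transpose Q = Q \<and>
     (\<exists>P. invertible P \<and> transpose P ** Q ** P = minkowski)"

definition ginv :: "metric \<Rightarrow> metric" where
  "ginv g x = matrix_inv (g x)"

definition vol :: "metric \<Rightarrow> vec4 \<Rightarrow> real" where
  "vol g x = sqrt \<bar>det (g x)\<bar>"

definition christoffel :: "metric \<Rightarrow> conn" where
  "christoffel g x \<tau> \<mu> \<nu> = 1/2 * (\<Sum>\<kappa>\<in>UNIV. ginv g x $ \<tau> $ \<kappa> *
     (pd \<mu> (\<lambda>y. g y $ \<nu> $ \<kappa>) x + pd \<nu> (\<lambda>y. g y $ \<mu> $ \<kappa>) x - pd \<kappa> (\<lambda>y. g y $ \<mu> $ \<nu>) x))"

definition torsion :: "conn \<Rightarrow> vec4 \<Rightarrow> 4 \<Rightarrow> 4 \<Rightarrow> 4 \<Rightarrow> real" where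
  "torsion Gam x \<tau> \<mu> \<nu> = Gam x \<tau> \<mu> \<nu> - Gam x \<tau> \<nu> \<mu>"

definition torsion_low :: "metric \<Rightarrow> conn \<Rightarrow> vec4 \<Rightarrow> 4 \<Rightarrow> 4 \<Rightarrow> 4 \<Rightarrow> real" where
  "torsion_low g Gam x \<tau> \<mu> \<nu> = (\<Sum>\<kappa>\<in>UNIV. g x $ \<tau> $ \<kappa> * torsion Gam x \<kappa> \<mu> \<nu>)"

definition cov_deriv2 :: "conn \<Rightarrow> (vec4 \<Rightarrow> 4 \<Rightarrow> 4 \<Rightarrow> real) \<Rightarrow> vec4 \<Rightarrow> 4 \<Rightarrow> 4 \<Rightarrow> 4 \<Rightarrow> real" where
  "cov_deriv2 Gam Q x \<mu> \<alpha> \<beta> = pd \<mu> (\<lambda>y. Q y \<alpha> \<beta>) x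
     - (\<Sum>\<kappa>\<in>UNIV. Gam x \<kappa> \<mu> \<alpha> * Q x \<kappa> \<beta>) - (\<Sum>\<kappa>\<in>UNIV. Gam x \<kappa> \<mu> \<beta> * Q x \<alpha> \<kappa>)"

text \<open>\<open>curvature Gam x \<kappa> \<tau> \<mu> \<nu>\<close> is \<open>R\<^sup>\<kappa>\<^sub>\<tau>\<^sub>\<mu>\<^sub>\<nu>\<close>.\<close>

definition curvature :: "conn \<Rightarrow> vec4 \<Rightarrow> 4 \<Rightarrow> 4 \<Rightarrow> 4 \<Rightarrow> 4 \<Rightarrow> real" where
  "curvature Gam x \<kappa> \<tau> \<mu> \<nu> =
     pd \<mu> (\<lambda>y. Gam y \<kappa> \<nu> \<tau>) x - pd \<nu> (\<lambda>y. Gam y \<kappa> \<mu> \<tau>) x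
     + (\<Sum>\<eta>\<in>UNIV. Gam x \<kappa> \<mu> \<eta> * Gam x \<eta> \<nu> \<tau>) - (\<Sum>\<eta>\<in>UNIV. Gam x \<kappa> \<nu> \<eta> * Gam x \<eta> \<mu> \<tau>)"

definition ricci :: "conn \<Rightarrow> vec4 \<Rightarrow> 4 \<Rightarrow> 4 \<Rightarrow> real" where
  "ricci Gam x \<tau> \<nu> = (\<Sum>\<kappa>\<in>UNIV. curvature Gam x \<kappa> \<tau> \<kappa> \<nu>)"

text \<open>\<open>curv_up g Gam x \<kappa> \<tau> \<mu> \<nu>\<close> has \<open>\<tau>\<close> down and \<open>\<kappa>\<close>, \<open>\<mu>\<close>, \<open>\<nu>\<close> up.\<close>

definition curv_up :: "metric \<Rightarrow> conn \<Rightarrow> vec4 \<Rightarrow> 4 \<Rightarrow> 4 \<Rightarrow> 4 \<Rightarrow> 4 \<Rightarrow> real" where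
  "curv_up g Gam x \<kappa> \<tau> \<mu> \<nu> =
     (\<Sum>\<alpha>\<in>UNIV. \<Sum>\<beta>\<in>UNIV. ginv g x $ \<mu> $ \<alpha> * ginv g x $ \<nu> $ \<beta> * curvature Gam x \<kappa> \<tau> \<alpha> \<beta>)"

text \<open>The Hodge star of a rank 1 tensor, given by its contravariant components.\<close>

definition hodge1 :: "metric \<Rightarrow> (vec4 \<Rightarrow> 4 \<Rightarrow> real) \<Rightarrow> vec4 \<Rightarrow> 4 \<Rightarrow> 4 \<Rightarrow> 4 \<Rightarrow> real" where
  "hodge1 g Q x \<tau> \<mu> \<nu> = vol g x * (\<Sum>\<alpha>\<in>UNIV. Q x \<alpha> * levi_civita \<alpha> \<tau> \<mu> \<nu>)"

section \<open>The Yang--Mills action\<close>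

definition ym_scalar :: "metric \<Rightarrow> conn \<Rightarrow> vec4 \<Rightarrow> real" where
  "ym_scalar g Gam x = (\<Sum>\<kappa>\<in>UNIV. \<Sum>\<tau>\<in>UNIV. \<Sum>\<mu>\<in>UNIV. \<Sum>\<nu>\<in>UNIV.
     curvature Gam x \<kappa> \<tau> \<mu> \<nu> * curv_up g Gam x \<tau> \<kappa> \<mu> \<nu>)"

definition ym_action :: "vec4 set \<Rightarrow> metric \<Rightarrow> conn \<Rightarrow> real" where
  "ym_action K g Gam = integral K (\<lambda>x. vol g x * ym_scalar g Gam x)"

text \<open>
  \<open>\<partial>S/\<partial>g = 0\<close> and \<open>\<partial>S/\<partial>\<Gamma> = 0\<close> on an open coordinate domain \<open>V\<close>: the first variation vanishes for
  all smooth variations supported in a compact \<open>K \<subseteq> V\<close>. Since the integral over \<open>V\<close> itself need not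
  exist, the action is taken over \<open>K\<close>, outside of which nothing is varied. On a manifold it
  suffices to use variations supported in a chart, by linearity of the first variation and a
  partition of unity.
\<close>

definition EL_metric :: "vec4 set \<Rightarrow> metric \<Rightarrow> conn \<Rightarrow> bool" where
  "EL_metric V g Gam \<longleftrightarrow>
     (\<forall>K (h :: metric). compact K \<and> K \<subseteq> V
        \<and> (\<forall>\<mu> \<nu>. smooth_on V (\<lambda>x. h x $ \<mu> $ \<nu>))
        \<and> (\<forall>x\<in>V. transpose (h x) = h x) \<and> (\<forall>x\<in>V - K. h x = 0)
        \<longrightarrow> ((\<lambda>t. ym_action K (\<lambda>x. g x + t *\<^sub>R h x) Gam) has_real_derivative 0) (at 0))"

definition EL_connection :: "vec4 set \<Rightarrow> metric \<Rightarrow> conn \<Rightarrow> bool" where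
  "EL_connection V g Gam \<longleftrightarrow>
     (\<forall>K (\<gamma> :: conn). compact K \<and> K \<subseteq> V
        \<and> (\<forall>\<tau> \<mu> \<nu>. smooth_on V (\<lambda>x. \<gamma> x \<tau> \<mu> \<nu>))
        \<and> (\<forall>x\<in>V - K. \<forall>\<tau> \<mu> \<nu>. \<gamma> x \<tau> \<mu> \<nu> = 0)
        \<longrightarrow> ((\<lambda>t. ym_action K g (\<lambda>x \<tau> \<mu> \<nu>. Gam x \<tau> \<mu> \<nu> + t * \<gamma> x \<tau> \<mu> \<nu>))
               has_real_derivative 0) (at 0))"

definition ym_equation_at :: "metric \<Rightarrow> conn \<Rightarrow> vec4 \<Rightarrow> bool" where
  "ym_equation_at g Gam x \<longleftrightarrow> (\<forall>\<kappa> \<tau> \<mu>.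
     1 / vol g x * (\<Sum>\<nu>\<in>UNIV. pd \<nu> (\<lambda>y. vol g y * curv_up g Gam y \<kappa> \<tau> \<mu> \<nu>) x)
     + (\<Sum>\<nu>\<in>UNIV. \<Sum>\<eta>\<in>UNIV. Gam x \<kappa> \<nu> \<eta> * curv_up g Gam x \<eta> \<tau> \<mu> \<nu>)
     - (\<Sum>\<nu>\<in>UNIV. \<Sum>\<eta>\<in>UNIV. Gam x \<eta> \<nu> \<tau> * curv_up g Gam x \<kappa> \<eta> \<mu> \<nu>) = 0)"

definition ym_H :: "metric \<Rightarrow> conn \<Rightarrow> vec4 \<Rightarrow> 4 \<Rightarrow> 4 \<Rightarrow> real" where
  "ym_H g Gam x \<nu> \<rho> = (\<Sum>\<kappa>\<in>UNIV. \<Sum>\<tau>\<in>UNIV. \<Sum>\<mu>\<in>UNIV.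
     curvature Gam x \<kappa> \<tau> \<mu> \<nu> * curv_up g Gam x \<tau> \<kappa> \<mu> \<rho>)"

definition complementary_ym_equation_at :: "metric \<Rightarrow> conn \<Rightarrow> vec4 \<Rightarrow> bool" where
  "complementary_ym_equation_at g Gam x \<longleftrightarrow> (\<forall>\<nu> \<rho>.
     ym_H g Gam x \<nu> \<rho> - 1/4 * (\<Sum>\<sigma>\<in>UNIV. ym_H g Gam x \<sigma> \<sigma>) * (if \<nu> = \<rho> then 1 else 0) = 0)"

section \<open>Spinors in a coordinate domain\<close>

text \<open>The overall sign of the metric spinor is irrelevant, since it is always used twice.\<close>

definition spinor_eps :: "2 \<Rightarrow> 2 \<Rightarrow> complex" where
  "spinor_eps a b = (if a = b then 0 else if a = 0 then 1 else - 1)"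

definition pauli_up :: "pauli \<Rightarrow> vec4 \<Rightarrow> 4 \<Rightarrow> 2 \<Rightarrow> 2 \<Rightarrow> complex" where
  "pauli_up sg x \<alpha> a b =
     (\<Sum>c\<in>UNIV. \<Sum>d\<in>UNIV. spinor_eps a c * spinor_eps b d * sg x \<alpha> $ c $ d)"

text \<open>
  Hermitian matrices with
  \<open>\<sigma>\<^sup>\<alpha>\<^sub>a\<^sub>d \<sigma>\<^sup>\<beta>\<^sup>c\<^sup>d + \<sigma>\<^sup>\<beta>\<^sub>a\<^sub>d \<sigma>\<^sup>\<alpha>\<^sup>c\<^sup>d = 2 g\<^sup>\<alpha>\<^sup>\<beta> \<delta>\<^sub>a\<^sup>c\<close>, the second spinor index being the dotted one.
\<close>

definition pauli_matrices_at :: "metric \<Rightarrow> pauli \<Rightarrow> vec4 \<Rightarrow> bool" where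
  "pauli_matrices_at g sg x \<longleftrightarrow>
     (\<forall>\<alpha> a b. sg x \<alpha> $ b $ a = cnj (sg x \<alpha> $ a $ b)) \<and>
     (\<forall>\<alpha> \<beta> a c. (\<Sum>d\<in>UNIV. sg x \<alpha> $ a $ d * pauli_up sg x \<beta> c d)
                + (\<Sum>d\<in>UNIV. sg x \<beta> $ a $ d * pauli_up sg x \<alpha> c d)
                = 2 * of_real (ginv g x $ \<alpha> $ \<beta>) * (if a = c then 1 else 0))"

text \<open>
  The spinor connection coefficients
  \<open>\<Gamma>\<^sup>a\<^sub>\<mu>\<^sub>b = \<onequarter> \<sigma>\<^sub>\<alpha>\<^sup>a\<^sup>d (\<partial>\<^sub>\<mu> \<sigma>\<^sup>\<alpha>\<^sub>b\<^sub>d + \<Gamma>\<^sup>\<alpha>\<^sub>\<mu>\<^sub>\<beta> \<sigma>\<^sup>\<beta>\<^sub>b\<^sub>d)\<close>: the trace-free ones for which the Pauli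
  matrices are parallel.
\<close>

definition spin_conn :: "metric \<Rightarrow> pauli \<Rightarrow> conn \<Rightarrow> vec4 \<Rightarrow> 2 \<Rightarrow> 4 \<Rightarrow> 2 \<Rightarrow> complex" where
  "spin_conn g sg Gam x a \<mu> b = 1/4 * (\<Sum>\<alpha>\<in>UNIV. \<Sum>d\<in>UNIV.
     (\<Sum>\<beta>\<in>UNIV. of_real (g x $ \<alpha> $ \<beta>) * pauli_up sg x \<beta> a d) *
     (pd \<mu> (\<lambda>y. sg y \<alpha> $ b $ d) x + (\<Sum>\<beta>\<in>UNIV. of_real (Gam x \<alpha> \<mu> \<beta>) * sg x \<beta> $ b $ d)))"

definition cov_deriv_spinor ::
  "metric \<Rightarrow> pauli \<Rightarrow> conn \<Rightarrow> spinor \<Rightarrow> vec4 \<Rightarrow> 4 \<Rightarrow> 2 \<Rightarrow> complex" where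
  "cov_deriv_spinor g sg Gam chi x \<mu> a =
     pd \<mu> (\<lambda>y. chi y $ a) x + (\<Sum>b\<in>UNIV. spin_conn g sg Gam x a \<mu> b * chi x $ b)"

text \<open>\<open>l\<^sup>\<alpha> = \<sigma>\<^sup>\<alpha>\<^sub>a\<^sub>b \<chi>\<^sup>a cnj \<chi>\<^sup>b\<close>; the sum is real when the Pauli matrices are Hermitian.\<close>

definition null_vector :: "pauli \<Rightarrow> spinor \<Rightarrow> vec4 \<Rightarrow> 4 \<Rightarrow> real" where
  "null_vector sg chi x \<alpha> =
     Re (\<Sum>a\<in>UNIV. \<Sum>b\<in>UNIV. sg x \<alpha> $ a $ b * (chi x $ a) * cnj (chi x $ b))"

section \<open>Manifolds, with fields given by their components in the charts of an atlas\<close>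

type_synonym 'm chart = "'m set \<times> ('m \<Rightarrow> vec4)"

definition chart_image :: "'m chart \<Rightarrow> vec4 set" where
  "chart_image c = snd c ` fst c"

definition chart_inv :: "'m chart \<Rightarrow> vec4 \<Rightarrow> 'm" where
  "chart_inv c = inv_into (fst c) (snd c)"

definition overlap :: "'m chart \<Rightarrow> 'm chart \<Rightarrow> vec4 set" where
  "overlap c c' = snd c ` (fst c \<inter> fst c')"

definition transition :: "'m chart \<Rightarrow> 'm chart \<Rightarrow> vec4 \<Rightarrow> vec4" where
  "transition c c' x = snd c' (chart_inv c x)"

definition jac :: "'m chart \<Rightarrow> 'm chart \<Rightarrow> vec4 \<Rightarrow> real ^ 4 ^ 4" where
  "jac c c' x = (\<chi> \<alpha> \<mu>. pd \<mu> (\<lambda>y. transition c c' y $ \<alpha>) x)"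

definition is_chart :: "'m topology \<Rightarrow> 'm chart \<Rightarrow> bool" where
  "is_chart M c \<longleftrightarrow> openin M (fst c) \<and> open (chart_image c) \<and>
     homeomorphic_map (subtopology M (fst c)) (top_of_set (chart_image c)) (snd c)"

text \<open>An orientation is needed for the Hodge star.\<close>

definition connected_oriented_4_manifold :: "'m topology \<Rightarrow> 'm chart set \<Rightarrow> bool" where
  "connected_oriented_4_manifold M A \<longleftrightarrow>
     Hausdorff_space M \<and> second_countable M \<and> connected_space M \<and>
     (\<forall>c\<in>A. is_chart M c) \<and> (\<Union>c\<in>A. fst c) = topspace M \<and>
     (\<forall>c\<in>A. \<forall>c'\<in>A. smooth_on (overlap c c') (transition c c') \<and>
        (\<forall>x\<in>overlap c c'. det (jac c c' x) > 0))"

definition lorentzian_metric_on :: "'m chart set \<Rightarrow> ('m chart \<Rightarrow> metric) \<Rightarrow> bool" where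
  "lorentzian_metric_on A g \<longleftrightarrow>
     (\<forall>c\<in>A. (\<forall>\<mu> \<nu>. smooth_on (chart_image c) (\<lambda>x. g c x $ \<mu> $ \<nu>)) \<and>
        (\<forall>x\<in>chart_image c. lorentzian (g c x))) \<and>
     (\<forall>c\<in>A. \<forall>c'\<in>A. \<forall>x\<in>overlap c c'.
        g c x = transpose (jac c c' x) ** g c' (transition c c' x) ** jac c c' x)"

definition affine_connection_on :: "'m chart set \<Rightarrow> ('m chart \<Rightarrow> conn) \<Rightarrow> bool" where
  "affine_connection_on A Gam \<longleftrightarrow>
     (\<forall>c\<in>A. \<forall>\<tau> \<mu> \<nu>. smooth_on (chart_image c) (\<lambda>x. Gam c x \<tau> \<mu> \<nu>)) \<and>
     (\<forall>c\<in>A. \<forall>c'\<in>A. \<forall>x\<in>overlap c c'. \<forall>\<alpha> \<mu> \<nu>.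
        (\<Sum>\<tau>\<in>UNIV. jac c c' x $ \<alpha> $ \<tau> * Gam c x \<tau> \<mu> \<nu>) =
        pd \<mu> (\<lambda>y. jac c c' y $ \<alpha> $ \<nu>) x +
        (\<Sum>\<beta>\<in>UNIV. \<Sum>\<gamma>\<in>UNIV. Gam c' (transition c c' x) \<alpha> \<beta> \<gamma> *
           jac c c' x $ \<beta> $ \<mu> * jac c c' x $ \<gamma> $ \<nu>))"

text \<open>
  A spin structure: Pauli matrices with respect to a spin frame over every chart, the spin frames of
  two charts being related by smooth \<open>SL(2, \<complex>)\<close>-valued functions \<open>L c c'\<close> (in the coordinates of \<open>c\<close>)
  that satisfy the cocycle condition.
\<close>

definition spin_structure_on ::
  "'m chart set \<Rightarrow> ('m chart \<Rightarrow> metric) \<Rightarrow> ('m chart \<Rightarrow> pauli)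
     \<Rightarrow> ('m chart \<Rightarrow> 'm chart \<Rightarrow> vec4 \<Rightarrow> complex ^ 2 ^ 2) \<Rightarrow> bool" where
  "spin_structure_on A g sg L \<longleftrightarrow>
     (\<forall>c\<in>A. (\<forall>\<alpha> a b. smooth_on (chart_image c) (\<lambda>x. sg c x \<alpha> $ a $ b)) \<and>
        (\<forall>x\<in>chart_image c. pauli_matrices_at (g c) (sg c) x)) \<and>
     (\<forall>c\<in>A. \<forall>c'\<in>A. (\<forall>a b. smooth_on (overlap c c') (\<lambda>x. L c c' x $ a $ b)) \<and>
        (\<forall>x\<in>overlap c c'. det (L c c' x) = 1 \<and>
           (\<forall>\<alpha> a b. sg c' (transition c c' x) \<alpha> $ a $ b =
              (\<Sum>\<beta>\<in>UNIV. \<Sum>d\<in>UNIV. \<Sum>e\<in>UNIV. of_real (jac c c' x $ \<alpha> $ \<beta>) *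
                 (L c c' x $ a $ d) * cnj (L c c' x $ b $ e) * sg c x \<beta> $ d $ e))) \<and>
        (\<forall>c''\<in>A. \<forall>x\<in>overlap c c' \<inter> overlap c c''.
           L c c'' x = L c' c'' (transition c c' x) ** L c c' x))"

definition spinor_field_on ::
  "'m chart set \<Rightarrow> ('m chart \<Rightarrow> 'm chart \<Rightarrow> vec4 \<Rightarrow> complex ^ 2 ^ 2)
     \<Rightarrow> ('m chart \<Rightarrow> spinor) \<Rightarrow> bool" where
  "spinor_field_on A L chi \<longleftrightarrow>
     (\<forall>c\<in>A. \<forall>a. smooth_on (chart_image c) (\<lambda>x. chi c x $ a)) \<and>
     (\<forall>c\<in>A. \<forall>c'\<in>A. \<forall>x\<in>overlap c c'. \<forall>d.
        chi c x $ d = (\<Sum>a\<in>UNIV. chi c' (transition c c' x) $ a * L c c' x $ a $ d))"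

text \<open>\<open>(M, g)\<close> is a pp-wave, with nonvanishing parallel spinor field \<open>chi\<close>.\<close>

definition pp_wave ::
  "'m topology \<Rightarrow> 'm chart set \<Rightarrow> ('m chart \<Rightarrow> metric) \<Rightarrow> ('m chart \<Rightarrow> pauli)
     \<Rightarrow> ('m chart \<Rightarrow> 'm chart \<Rightarrow> vec4 \<Rightarrow> complex ^ 2 ^ 2) \<Rightarrow> ('m chart \<Rightarrow> spinor) \<Rightarrow> bool" where
  "pp_wave M A g sg L chi \<longleftrightarrow>
     connected_oriented_4_manifold M A \<and> lorentzian_metric_on A g \<and>
     spin_structure_on A g sg L \<and> spinor_field_on A L chi \<and>
     (\<forall>c\<in>A. \<forall>x\<in>chart_image c. chi c x \<noteq> 0 \<and>
        (\<forall>\<mu> a. cov_deriv_spinor (g c) (sg c) (christoffel (g c)) (chi c) x \<mu> a = 0))"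

definition phase_function ::
  "'m chart set \<Rightarrow> ('m chart \<Rightarrow> metric) \<Rightarrow> ('m chart \<Rightarrow> pauli) \<Rightarrow> ('m chart \<Rightarrow> spinor)
     \<Rightarrow> ('m \<Rightarrow> real) \<Rightarrow> bool" where
  "phase_function A g sg chi phi \<longleftrightarrow>
     (\<forall>c\<in>A. smooth_on (chart_image c) (phi \<circ> chart_inv c) \<and>
        (\<forall>x\<in>chart_image c. \<forall>\<mu>. pd \<mu> (phi \<circ> chart_inv c) x =
           (\<Sum>\<alpha>\<in>UNIV. g c x $ \<mu> $ \<alpha> * null_vector (sg c) (chi c) x \<alpha>)))"

end

theory Submission
  imports Defs
begin

text \<open>
  The parallel spinor \<open>chi\<close> and \<open>(- cnj chi\<^sup>1, cnj chi\<^sup>0) / |chi|\<^sup>2\<close> form a spin frame, which yields a null frame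
  \<open>l, n, m\<^sub>1, m\<^sub>2\<close> with Levi-Civita derivatives \<open>D l = 0\<close> and \<open>D m\<^sub>i = a\<^sub>i \<otimes> l\<close>. Thus the Levi-Civita curvature is
  \<open>\<Sum> X\<^sub>i \<otimes> da\<^sub>i\<close> with the commuting parallel endomorphisms \<open>X\<^sub>i = m\<^sub>i \<otimes> l - l \<otimes> m\<^sub>i\<close>. By the first Bianchi identity
  \<open>da\<^sub>i = - 1/2 \<Sum> s\<^sub>i\<^sub>j l \<and> m\<^sub>j\<close> with \<open>s\<close> symmetric, and \<open>Ric\<close> is \<open>- 1/2 tr s\<close> times \<open>l \<otimes> l\<close>. If it is parallel, then
  \<open>tr s\<close> is constant, and together with \<open>dda\<^sub>i = 0\<close> this makes the two-forms \<open>da\<^sub>i\<close> divergence free.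

  The contortion only adds a rotation of \<open>m\<^sub>1, m\<^sub>2\<close> with rate \<open>k l / 2\<close> and multiples of \<open>m\<^sub>j\<close> to the \<open>a\<^sub>i\<close>. The curvature of the
  full connection therefore has the same shape, with functions of the phase added to the \<open>s\<^sub>i\<^sub>j\<close>. Their
  gradients are multiples of \<open>l\<close>, so that the two-forms remain divergence free, which is the Yang--Mills equation.
  Since \<open>tr (X\<^sub>i X\<^sub>j) = 0\<close>, the Lagrangian vanishes for this connection and every metric, which gives the other equation.
\<close>

text \<open>Why the frame moves as stated: the second spinor is normalised so that the spin frame
  has determinant 1. The determinant form and \<open>chi\<close> are parallel, so the derivative of
  the second spinor is a multiple of \<open>chi\<close>. Hence m1 + i m2, built from
  \<open>chi\<close> and the conjugate of the second spinor, can only move along \<open>l\<close>.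
  This replaces the local normal form of a pp-metric: everything is computed in the given
  coordinates of a chart. The Ricci hypothesis serves one purpose. Closedness of da_i says that the
  rows of \<open>s\<close> are curl free in the plane of m1, m2, whereas the Yang-Mills equation
  wants them divergence free. For a symmetric 2 by 2 matrix with constant trace the two conditions
  agree. The torsion spoils both the symmetry and the constant trace, harmlessly: \<open>l\<close>
  is orthogonal to itself and to the m_j. The rotation by k l / 2 drops out of the equation for the
  same reason. Varying the connection requires an integration by parts over an arbitrary compact
  set; it is obtained from the translation invariance of the integral.\<close>

no_notation suminf (binder "\<Sum>" 10)

text \<open>Index sums run over a whole index type, as in tensor notation.\<close>

abbreviation index_sum :: "('i \<Rightarrow> 'a::comm_monoid_add) \<Rightarrow> 'a" (binder "\<Sum>" 10) where
  "index_sum f \<equiv> sum f UNIV"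

section \<open>Calculus of smooth functions\<close>

text \<open>On an open set a derivative depends only on the values inside the set, which carries the
  induction.\<close>

lemma Ck_on_cong:
  assumes "open U" "\<And>x. x \<in> U \<Longrightarrow> f x = g x"
  shows "Ck_on n U f = Ck_on n U g"
  using assms(2)
proof (induction n arbitrary: f g)
  case 0
  then show ?case by (simp cong: continuous_on_cong)
next
  case (Suc n)
  have 1: "f differentiable_on U \<longleftrightarrow> g differentiable_on U"
    using Suc.prems by (auto simp: differentiable_on_def intro: differentiable_transform_within[OF _ zero_less_one])
  have 2: "frechet_derivative f (at x) = frechet_derivative g (at x)" if "x \<in> U" for x
  proof -
    have "(f has_derivative D) (at x) = (g has_derivative D) (at x)" for D
      using Suc.prems that by (auto intro: has_derivative_transform_within_open[OF _ assms(1) that])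
    then show ?thesis
      by (simp add: frechet_derivative_def)
  qed
  have "Ck_on n U (\<lambda>x. frechet_derivative f (at x) v) = Ck_on n U (\<lambda>x. frechet_derivative g (at x) v)" for v
    by (rule Suc.IH) (simp add: 2)
  then show ?case
    by (simp add: 1)
qed

lemma Ck_on_Suc_imp: "Ck_on (Suc n) U f \<Longrightarrow> Ck_on n U f"
  by (induction n arbitrary: f) (auto simp: differentiable_imp_continuous_on)

lemma frechet_derivativeI: "(f has_derivative f') (at x) \<Longrightarrow> frechet_derivative f (at x) = f'"
  by (simp add: frechet_derivative_at[symmetric])

text \<open>The closure properties below exhibit a derivative; uniqueness of derivatives identifies
  it with \<open>frechet_derivative\<close>.\<close>

lemma Ck_on_SucI:
  assumes "open U" "\<And>x. x \<in> U \<Longrightarrow> (f has_derivative f' x) (at x)"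
    and "\<And>v. v \<in> Basis \<Longrightarrow> Ck_on n U (\<lambda>x. f' x v)"
  shows "Ck_on (Suc n) U f"
proof -
  have "f differentiable_on U"
    using assms(1,2) by (auto simp: differentiable_on_eq_differentiable_at differentiable_def)
  moreover have "Ck_on n U (\<lambda>x. frechet_derivative f (at x) v)" if "v \<in> Basis" for v
    by (rule Ck_on_cong[THEN iffD2, OF assms(1) _ assms(3)[OF that]]) (rule frechet_derivativeI[OF assms(2), THEN fun_cong])
  ultimately show ?thesis by simp
qed

lemma Ck_on_SucD:
  assumes "open U" "Ck_on (Suc n) U f" "x \<in> U"
  shows "(f has_derivative frechet_derivative f (at x)) (at x)"
  using assms by (simp add: differentiable_on_eq_differentiable_at frechet_derivative_works)

lemma Ck_on_const: "open U \<Longrightarrow> Ck_on n U (\<lambda>x. c)"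
  by (induction n arbitrary: c) (auto intro!: Ck_on_SucI derivative_eq_intros simp del: Ck_on.simps(2))

lemma Ck_on_add:
  assumes "open U" "Ck_on n U f" "Ck_on n U g"
  shows "Ck_on n U (\<lambda>x. f x + g x)"
  using assms(2,3)
proof (induction n arbitrary: f g)
  case (Suc n)
  show ?case
    by (rule Ck_on_SucI[OF assms(1) has_derivative_add[OF Ck_on_SucD Ck_on_SucD]])
      (use Suc assms(1) in auto)
qed (simp add: continuous_intros)

lemma Ck_on_bounded_linear:
  assumes "open U" "bounded_linear h" "Ck_on n U f"
  shows "Ck_on n U (\<lambda>x. h (f x))"
  using assms(3)
proof (induction n arbitrary: f)
  case 0
  then show ?case using assms(2) by (auto intro: linear_continuous_on_compose bounded_linear.continuous_on)
next
  case (Suc n)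
  show ?case
    by (rule Ck_on_SucI[OF assms(1) bounded_linear.has_derivative[OF assms(2) Ck_on_SucD]])
      (use Suc assms(1) in auto)
qed

lemma Ck_on_mult:
  fixes f g :: "'a::euclidean_space \<Rightarrow> 'b::real_normed_algebra"
  assumes "open U" "Ck_on n U f" "Ck_on n U g"
  shows "Ck_on n U (\<lambda>x. f x * g x)"
  using assms(2,3)
proof (induction n arbitrary: f g)
  case (Suc n)
  show ?case
    by (rule Ck_on_SucI[OF assms(1) has_derivative_mult[OF Ck_on_SucD Ck_on_SucD]])
      (use Suc assms(1) Ck_on_Suc_imp[OF Suc.prems(1)] Ck_on_Suc_imp[OF Suc.prems(2)]
      in \<open>auto intro!: Ck_on_add[OF assms(1)]\<close>)
qed (simp add: continuous_intros)

text \<open>The derivative of the inverse is a product containing the inverse itself, at an order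
  that the induction hypothesis supplies.\<close>

lemma Ck_on_inverse:
  fixes f :: "'a::euclidean_space \<Rightarrow> real"
  assumes "open U" "Ck_on n U f" "\<And>x. x \<in> U \<Longrightarrow> f x \<noteq> 0"
  shows "Ck_on n U (\<lambda>x. inverse (f x))"
  using assms(2,3)
proof (induction n)
  case (Suc n)
  have *: "Ck_on n U (\<lambda>x. inverse (f x))"
    using Suc Ck_on_Suc_imp by blast
  have "Ck_on n U (\<lambda>x. - 1 * (inverse (f x) * frechet_derivative f (at x) v * inverse (f x)))" if "v \<in> Basis" for v
    using that Suc.prems * by (intro Ck_on_mult assms Ck_on_const) auto
  then have 1: "Ck_on n U (\<lambda>x. - (inverse (f x) * frechet_derivative f (at x) v * inverse (f x)))" if "v \<in> Basis" for v
    using that by simp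
  have "((\<lambda>x. inverse (f x)) has_derivative
      (\<lambda>v. - (inverse (f x) * frechet_derivative f (at x) v * inverse (f x)))) (at x)" if "x \<in> U" for x
    using Suc.prems(2)[OF that] Ck_on_SucD[OF assms(1) Suc.prems(1) that]
    by (rule Deriv.has_derivative_inverse)
  then show ?case
    using 1 by (rule Ck_on_SucI[OF assms(1)])
qed (simp add: continuous_intros)

lemma smooth_on_const: "open U \<Longrightarrow> smooth_on U (\<lambda>x. c)"
  by (simp add: smooth_on_def Ck_on_const)

lemma smooth_on_add: "open U \<Longrightarrow> smooth_on U f \<Longrightarrow> smooth_on U g \<Longrightarrow> smooth_on U (\<lambda>x. f x + g x)"
  by (simp add: smooth_on_def Ck_on_add)

lemma smooth_on_mult:
  fixes f g :: "'a::euclidean_space \<Rightarrow> 'b::real_normed_algebra"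
  shows "open U \<Longrightarrow> smooth_on U f \<Longrightarrow> smooth_on U g \<Longrightarrow> smooth_on U (\<lambda>x. f x * g x)"
  by (simp add: smooth_on_def Ck_on_mult)

lemma smooth_on_bounded_linear:
  "open U \<Longrightarrow> bounded_linear h \<Longrightarrow> smooth_on U f \<Longrightarrow> smooth_on U (\<lambda>x. h (f x))"
  by (simp add: smooth_on_def Ck_on_bounded_linear)

lemma smooth_on_minus: "open U \<Longrightarrow> smooth_on U f \<Longrightarrow> smooth_on U (\<lambda>x. - f x)"
  by (intro smooth_on_bounded_linear[of U uminus] bounded_linear_minus bounded_linear_ident) auto

lemma smooth_on_diff: "open U \<Longrightarrow> smooth_on U f \<Longrightarrow> smooth_on U g \<Longrightarrow> smooth_on U (\<lambda>x. f x - g x)"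
  using smooth_on_add[of U f "\<lambda>x. - g x"] by (simp add: smooth_on_minus)

lemma smooth_on_sum:
  assumes "open U" "\<And>i. i \<in> I \<Longrightarrow> smooth_on U (f i)"
  shows "smooth_on U (\<lambda>x. \<Sum>i\<in>I. f i x)"
  using assms(2)
  by (induction I rule: infinite_finite_induct) (auto intro!: smooth_on_const smooth_on_add assms(1))

lemma smooth_on_inverse:
  fixes f :: "'a::euclidean_space \<Rightarrow> real"
  shows "open U \<Longrightarrow> smooth_on U f \<Longrightarrow> (\<And>x. x \<in> U \<Longrightarrow> f x \<noteq> 0) \<Longrightarrow> smooth_on U (\<lambda>x. inverse (f x))"
  by (simp add: smooth_on_def Ck_on_inverse)

lemma smooth_on_cong:
  "open U \<Longrightarrow> (\<And>x. x \<in> U \<Longrightarrow> f x = g x) \<Longrightarrow> smooth_on U f = smooth_on U g"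
  by (simp add: smooth_on_def Ck_on_cong[of U f g])

lemma smooth_on_pd: "smooth_on U f \<Longrightarrow> smooth_on U (pd \<mu> f)"
  unfolding smooth_on_def pd_def[abs_def]
  by (metis Ck_on.simps(2) axis_in_Basis_iff Basis_real_def insertI1)

lemma smooth_on_differentiable:
  "open U \<Longrightarrow> smooth_on U f \<Longrightarrow> x \<in> U \<Longrightarrow> f differentiable at x"
  unfolding smooth_on_def
  by (metis Ck_on.simps(2) differentiable_on_eq_differentiable_at)

lemma smooth_on_continuous: "smooth_on U f \<Longrightarrow> continuous_on U f"
  unfolding smooth_on_def by (metis Ck_on.simps(1))

lemmas smooth_intros =
  smooth_on_const smooth_on_add smooth_on_mult smooth_on_minus smooth_on_diff smooth_on_sum smooth_on_pd

section \<open>Partial derivatives\<close>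

lemma pdI: "(f has_derivative f') (at x) \<Longrightarrow> pd \<mu> f x = f' (axis \<mu> 1)"
  by (simp add: pd_def frechet_derivativeI)

lemma has_derivative_pd: "f differentiable at x \<Longrightarrow> (f has_derivative frechet_derivative f (at x)) (at x)"
  by (simp add: frechet_derivative_works)

lemma pd_const [simp]: "pd \<mu> (\<lambda>x. c) x = 0"
  by (simp add: pd_def)

lemma pd_add: "f differentiable at x \<Longrightarrow> g differentiable at x \<Longrightarrow>
    pd \<mu> (\<lambda>y. f y + g y) x = pd \<mu> f x + pd \<mu> g x"
  by (subst pdI[OF has_derivative_add]) (auto dest: has_derivative_pd simp: pd_def)

lemma pd_diff: "f differentiable at x \<Longrightarrow> g differentiable at x \<Longrightarrow>
    pd \<mu> (\<lambda>y. f y - g y) x = pd \<mu> f x - pd \<mu> g x"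
  by (subst pdI[OF has_derivative_diff]) (auto dest: has_derivative_pd simp: pd_def)

lemma pd_minus: "f differentiable at x \<Longrightarrow> pd \<mu> (\<lambda>y. - f y) x = - pd \<mu> f x"
  by (subst pdI[OF has_derivative_minus]) (auto dest: has_derivative_pd simp: pd_def)

lemma pd_mult:
  fixes f g :: "vec4 \<Rightarrow> 'b::{real_normed_algebra, ab_semigroup_mult}"
  shows "f differentiable at x \<Longrightarrow> g differentiable at x \<Longrightarrow>
    pd \<mu> (\<lambda>y. f y * g y) x = pd \<mu> f x * g x + f x * pd \<mu> g x"
  by (subst pdI[OF has_derivative_mult]) (auto dest: has_derivative_pd simp: pd_def)

lemma pd_sum:
  "(\<And>i. i \<in> I \<Longrightarrow> f i differentiable at x) \<Longrightarrow> pd \<mu> (\<lambda>y. \<Sum>i\<in>I. f i y) x = (\<Sum>i\<in>I. pd \<mu> (f i) x)"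
  by (subst pdI[OF has_derivative_sum]) (auto dest: has_derivative_pd simp: pd_def)

lemma pd_bounded_linear:
  "bounded_linear h \<Longrightarrow> f differentiable at x \<Longrightarrow> pd \<mu> (\<lambda>y. h (f y)) x = h (pd \<mu> f x)"
  by (subst pdI[OF bounded_linear.has_derivative]) (auto dest: has_derivative_pd simp: pd_def)

lemma pd_cong:
  assumes "open U" "x \<in> U" "\<And>y. y \<in> U \<Longrightarrow> f y = g y"
  shows "pd \<mu> f x = pd \<mu> g x"
proof -
  have "(f has_derivative D) (at x) = (g has_derivative D) (at x)" for D
    using assms by (auto intro: has_derivative_transform_within_open[OF _ assms(1,2)])
  then show ?thesis
    by (simp add: pd_def frechet_derivative_def)
qed

lemma pd_zero_on:
  assumes "open U" "x \<in> U" "\<And>y. y \<in> U \<Longrightarrow> f y = c"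
  shows "pd \<mu> f x = 0"
  using pd_cong[OF assms(1,2), of f "\<lambda>_. c" \<mu>] assms(3) by simp

lemma has_real_derivative_pd:
  fixes f :: "vec4 \<Rightarrow> real"
  assumes "f differentiable at (x + t *\<^sub>R axis \<mu> 1)"
  shows "((\<lambda>t. f (x + t *\<^sub>R axis \<mu> 1)) has_real_derivative pd \<mu> f (x + t *\<^sub>R axis \<mu> 1)) (at t)"
proof -
  note D = has_derivative_pd[OF assms]
  interpret bounded_linear "frechet_derivative f (at (x + t *\<^sub>R axis \<mu> 1))"
    using D by (rule has_derivative_bounded_linear)
  have "((\<lambda>t. x + t *\<^sub>R axis \<mu> 1) has_derivative (\<lambda>h. h *\<^sub>R axis \<mu> 1)) (at t)"
    by (auto intro!: derivative_eq_intros)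
  from has_derivative_compose[OF this D]
  show ?thesis
    by (simp add: has_field_derivative_def pd_def scaleR mult.commute[of _ "frechet_derivative _ _ _"] mult_commute_abs)
qed

text \<open>For \<open>pd_commute\<close>, this is used for both orders of \<open>\<mu>\<close> and \<open>\<nu>\<close>, as the left hand side is symmetric.\<close>

lemma mixed_difference:
  fixes f :: "vec4 \<Rightarrow> real"
  assumes sm: "open U" "smooth_on U f" and e: "0 < e"
    and U: "\<And>s t. 0 \<le> s \<Longrightarrow> s \<le> e \<Longrightarrow> 0 \<le> t \<Longrightarrow> t \<le> e \<Longrightarrow> x + s *\<^sub>R axis \<mu> 1 + t *\<^sub>R axis \<nu> 1 \<in> U"
  shows "\<exists>s t. 0 < s \<and> s < e \<and> 0 < t \<and> t < e \<and>
     f (x + e *\<^sub>R axis \<mu> 1 + e *\<^sub>R axis \<nu> 1) - f (x + e *\<^sub>R axis \<mu> 1) - f (x + e *\<^sub>R axis \<nu> 1) + f x =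
      e * e * pd \<nu> (pd \<mu> f) (x + s *\<^sub>R axis \<mu> 1 + t *\<^sub>R axis \<nu> 1)"
proof -
  let ?a = "axis \<mu> 1 :: vec4" and ?b = "axis \<nu> 1 :: vec4"
  let ?F = "\<lambda>s. f ((x + e *\<^sub>R ?b) + s *\<^sub>R ?a) - f (x + s *\<^sub>R ?a)"
  have dF: "(?F has_real_derivative pd \<mu> f ((x + e *\<^sub>R ?b) + s *\<^sub>R ?a) - pd \<mu> f (x + s *\<^sub>R ?a)) (at s)"
    if "0 \<le> s" "s \<le> e" for s
    using U[of s e] U[of s 0] that e
    by (intro DERIV_diff has_real_derivative_pd smooth_on_differentiable[OF sm]) (auto simp: algebra_simps)
  \<comment> \<open>The mean value theorem along \<open>\<mu>\<close>, applied to the difference of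
    \<open>f\<close> across two parallel edges; a second application along \<open>\<nu>\<close>
    follows.\<close>
  obtain s where s: "0 < s" "s < e" "?F e - ?F 0 = (e - 0) * (pd \<mu> f ((x + e *\<^sub>R ?b) + s *\<^sub>R ?a) - pd \<mu> f (x + s *\<^sub>R ?a))"
    using MVT2[OF e dF] by auto
  let ?G = "\<lambda>t. pd \<mu> f ((x + s *\<^sub>R ?a) + t *\<^sub>R ?b)"
  have dG: "(?G has_real_derivative pd \<nu> (pd \<mu> f) ((x + s *\<^sub>R ?a) + t *\<^sub>R ?b)) (at t)" if "0 \<le> t" "t \<le> e" for t
    using U[of s t] that s
    by (intro has_real_derivative_pd smooth_on_differentiable[OF sm(1) smooth_on_pd[OF sm(2)]]) auto
  obtain t where t: "0 < t" "t < e" "?G e - ?G 0 = (e - 0) * pd \<nu> (pd \<mu> f) ((x + s *\<^sub>R ?a) + t *\<^sub>R ?b)"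
    using MVT2[OF e dG] by auto
  have "?F e - ?F 0 = e * (?G e - ?G 0)"
    using s(3) by (simp add: algebra_simps)
  then show ?thesis
    using s(1,2) t by (intro exI[of _ s] exI[of _ t]) (simp add: algebra_simps)
qed

text \<open>The second difference over a small square is symmetric in the two directions, and either
  mixed derivative attains its quotient by \<open>e * e\<close> somewhere in the square. Continuity
  at \<open>x\<close> then excludes different values.\<close>

lemma pd_commute:
  fixes f :: "vec4 \<Rightarrow> real"
  assumes U: "open U" "smooth_on U f" and x: "x \<in> U"
  shows "pd \<mu> (pd \<nu> f) x = pd \<nu> (pd \<mu> f) x"
proof (rule ccontr)
  assume neq: "\<not> ?thesis"
  define d where "d = \<bar>pd \<mu> (pd \<nu> f) x - pd \<nu> (pd \<mu> f) x\<bar> / 2"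
  have d: "d > 0" using neq by (simp add: d_def)
  have "isCont (pd \<mu> (pd \<nu> f)) x" "isCont (pd \<nu> (pd \<mu> f)) x"
    using smooth_on_continuous[OF smooth_on_pd[OF smooth_on_pd[OF U(2)]]] x
    by (auto simp: continuous_on_eq_continuous_at[OF U(1)])
  then obtain r1 r2 where r1: "r1 > 0" "\<And>y. dist y x < r1 \<Longrightarrow> \<bar>pd \<mu> (pd \<nu> f) y - pd \<mu> (pd \<nu> f) x\<bar> < d"
    and r2: "r2 > 0" "\<And>y. dist y x < r2 \<Longrightarrow> \<bar>pd \<nu> (pd \<mu> f) y - pd \<nu> (pd \<mu> f) x\<bar> < d"
    using d unfolding continuous_at_eps_delta dist_real_def by metis
  obtain r3 where r3: "r3 > 0" "ball x r3 \<subseteq> U"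
    using U(1) x open_contains_ball by blast
  \<comment> \<open>All points of the square lie within \<open>2 * e\<close> of \<open>x\<close>, so
    a third of the least radius keeps them in all three balls.\<close>
  define e where "e = min r1 (min r2 r3) / 3"
  have e: "e > 0" "2 * e < r1" "2 * e < r2" "2 * e < r3"
    using r1(1) r2(1) r3(1) by (auto simp: e_def min_def)
  have near: "dist (x + s *\<^sub>R axis i 1 + t *\<^sub>R axis j 1) x \<le> 2 * e"
    if "0 \<le> s" "s \<le> e" "0 \<le> t" "t \<le> e" for s t i j
  proof -
    have "norm (s *\<^sub>R axis i 1 + t *\<^sub>R axis j (1::real)) \<le> s + t"
      by (rule norm_triangle_le) (use that in simp)
    then show ?thesis using that by (simp add: dist_norm algebra_simps)
  qed
  have inU: "x + s *\<^sub>R axis i 1 + t *\<^sub>R axis j 1 \<in> U" if "0 \<le> s" "s \<le> e" "0 \<le> t" "t \<le> e" for s t i j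
    using near[OF that, of i j] e r3 by (auto simp: subset_iff dist_commute)
  obtain s t where st: "0 < s" "s < e" "0 < t" "t < e"
     "f (x + e *\<^sub>R axis \<mu> 1 + e *\<^sub>R axis \<nu> 1) - f (x + e *\<^sub>R axis \<mu> 1) - f (x + e *\<^sub>R axis \<nu> 1) + f x =
      e * e * pd \<nu> (pd \<mu> f) (x + s *\<^sub>R axis \<mu> 1 + t *\<^sub>R axis \<nu> 1)"
    using mixed_difference[OF U e(1) inU, of \<mu> \<nu>] by blast
  obtain s' t' where st': "0 < s'" "s' < e" "0 < t'" "t' < e"
     "f (x + e *\<^sub>R axis \<nu> 1 + e *\<^sub>R axis \<mu> 1) - f (x + e *\<^sub>R axis \<nu> 1) - f (x + e *\<^sub>R axis \<mu> 1) + f x =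
      e * e * pd \<mu> (pd \<nu> f) (x + s' *\<^sub>R axis \<nu> 1 + t' *\<^sub>R axis \<mu> 1)"
    using mixed_difference[OF U e(1) inU, of \<nu> \<mu>] by blast
  have "e * e * pd \<nu> (pd \<mu> f) (x + s *\<^sub>R axis \<mu> 1 + t *\<^sub>R axis \<nu> 1) =
      e * e * pd \<mu> (pd \<nu> f) (x + s' *\<^sub>R axis \<nu> 1 + t' *\<^sub>R axis \<mu> 1)"
    using st(5) st'(5) by (simp add: algebra_simps)
  then have "pd \<nu> (pd \<mu> f) (x + s *\<^sub>R axis \<mu> 1 + t *\<^sub>R axis \<nu> 1) = pd \<mu> (pd \<nu> f) (x + s' *\<^sub>R axis \<nu> 1 + t' *\<^sub>R axis \<mu> 1)"
    using e(1) by simp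
  moreover have "\<bar>pd \<nu> (pd \<mu> f) (x + s *\<^sub>R axis \<mu> 1 + t *\<^sub>R axis \<nu> 1) - pd \<nu> (pd \<mu> f) x\<bar> < d"
    using near[of s t \<mu> \<nu>] st e by (intro r2(2)) auto
  moreover have "\<bar>pd \<mu> (pd \<nu> f) (x + s' *\<^sub>R axis \<nu> 1 + t' *\<^sub>R axis \<mu> 1) - pd \<mu> (pd \<nu> f) x\<bar> < d"
    using near[of s' t' \<nu> \<mu>] st' e by (intro r1(2)) auto
  ultimately show False unfolding d_def by (smt (verit) field_sum_of_halves)
qed

section \<open>The first variation with respect to the connection\<close>

lemma differentiable_transform_open:
  assumes "f differentiable at x" "open U" "x \<in> U" "\<And>y. y \<in> U \<Longrightarrow> f y = g y"
  shows "g differentiable at x"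
  using assms unfolding differentiable_def by (meson has_derivative_transform_within_open)

text \<open>Continued by zero, \<open>F\<close> is differentiable everywhere, and the integral of
  its translates along an axis does not depend on the shift. Differentiation under the integral sign
  at shift 0 gives the claim. The boundary of \<open>K\<close> may be arbitrarily bad.\<close>

lemma integral_pd_zero:
  fixes F :: "vec4 \<Rightarrow> real"
  assumes V: "open V" and K: "compact K" "K \<subseteq> V"
    and diff: "\<And>x. x \<in> V \<Longrightarrow> F differentiable at x"
    and cont: "continuous_on V (pd \<mu> F)"
    and zero: "\<And>x. x \<in> V - K \<Longrightarrow> F x = 0"
  shows "integral K (pd \<mu> F) = 0"
proof -
  define e where "e = (axis \<mu> 1 :: vec4)"
  define G where "G x = (if x \<in> V then F x else 0)" for x
  have openK: "open (- K)"
    using K(1) by (simp add: compact_imp_closed open_Compl)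
  have G0: "G x = 0" if "x \<in> - K" for x
    using that zero by (auto simp: G_def)
  have GF: "G differentiable at x" "pd \<mu> G x = pd \<mu> F x" if "x \<in> V" for x
  proof -
    show "G differentiable at x"
      by (rule differentiable_transform_open[OF diff[OF that] V that]) (simp add: G_def)
    show "pd \<mu> G x = pd \<mu> F x"
      by (rule pd_cong[OF V that]) (simp add: G_def)
  qed
  have GK: "G differentiable at x" "pd \<mu> G x = 0" if "x \<in> - K" for x
  proof -
    show "G differentiable at x"
      by (rule differentiable_transform_open[OF differentiable_const openK that]) (simp add: G0)
    show "pd \<mu> G x = 0"
      by (rule pd_zero_on[OF openK that G0])
  qed
  have Gdiff: "G differentiable at x" for x
    using GF(1)[of x] GK(1)[of x] K(2) by blast
  have "continuous_on V (pd \<mu> G)"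
    using cont GF(2) by (simp cong: continuous_on_cong)
  moreover have "continuous_on (- K) (pd \<mu> G)"
    by (rule continuous_on_cong[THEN iffD2, OF refl GK(2) continuous_on_const])
  \<comment> \<open>\<open>V\<close> and the complement of \<open>K\<close> form an open cover of
    the space.\<close>
  ultimately have "continuous_on (V \<union> - K) (pd \<mu> G)"
    using V openK by (intro continuous_on_open_Un)
  moreover have "V \<union> - K = UNIV"
    using K(2) by blast
  ultimately have contG': "continuous_on UNIV (pd \<mu> G)"
    by simp
  have contG: "continuous_on UNIV G"
    by (intro differentiable_imp_continuous_on) (simp add: differentiable_on_def Gdiff)
  obtain r where r: "\<And>x. x \<in> K \<Longrightarrow> norm x \<le> r"
    using compact_imp_bounded[OF K(1)] unfolding bounded_iff by blast
  \<comment> \<open>The margin 1 leaves room for all shifts with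
    \<open>\<bar>t\<bar> \<le> 1\<close>, so that one fixed box serves in the Leibniz rule.\<close>
  obtain b where b: "cball 0 (r + 1) \<subseteq> cbox (- b) (b::vec4)"
    using bounded_subset_cbox_symmetric[OF bounded_cball] by blast
  have KB: "K \<subseteq> cbox (- b) b"
    using r b by (force simp: subset_iff)
  obtain I where I: "(G has_integral I) (cbox (- b) b)"
    using integrable_continuous[OF continuous_on_subset[OF contG subset_UNIV]] unfolding integrable_on_def by blast
  have shift: "((\<lambda>x. G (x + t *\<^sub>R e)) has_integral I) (cbox (- b) b)" if t: "\<bar>t\<bar> \<le> 1" for t
  proof -
    let ?C = "cbox (- b - t *\<^sub>R e) (b - t *\<^sub>R e)"
    have 1: "((\<lambda>x. G (x + t *\<^sub>R e)) has_integral I) ?C"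
      using has_integral_affinity'[OF I, of 1 "t *\<^sub>R e"] by simp
    have 2: "G (x + t *\<^sub>R e) = 0" if "x \<notin> cbox (- b) b" for x
    proof (rule G0, rule ComplI)
      assume "x + t *\<^sub>R e \<in> K"
      then have "norm (x + t *\<^sub>R e) \<le> r" by (rule r)
      moreover have "norm x \<le> norm (x + t *\<^sub>R e) + norm (t *\<^sub>R e)"
      by (metis add_diff_cancel norm_triangle_ineq4)
      moreover have "norm (t *\<^sub>R e) \<le> 1" using t by (simp add: e_def)
      ultimately have "x \<in> cball 0 (r + 1)" by simp
      then show False using b that by blast
    qed
    have 3: "G (x + t *\<^sub>R e) = 0" if "x \<notin> ?C" for x
    proof (rule G0, rule ComplI)
      assume "x + t *\<^sub>R e \<in> K"
      then have "x + t *\<^sub>R e \<in> cbox (- b) b" using KB by blast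
      then show False using that by (auto simp: mem_box algebra_simps)
    qed
    have "((\<lambda>x. G (x + t *\<^sub>R e)) has_integral I) UNIV"
      by (rule has_integral_on_superset[OF 1]) (use 3 in auto)
    then have "((\<lambda>x. if x \<in> cbox (- b) b then G (x + t *\<^sub>R e) else 0) has_integral I) UNIV"
      by (rule has_integral_eq[rotated]) (use 2 in auto)
    then show ?thesis
      by (rule has_integral_restrict_UNIV[THEN iffD1])
  qed
  have "((\<lambda>t. integral (cbox (- b) b) (\<lambda>x. G (x + t *\<^sub>R e))) has_real_derivative
      integral (cbox (- b) b) (\<lambda>x. pd \<mu> G (x + 0 *\<^sub>R e))) (at 0 within {-1..1})"
  proof (rule leibniz_rule_field_derivative)
    show "((\<lambda>t. G (x + t *\<^sub>R e)) has_real_derivative pd \<mu> G (x + t *\<^sub>R e)) (at t within {-1..1})" for x t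
      using has_real_derivative_pd[of G x t \<mu>] Gdiff
      by (auto simp: e_def intro: has_field_derivative_at_within)
    show "(\<lambda>x. G (x + t *\<^sub>R e)) integrable_on cbox (- b) b" if "t \<in> {-1..1}" for t
      using that by (intro has_integral_integrable[OF shift]) auto
    show "continuous_on ({-1..1} \<times> cbox (- b) b) (\<lambda>(t, x). pd \<mu> G (x + t *\<^sub>R e))"
      unfolding split_beta
      by (rule continuous_on_compose2[OF contG']) (auto intro!: continuous_intros)
  qed auto
  then have "((\<lambda>t. integral (cbox (- b) b) (\<lambda>x. G (x + t *\<^sub>R e))) has_real_derivative
      integral (cbox (- b) b) (pd \<mu> G)) (at 0 within {-1..1})"
    by simp
  note D = this
  have "I = integral (cbox (- b) b) (\<lambda>x. G (x + t *\<^sub>R e))" if "t \<in> {-1..1}" for t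
    using integral_unique[OF shift[of t]] that by auto
  then have "((\<lambda>t. I) has_real_derivative integral (cbox (- b) b) (pd \<mu> G)) (at 0 within {-1..1})"
    unfolding has_field_derivative_def
    by (rule has_derivative_transform[OF _ _ D[unfolded has_field_derivative_def], rotated]) auto
  moreover have "at (0::real) within {-1..1} = at 0"
    by (rule at_within_interior) simp
  ultimately have "((\<lambda>t. I) has_real_derivative integral (cbox (- b) b) (pd \<mu> G)) (at 0)"
    by simp
  then have "integral (cbox (- b) b) (pd \<mu> G) = 0"
    by (rule DERIV_unique) simp
  \<comment> \<open>The derivative of \<open>G\<close> vanishes off \<open>K\<close>, so
    \<open>K\<close> may be replaced by the box.\<close>
  moreover have "integral K (pd \<mu> G) = integral (cbox (- b) b) (pd \<mu> G)"
  proof -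
    have "(pd \<mu> G has_integral integral (cbox (- b) b) (pd \<mu> G)) (cbox (- b) b)"
      by (intro integrable_integral integrable_continuous continuous_on_subset[OF contG' subset_UNIV])
    moreover have "{x \<in> cbox (- b) b - K. pd \<mu> G x \<noteq> 0} = {}" "{x \<in> K - cbox (- b) b. pd \<mu> G x \<noteq> 0} = {}"
      using KB GK(2) by blast+
    ultimately have "(pd \<mu> G has_integral integral (cbox (- b) b) (pd \<mu> G)) K"
      using has_integral_spike_set_eq[of "cbox (- b) b" K "pd \<mu> G"] by (metis negligible_empty)
    then show ?thesis by (rule integral_unique)
  qed
  moreover have "integral K (pd \<mu> G) = integral K (pd \<mu> F)"
    by (rule integral_cong) (use K GF in auto)
  ultimately show ?thesis by simp
qed

text \<open>The polarised Lagrangian: a trace in the first two indices, with the form indices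
  contracted by an inverse metric \<open>h\<close>. Bilinearity separates the powers of a variation
  parameter.\<close>

definition curv_pairing :: "real ^ 4 ^ 4 \<Rightarrow> (4 \<Rightarrow> 4 \<Rightarrow> 4 \<Rightarrow> 4 \<Rightarrow> real) \<Rightarrow> (4 \<Rightarrow> 4 \<Rightarrow> 4 \<Rightarrow> 4 \<Rightarrow> real) \<Rightarrow> real" where
  "curv_pairing h P Q = (\<Sum>k t \<mu> \<nu>.
     P k t \<mu> \<nu> * (\<Sum>i j. h $ \<mu> $ i * h $ \<nu> $ j * Q t k i j))"

lemma ym_scalar_eq: "ym_scalar g Gam x = curv_pairing (ginv g x) (curvature Gam x) (curvature Gam x)"
  by (simp add: ym_scalar_def curv_pairing_def curv_up_def)

lemma curv_pairing_add_left:
  "curv_pairing h (\<lambda>k t \<mu> \<nu>. P k t \<mu> \<nu> + P' k t \<mu> \<nu>) Q = curv_pairing h P Q + curv_pairing h P' Q"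
  by (simp add: curv_pairing_def distrib_right sum.distrib)

lemma curv_pairing_scale_left:
  "curv_pairing h (\<lambda>k t \<mu> \<nu>. c * P k t \<mu> \<nu>) Q = c * curv_pairing h P Q"
  by (simp add: curv_pairing_def sum_distrib_left mult.assoc)

text \<open>Flattened sums can be renamed by a single bijection of tuples.\<close>

lemma sum_to_tuple6:
  fixes f :: "'a \<Rightarrow> 'b \<Rightarrow> 'c \<Rightarrow> 'd \<Rightarrow> 'e \<Rightarrow> 'f \<Rightarrow> 'z::comm_monoid_add"
  shows "(\<Sum>a b c d e k. f a b c d e k) =
      (\<Sum>(a, b, c, d, e, k)\<in>UNIV. f a b c d e k)"
  by (simp add: sum.cartesian_product split_beta del: UNIV_Times_UNIV flip: UNIV_Times_UNIV)

lemma sum_to_tuple5: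
  fixes f :: "'a \<Rightarrow> 'b \<Rightarrow> 'c \<Rightarrow> 'd \<Rightarrow> 'e \<Rightarrow> 'z::comm_monoid_add"
  shows "(\<Sum>a b c d e. f a b c d e) =
      (\<Sum>(a, b, c, d, e)\<in>UNIV. f a b c d e)"
  by (simp add: sum.cartesian_product split_beta del: UNIV_Times_UNIV flip: UNIV_Times_UNIV)

lemma sum_to_tuple4:
  fixes f :: "'a \<Rightarrow> 'b \<Rightarrow> 'c \<Rightarrow> 'd \<Rightarrow> 'z::comm_monoid_add"
  shows "(\<Sum>a b c d. f a b c d) =
      (\<Sum>(a, b, c, d)\<in>UNIV. f a b c d)"
  by (simp add: sum.cartesian_product split_beta del: UNIV_Times_UNIV flip: UNIV_Times_UNIV)

text \<open>Cyclicity of the trace together with the symmetry of \<open>h\<close>.\<close>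

lemma curv_pairing_commute:
  assumes "transpose h = h"
  shows "curv_pairing h P Q = curv_pairing h Q P"
proof -
  have h: "h $ i $ j = h $ j $ i" for i j
    using arg_cong[OF assms, of "\<lambda>m. m $ j $ i"] by (simp add: transpose_def)
  have "curv_pairing h P Q = (\<Sum>(k, t, \<mu>, \<nu>, a, b)\<in>UNIV. P k t \<mu> \<nu> * (h $ \<mu> $ a * h $ \<nu> $ b * Q t k a b))"
    by (simp only: curv_pairing_def sum_distrib_left sum_to_tuple6)
  also have "\<dots> = (\<Sum>(k, t, \<mu>, \<nu>, a, b)\<in>UNIV. Q k t \<mu> \<nu> * (h $ \<mu> $ a * h $ \<nu> $ b * P t k a b))"
    by (rule sum.reindex_bij_witness[of _ "\<lambda>(k, t, \<mu>, \<nu>, a, b). (t, k, a, b, \<mu>, \<nu>)"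
      "\<lambda>(k, t, \<mu>, \<nu>, a, b). (t, k, a, b, \<mu>, \<nu>)"]) (auto simp: h ac_simps)
  also have "\<dots> = curv_pairing h Q P"
    by (simp only: curv_pairing_def sum_distrib_left sum_to_tuple6)
  finally show ?thesis .
qed

text \<open>The curvature is quadratic in the connection, so the Lagrangian has degree four in
  \<open>t\<close>; the linear coefficient is its first variation.\<close>

lemma curv_pairing_quadratic:
  assumes "transpose h = h"
  shows "curv_pairing h (\<lambda>k \<tau> \<mu> \<nu>. P k \<tau> \<mu> \<nu> + t * P1 k \<tau> \<mu> \<nu> + t^2 * P2 k \<tau> \<mu> \<nu>)
      (\<lambda>k \<tau> \<mu> \<nu>. P k \<tau> \<mu> \<nu> + t * P1 k \<tau> \<mu> \<nu> + t^2 * P2 k \<tau> \<mu> \<nu>) =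
    curv_pairing h P P + t * (2 * curv_pairing h P1 P)
     + t^2 * (2 * curv_pairing h P P2 + curv_pairing h P1 P1)
     + t^3 * (2 * curv_pairing h P1 P2) + t^4 * curv_pairing h P2 P2"
  using curv_pairing_commute[OF assms, of P P1] curv_pairing_commute[OF assms, of P P2] curv_pairing_commute[OF assms, of P1 P2]
  by (simp add: curv_pairing_add_left curv_pairing_scale_left
      curv_pairing_commute[OF assms, of _ "\<lambda>k \<tau> \<mu> \<nu>. P k \<tau> \<mu> \<nu> + t * P1 k \<tau> \<mu> \<nu> + t^2 * P2 k \<tau> \<mu> \<nu>"])
    (simp add: algebra_simps power2_eq_square power3_eq_cube power4_eq_xxxx)

lemma continuous_on_curv_pairing:
  assumes "\<And>i j. continuous_on S (\<lambda>x. h x $ i $ j)"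
    "\<And>k t \<mu> \<nu>. continuous_on S (\<lambda>x. P x k t \<mu> \<nu>)"
    "\<And>k t \<mu> \<nu>. continuous_on S (\<lambda>x. Q x k t \<mu> \<nu>)"
  shows "continuous_on S (\<lambda>x. curv_pairing (h x) (P x) (Q x))"
  unfolding curv_pairing_def by (intro continuous_intros assms)

lemma curvature_antisym: "curvature Gam x k t \<mu> \<nu> = - curvature Gam x k t \<nu> \<mu>"
  by (simp add: curvature_def)

lemma curv_up_antisym: "curv_up g Gam x k t \<mu> \<nu> = - curv_up g Gam x k t \<nu> \<mu>"
proof -
  have "curv_up g Gam x k t \<mu> \<nu> = (\<Sum>j i. ginv g x $ \<mu> $ i * ginv g x $ \<nu> $ j * curvature Gam x k t i j)"
    unfolding curv_up_def by (rule sum.swap)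
  also have "\<dots> = (\<Sum>j i. - (ginv g x $ \<nu> $ j * ginv g x $ \<mu> $ i * curvature Gam x k t j i))"
    by (intro sum.cong refl) (subst curvature_antisym, simp)
  finally show ?thesis by (simp add: curv_up_def sum_negf)
qed

section \<open>The curvature along a variation of the connection\<close>

definition curv_lin :: "conn \<Rightarrow> conn \<Rightarrow> vec4 \<Rightarrow> 4 \<Rightarrow> 4 \<Rightarrow> 4 \<Rightarrow> 4 \<Rightarrow> real" where
  "curv_lin Gam gam x k t \<mu> \<nu> = pd \<mu> (\<lambda>y. gam y k \<nu> t) x
     + (\<Sum>h. Gam x k \<mu> h * gam x h \<nu> t) - (\<Sum>h. gam x k \<nu> h * Gam x h \<mu> t)"

text \<open>The covariant exterior derivative of \<open>gam\<close>, regarded as a one-form in its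
  middle index with values in endomorphisms. Accordingly \<open>curv_lin\<close> adds to the partial
  derivative the commutator with \<open>Gam\<close>.\<close>

definition curv_first :: "conn \<Rightarrow> conn \<Rightarrow> vec4 \<Rightarrow> 4 \<Rightarrow> 4 \<Rightarrow> 4 \<Rightarrow> 4 \<Rightarrow> real" where
  "curv_first Gam gam x k t \<mu> \<nu> = curv_lin Gam gam x k t \<mu> \<nu> - curv_lin Gam gam x k t \<nu> \<mu>"

definition curv_second :: "conn \<Rightarrow> vec4 \<Rightarrow> 4 \<Rightarrow> 4 \<Rightarrow> 4 \<Rightarrow> 4 \<Rightarrow> real" where
  "curv_second gam x k t \<mu> \<nu> = (\<Sum>h. gam x k \<mu> h * gam x h \<nu> t) - (\<Sum>h. gam x k \<nu> h * gam x h \<mu> t)"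

lemma curvature_add_scaled:
  assumes "\<And>\<tau> \<mu> \<nu>. (\<lambda>y. Gam y \<tau> \<mu> \<nu>) differentiable at x" "\<And>\<tau> \<mu> \<nu>. (\<lambda>y. gam y \<tau> \<mu> \<nu>) differentiable at x"
  shows "curvature (\<lambda>x \<tau> \<mu> \<nu>. Gam x \<tau> \<mu> \<nu> + t * gam x \<tau> \<mu> \<nu>) x k \<tau> \<mu> \<nu> =
    curvature Gam x k \<tau> \<mu> \<nu> + t * curv_first Gam gam x k \<tau> \<mu> \<nu> + t^2 * curv_second gam x k \<tau> \<mu> \<nu>"
proof -
  have "pd r (\<lambda>y. Gam y i j c + t * gam y i j c) x = pd r (\<lambda>y. Gam y i j c) x + t * pd r (\<lambda>y. gam y i j c) x"
    for r i j c
    using assms by (subst pd_add) (auto simp: pd_mult)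
  then show ?thesis
    by (simp add: curvature_def curv_first_def curv_lin_def curv_second_def algebra_simps
      power2_eq_square sum.distrib flip: sum_distrib_left)
qed

text \<open>A pointwise integration by parts: the Yang-Mills equation supplies the terms that
  complete the pairing to a divergence. The factor 2 appears because the two antisymmetrised terms
  of \<open>curv_first\<close> contribute equally.\<close>

lemma sum_pd_eq_curv_pairing:
  assumes V: "open V" "x \<in> V"
    and g: "vol g x \<noteq> 0" and ym: "ym_equation_at g Gam x"
    and dU: "\<And>k t \<mu> \<nu>. (\<lambda>y. vol g y * curv_up g Gam y k t \<mu> \<nu>) differentiable at x"
    and dgam: "\<And>t \<mu> \<nu>. (\<lambda>y. gam y t \<mu> \<nu>) differentiable at x"
  shows "vol g x * curv_pairing (ginv g x) (curv_first Gam gam x) (curvature Gam x) =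
    2 * (\<Sum>\<mu> k t \<nu>.
      pd \<mu> (\<lambda>y. vol g y * curv_up g Gam y t k \<mu> \<nu> * gam y k \<nu> t) x)"
proof -
  define U where "U k t \<mu> \<nu> y = vol g y * curv_up g Gam y k t \<mu> \<nu>" for k t \<mu> \<nu> y
  have U_anti: "U k t \<mu> \<nu> = (\<lambda>y. - U k t \<nu> \<mu> y)" for k t \<mu> \<nu>
    unfolding U_def by (subst curv_up_antisym) simp
  have dU: "U k t \<mu> \<nu> differentiable at x" for k t \<mu> \<nu>
    using dU[of k t \<mu> \<nu>] unfolding U_def[abs_def] .
  let ?P = "curv_lin Gam gam x"
  \<comment> \<open>The equation times the volume density, with the form indices interchanged so
    that the divergence is taken over the first.\<close>
  have ym': "(\<Sum>\<mu>. pd \<mu> (U t k \<mu> \<nu>) x) =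
     (\<Sum>\<mu> h. Gam x h \<mu> k * U t h \<mu> \<nu> x) - (\<Sum>\<mu> h. Gam x t \<mu> h * U h k \<mu> \<nu> x)"
    for t k \<nu>
  proof -
    have "1 / vol g x * (\<Sum>\<mu>. pd \<mu> (U t k \<nu> \<mu>) x)
     + (\<Sum>\<mu> h. Gam x t \<mu> h * curv_up g Gam x h k \<nu> \<mu>)
     - (\<Sum>\<mu> h. Gam x h \<mu> k * curv_up g Gam x t h \<nu> \<mu>) = 0"
      using ym unfolding ym_equation_at_def U_def[abs_def] by blast
    then have "vol g x * (1 / vol g x * (\<Sum>\<mu>. pd \<mu> (U t k \<nu> \<mu>) x)
     + (\<Sum>\<mu> h. Gam x t \<mu> h * curv_up g Gam x h k \<nu> \<mu>)
     - (\<Sum>\<mu> h. Gam x h \<mu> k * curv_up g Gam x t h \<nu> \<mu>)) = 0"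
      by simp
    then have "(\<Sum>\<mu>. pd \<mu> (U t k \<nu> \<mu>) x)
     + (\<Sum>\<mu> h. Gam x t \<mu> h * U h k \<nu> \<mu> x)
     - (\<Sum>\<mu> h. Gam x h \<mu> k * U t h \<nu> \<mu> x) = 0"
      using g unfolding U_def by (simp add: distrib_left right_diff_distrib sum_distrib_left mult.left_commute)
    moreover have "pd \<mu> (U t k \<nu> \<mu>) x = - pd \<mu> (U t k \<mu> \<nu>) x" for \<mu>
      by (subst U_anti) (rule pd_minus[OF dU])
    moreover have "U a b \<nu> \<mu> x = - U a b \<mu> \<nu> x" for a b \<mu>
      by (subst U_anti) simp
    ultimately show ?thesis
      by (simp add: sum_negf)
  qed
  have "vol g x * curv_pairing (ginv g x) (curv_first Gam gam x) (curvature Gam x) =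
      (\<Sum>k t \<mu> \<nu>. (?P k t \<mu> \<nu> - ?P k t \<nu> \<mu>) * U t k \<mu> \<nu> x)"
    by (simp add: curv_pairing_def curv_first_def U_def curv_up_def sum_distrib_left mult.left_commute)
  also have "\<dots> = (\<Sum>k t. (\<Sum>\<mu> \<nu>. ?P k t \<mu> \<nu> * U t k \<mu> \<nu> x)
      - (\<Sum>\<nu> \<mu>. ?P k t \<nu> \<mu> * U t k \<mu> \<nu> x))"
    by (subst (2) sum.swap) (simp add: left_diff_distrib sum_subtractf)
  also have "\<dots> = (\<Sum>k t. (\<Sum>\<mu> \<nu>. ?P k t \<mu> \<nu> * U t k \<mu> \<nu> x)
      - (\<Sum>\<nu> \<mu>. - (?P k t \<nu> \<mu> * U t k \<nu> \<mu> x)))"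
    using fun_cong[OF U_anti, of _ _ _ _ x] by (metis (no_types, lifting) mult_minus_right sum.cong)
  also have "\<dots> = 2 * (\<Sum>k t \<mu> \<nu>. ?P k t \<mu> \<nu> * U t k \<mu> \<nu> x)"
    by (simp add: sum_negf sum_distrib_left)
  also have "(\<Sum>k t \<mu> \<nu>. ?P k t \<mu> \<nu> * U t k \<mu> \<nu> x) =
      (\<Sum>k t \<mu> \<nu>. pd \<mu> (\<lambda>y. gam y k \<nu> t) x * U t k \<mu> \<nu> x)
    + (\<Sum>k t \<mu> \<nu> h. Gam x k \<mu> h * gam x h \<nu> t * U t k \<mu> \<nu> x)
    - (\<Sum>k t \<mu> \<nu> h. gam x k \<nu> h * Gam x h \<mu> t * U t k \<mu> \<nu> x)"
    by (simp add: curv_lin_def distrib_right left_diff_distrib sum.distrib sum_subtractf sum_distrib_right)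
  \<comment> \<open>The indices are renamed until \<open>gam x k \<nu> t\<close> is a common factor,
    whose coefficient is then the right hand side of \<open>ym'\<close>.\<close>
  also have "(\<Sum>k t \<mu> \<nu> h. Gam x k \<mu> h * gam x h \<nu> t * U t k \<mu> \<nu> x) =
      (\<Sum>k t \<nu> \<mu> h. gam x k \<nu> t * (Gam x h \<mu> k * U t h \<mu> \<nu> x))"
    unfolding sum_to_tuple5
    by (rule sum.reindex_bij_witness[of _ "\<lambda>(k, t, \<nu>, \<mu>, h). (h, t, \<mu>, \<nu>, k)" "\<lambda>(k, t, \<mu>, \<nu>, h). (h, t, \<nu>, \<mu>, k)"])
      auto
  also have "(\<Sum>k t \<mu> \<nu> h. gam x k \<nu> h * Gam x h \<mu> t * U t k \<mu> \<nu> x) =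
      (\<Sum>k t \<nu> \<mu> h. gam x k \<nu> t * (Gam x t \<mu> h * U h k \<mu> \<nu> x))"
    unfolding sum_to_tuple5
    by (rule sum.reindex_bij_witness[of _ "\<lambda>(k, t, \<nu>, \<mu>, h). (k, h, \<mu>, \<nu>, t)" "\<lambda>(k, t, \<mu>, \<nu>, h). (k, h, \<nu>, \<mu>, t)"])
      auto
  also have "(\<Sum>k t \<mu> \<nu>. pd \<mu> (\<lambda>y. gam y k \<nu> t) x * U t k \<mu> \<nu> x)
     + (\<Sum>k t \<nu> \<mu> h. gam x k \<nu> t * (Gam x h \<mu> k * U t h \<mu> \<nu> x))
     - (\<Sum>k t \<nu> \<mu> h. gam x k \<nu> t * (Gam x t \<mu> h * U h k \<mu> \<nu> x))
     = (\<Sum>k t. (\<Sum>\<mu> \<nu>. pd \<mu> (\<lambda>y. gam y k \<nu> t) x * U t k \<mu> \<nu> x)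
      + (\<Sum>\<nu>. gam x k \<nu> t * (\<Sum>\<mu>. pd \<mu> (U t k \<mu> \<nu>) x)))"
    unfolding ym' by (simp add: sum_distrib_left right_diff_distrib sum_subtractf sum.distrib)
  also have "\<dots> = (\<Sum>k t \<mu> \<nu>. pd \<mu> (\<lambda>y. gam y k \<nu> t) x * U t k \<mu> \<nu> x
      + gam x k \<nu> t * pd \<mu> (U t k \<mu> \<nu>) x)"
  proof -
    have "(\<Sum>\<nu>. gam x k \<nu> t * (\<Sum>\<mu>. pd \<mu> (U t k \<mu> \<nu>) x)) =
      (\<Sum>\<mu> \<nu>. gam x k \<nu> t * pd \<mu> (U t k \<mu> \<nu>) x)" for k t
      unfolding sum_distrib_left by (rule sum.swap)
    then show ?thesis by (simp add: sum.distrib)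
  qed
  also have "\<dots> = (\<Sum>k t \<mu> \<nu>. pd \<mu> (\<lambda>y. U t k \<mu> \<nu> y * gam y k \<nu> t) x)"
    by (simp add: pd_mult dU dgam algebra_simps)
  also have "\<dots> = (\<Sum>\<mu> k t \<nu>. pd \<mu> (\<lambda>y. U t k \<mu> \<nu> y * gam y k \<nu> t) x)"
    unfolding sum_to_tuple4
    by (rule sum.reindex_bij_witness[of _ "\<lambda>(\<mu>, k, t, \<nu>). (k, t, \<mu>, \<nu>)" "\<lambda>(k, t, \<mu>, \<nu>). (\<mu>, k, t, \<nu>)"]) auto
  finally show ?thesis unfolding U_def[abs_def] by simp
qed

lemma integrable_on_compact:
  fixes f :: "'a::euclidean_space \<Rightarrow> 'b::euclidean_space"
  assumes "compact K" "continuous_on K f"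
  shows "f integrable_on K"
  using borel_integrable_compact[OF assms] set_borel_integral_eq_integral(1)
  unfolding set_integrable_def by blast

text \<open>The action is a polynomial in \<open>t\<close>, so its derivative at 0 is the integral
  of the linear coefficient, a sum of total derivatives of fields that vanish off
  \<open>K\<close>.\<close>

lemma EL_connection_if_ym_equation:
  assumes V: "open V"
    and g: "\<And>x. x \<in> V \<Longrightarrow> vol g x \<noteq> 0" "\<And>x. x \<in> V \<Longrightarrow> transpose (ginv g x) = ginv g x"
    and cont_g: "continuous_on V (vol g)" "\<And>\<mu> \<nu>. continuous_on V (\<lambda>x. ginv g x $ \<mu> $ \<nu>)"
    and Gam: "\<And>\<tau> \<mu> \<nu>. smooth_on V (\<lambda>x. Gam x \<tau> \<mu> \<nu>)"
    and dU: "\<And>k \<tau> \<mu> \<nu> x. x \<in> V \<Longrightarrow> (\<lambda>y. vol g y * curv_up g Gam y k \<tau> \<mu> \<nu>) differentiable at x"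
    and cU: "\<And>r k \<tau> \<mu> \<nu>. continuous_on V (pd r (\<lambda>y. vol g y * curv_up g Gam y k \<tau> \<mu> \<nu>))"
    and ym: "\<And>x. x \<in> V \<Longrightarrow> ym_equation_at g Gam x"
  shows "EL_connection V g Gam"
  unfolding EL_connection_def
proof (intro allI impI, elim conjE)
  fix K and gam :: conn
  assume K: "compact K" "K \<subseteq> V" and sm: "\<forall>\<tau> \<mu> \<nu>. smooth_on V (\<lambda>x. gam x \<tau> \<mu> \<nu>)"
    and zero: "\<forall>x\<in>V - K. \<forall>\<tau> \<mu> \<nu>. gam x \<tau> \<mu> \<nu> = 0"
  let ?B = "\<lambda>P Q x. vol g x * curv_pairing (ginv g x) (P x) (Q x)"
  let ?R = "curvature Gam" and ?R1 = "curv_first Gam gam" and ?R2 = "curv_second gam"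
  have dGam: "(\<lambda>y. Gam y \<tau> \<mu> \<nu>) differentiable at x" and dgam: "(\<lambda>y. gam y \<tau> \<mu> \<nu>) differentiable at x"
    if "x \<in> V" for x \<tau> \<mu> \<nu>
    using that V Gam sm by (auto intro: smooth_on_differentiable)
  have cGam: "continuous_on K (\<lambda>x. Gam x \<tau> \<mu> \<nu>)" "continuous_on K (pd r (\<lambda>x. Gam x \<tau> \<mu> \<nu>))"
    "continuous_on K (\<lambda>x. gam x \<tau> \<mu> \<nu>)" "continuous_on K (pd r (\<lambda>x. gam x \<tau> \<mu> \<nu>))"
    for r \<tau> \<mu> \<nu>
    using Gam sm by (auto intro!: continuous_on_subset[OF smooth_on_continuous[of V] K(2)] smooth_on_pd)
  have cR: "continuous_on K (\<lambda>x. ?R x k \<tau> \<mu> \<nu>)" "continuous_on K (\<lambda>x. ?R1 x k \<tau> \<mu> \<nu>)"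
    "continuous_on K (\<lambda>x. ?R2 x k \<tau> \<mu> \<nu>)" for k \<tau> \<mu> \<nu>
    unfolding curvature_def curv_first_def curv_lin_def curv_second_def
    by (intro continuous_intros cGam)+
  have cg: "continuous_on K (vol g)" "continuous_on K (\<lambda>x. ginv g x $ \<mu> $ \<nu>)" for \<mu> \<nu>
    using cont_g K(2) by (auto intro: continuous_on_subset)
  have int: "?B P Q integrable_on K"
    if "\<And>k \<tau> \<mu> \<nu>. continuous_on K (\<lambda>x. P x k \<tau> \<mu> \<nu>)" "\<And>k \<tau> \<mu> \<nu>. continuous_on K (\<lambda>x. Q x k \<tau> \<mu> \<nu>)" for P Q
    by (intro integrable_on_compact K(1) continuous_on_mult cg continuous_on_curv_pairing that)
  define c0 c1 c2 c3 c4 where c: "c0 = ?B ?R ?R" "c1 = (\<lambda>x. 2 * ?B ?R1 ?R x)"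
    "c2 = (\<lambda>x. 2 * ?B ?R ?R2 x + ?B ?R1 ?R1 x)" "c3 = (\<lambda>x. 2 * ?B ?R1 ?R2 x)" "c4 = ?B ?R2 ?R2"
  have intc: "c0 integrable_on K" "c1 integrable_on K" "c2 integrable_on K" "c3 integrable_on K" "c4 integrable_on K"
    unfolding c by (intro integrable_add integrable_on_mult_right int cR)+
  have action: "ym_action K g (\<lambda>x \<tau> \<mu> \<nu>. Gam x \<tau> \<mu> \<nu> + t * gam x \<tau> \<mu> \<nu>) =
      integral K c0 + t * integral K c1 + t^2 * integral K c2 + t^3 * integral K c3 + t^4 * integral K c4" for t
  proof -
    have "ym_action K g (\<lambda>x \<tau> \<mu> \<nu>. Gam x \<tau> \<mu> \<nu> + t * gam x \<tau> \<mu> \<nu>) =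
      integral K (\<lambda>x. c0 x + t * c1 x + t^2 * c2 x + t^3 * c3 x + t^4 * c4 x)"
      unfolding ym_action_def
    proof (rule integral_cong)
      fix x assume "x \<in> K"
      then have x: "x \<in> V" using K by blast
      have "curvature (\<lambda>x \<tau> \<mu> \<nu>. Gam x \<tau> \<mu> \<nu> + t * gam x \<tau> \<mu> \<nu>) x =
      (\<lambda>k \<tau> \<mu> \<nu>. ?R x k \<tau> \<mu> \<nu> + t * ?R1 x k \<tau> \<mu> \<nu> + t^2 * ?R2 x k \<tau> \<mu> \<nu>)"
      by (intro ext curvature_add_scaled dGam dgam x)
      then show "vol g x * ym_scalar g (\<lambda>x \<tau> \<mu> \<nu>. Gam x \<tau> \<mu> \<nu> + t * gam x \<tau> \<mu> \<nu>) x =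
      c0 x + t * c1 x + t^2 * c2 x + t^3 * c3 x + t^4 * c4 x"
      unfolding ym_scalar_eq c by (simp only: curv_pairing_quadratic[OF g(2)[OF x]]) (simp add: algebra_simps)
    qed
    also have "\<dots> = integral K c0 + t * integral K c1 + t^2 * integral K c2 + t^3 * integral K c3 + t^4 * integral K c4"
      using intc by (simp add: integral_add integrable_add integrable_on_mult_right)
    finally show ?thesis .
  qed
  \<comment> \<open>One factor 2 comes from the quadratic form, the other from antisymmetry.\<close>
  have "c1 x = (\<Sum>\<mu> k \<tau> \<nu>.
      4 * pd \<mu> (\<lambda>y. vol g y * curv_up g Gam y \<tau> k \<mu> \<nu> * gam y k \<nu> \<tau>) x)" if "x \<in> K" for x
  proof -
    have x: "x \<in> V" using that K by blast
    show ?thesis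
      unfolding c using sum_pd_eq_curv_pairing[OF V x g(1)[OF x] ym[OF x] dU[OF x] dgam[OF x]]
      by (simp add: sum_distrib_left)
  qed
  then have "integral K c1 = integral K (\<lambda>x. \<Sum>\<mu> k \<tau> \<nu>.
      4 * pd \<mu> (\<lambda>y. vol g y * curv_up g Gam y \<tau> k \<mu> \<nu> * gam y k \<nu> \<tau>) x)"
    by (rule integral_cong)
  also have "\<dots> = 0"
  proof -
    let ?F = "\<lambda>\<mu> k \<tau> \<nu> y. vol g y * curv_up g Gam y \<tau> k \<mu> \<nu> * gam y k \<nu> \<tau>"
    have cF: "continuous_on V (pd \<mu> (?F \<mu> k \<tau> \<nu>))" for \<mu> k \<tau> \<nu>
    proof -
      have "continuous_on V (\<lambda>x. pd \<mu> (\<lambda>y. vol g y * curv_up g Gam y \<tau> k \<mu> \<nu>) x * gam x k \<nu> \<tau>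
      + vol g x * curv_up g Gam x \<tau> k \<mu> \<nu> * pd \<mu> (\<lambda>y. gam y k \<nu> \<tau>) x)"
      using sm dU V
      by (intro continuous_on_add continuous_on_mult cU smooth_on_continuous smooth_on_pd differentiable_imp_continuous_on)
      (auto simp: differentiable_on_eq_differentiable_at)
      then show ?thesis
      by (rule continuous_on_cong[THEN iffD1, rotated 2]) (auto simp: pd_mult dU dgam)
    qed
    have iF: "pd \<mu> (?F \<mu> k \<tau> \<nu>) integrable_on K" for \<mu> k \<tau> \<nu>
      by (intro integrable_on_compact K(1) continuous_on_subset[OF cF K(2)])
    have zF: "integral K (pd \<mu> (?F \<mu> k \<tau> \<nu>)) = 0" for \<mu> k \<tau> \<nu>
      by (rule integral_pd_zero[OF V K _ cF]) (use zero dU dgam in auto)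
    show ?thesis
      by (simp add: integral_sum integrable_sum integrable_on_mult_right iF zF)
  qed
  finally have c1: "integral K c1 = 0" .
  show "((\<lambda>t. ym_action K g (\<lambda>x \<tau> \<mu> \<nu>. Gam x \<tau> \<mu> \<nu> + t * gam x \<tau> \<mu> \<nu>)) has_real_derivative 0) (at 0)"
    unfolding action c1 by (auto intro!: derivative_eq_intros)
qed

section \<open>Determinants and the volume density\<close>

text \<open>The derivative of the determinant at \<open>A\<close> in the direction \<open>H\<close>,
  by multilinearity in the rows.\<close>

definition det_deriv :: "real ^ 'n ^ 'n \<Rightarrow> ('n \<Rightarrow> 'n \<Rightarrow> real) \<Rightarrow> real" where
  "det_deriv A H = (\<Sum>i. det (\<chi> r. if r = i then (\<chi> c. H i c) else A $ r))"

lemma has_derivative_det: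
  fixes A :: "'a::real_normed_vector \<Rightarrow> real ^ 'n ^ 'n"
  assumes "\<And>i j. ((\<lambda>x. A x $ i $ j) has_derivative A' i j) (at x)"
  shows "((\<lambda>x. det (A x)) has_derivative (\<lambda>h. det_deriv (A x) (\<lambda>i j. A' i j h))) (at x)"
proof -
  have *: "(\<Prod>r\<in>UNIV. (\<chi> r. if r = i then (\<chi> c. A' i c h) else A x $ r) $ r $ p r) =
      A' i (p i) h * (\<Prod>r\<in>UNIV - {i}. A x $ r $ p r)" for i p h
    by (subst prod.remove[of UNIV i]) (auto intro!: prod.cong)
  have "((\<lambda>x. \<Sum>p\<in>{p. p permutes UNIV}. of_int (sign p) * (\<Prod>i\<in>UNIV. A x $ i $ p i)) has_derivative
     (\<lambda>h. \<Sum>p\<in>{p. p permutes UNIV}. of_int (sign p) * (\<Sum>i. A' i (p i) h * (\<Prod>r\<in>UNIV - {i}. A x $ r $ p r)))) (at x)"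
    by (intro has_derivative_sum has_derivative_mult_right has_derivative_prod assms)
  also have "(\<lambda>h. \<Sum>p\<in>{p. p permutes UNIV}. of_int (sign p) * (\<Sum>i. A' i (p i) h * (\<Prod>r\<in>UNIV - {i}. A x $ r $ p r)))
      = (\<lambda>h. det_deriv (A x) (\<lambda>i j. A' i j h))"
    unfolding det_deriv_def det_def * sum_distrib_left by (rule ext, rule sum.swap)
  finally show ?thesis unfolding det_def .
qed

text \<open>Both sides are the derivative at 0 of the determinant of \<open>A + t H\<close>,
  computed once for the matrix and once for its transpose.\<close>

lemma det_deriv_transpose: "det_deriv A H = det_deriv (transpose A) (\<lambda>i j. H j i)"
proof -
  have 1: "((\<lambda>t. det (\<chi> i j. A $ i $ j + t * H i j)) has_derivative
      (\<lambda>h. det_deriv (\<chi> i j. A $ i $ j + 0 * H i j) (\<lambda>i j. h * H i j))) (at 0)"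
    by (rule has_derivative_det) (auto intro!: derivative_eq_intros)
  have 2: "((\<lambda>t. det (\<chi> i j. A $ j $ i + t * H j i)) has_derivative
      (\<lambda>h. det_deriv (\<chi> i j. A $ j $ i + 0 * H j i) (\<lambda>i j. h * H j i))) (at 0)"
    by (rule has_derivative_det) (auto intro!: derivative_eq_intros)
  have 3: "(\<lambda>t. det (\<chi> i j. A $ j $ i + t * H j i)) = (\<lambda>t. det (\<chi> i j. A $ i $ j + t * H i j))"
    by (rule ext, subst det_transpose[symmetric]) (simp add: transpose_def)
  note has_derivative_unique[OF 1 2[unfolded 3]]
  from fun_cong[OF this, of 1] show ?thesis
    by (simp add: transpose_def)
qed

text \<open>Expanding the replaced row linearly, all summands but the one for \<open>k = i\<close>
  have two equal rows.\<close>

lemma det_replace_row_mult: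
  "det (\<chi> r. if r = i then (\<chi> c. \<Sum>k. b k * A $ k $ c) else A $ r) = b i * det (A :: real ^ 'n ^ 'n)"
proof -
  have "(\<chi> c. \<Sum>k. b k * A $ k $ c) = (\<Sum>k. b k *s A $ k)"
    by (simp add: vec_eq_iff)
  then have "det (\<chi> r. if r = i then (\<chi> c. \<Sum>k. b k * A $ k $ c) else A $ r) =
      det (\<chi> r. if r = i then (\<Sum>k. b k *s A $ k) else A $ r)"
    by (simp cong: if_cong)
  also have "\<dots> = (\<Sum>k. det (\<chi> r. if r = i then b k *s A $ k else A $ r))"
    using det_linear_row_sum[of UNIV i "\<lambda>_ k. b k *s A $ k" "\<lambda>r. A $ r"] by simp
  also have "\<dots> = (\<Sum>k. if k = i then b i * det A else 0)"
  proof (rule sum.cong)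
    fix k
    have "det (\<chi> r. if r = i then b k *s A $ k else A $ r) = b k * det (\<chi> r. if r = i then A $ k else A $ r)"
      using det_row_mul[of i "b k" "\<lambda>_. A $ k" "\<lambda>r. A $ r"] by simp
    moreover have "det (\<chi> r. if r = i then A $ k else A $ r) = 0" if "k \<noteq> i"
      by (rule det_identical_rows[OF that]) (use that in \<open>simp add: row_def vec_eq_iff\<close>)
    moreover have "(\<chi> r. if r = i then A $ i else A $ r) = A"
      by (simp add: vec_eq_iff)
    ultimately show "det (\<chi> r. if r = i then b k *s A $ k else A $ r) = (if k = i then b i * det A else 0)"
      by auto
  qed simp
  finally show ?thesis by simp
qed

text \<open>Jacobi's formula for a direction of the form \<open>b\<close> times \<open>A\<close>,
  free of adjugates.\<close>

lemma det_deriv_mult: "det_deriv A (\<lambda>i j. \<Sum>k. b i k * A $ k $ j) = (\<Sum>i. b i i) * det A"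
  by (simp add: det_deriv_def det_replace_row_mult[of _ "b _" A] sum_distrib_right)

lemma det_deriv_add: "det_deriv A (\<lambda>i j. H i j + H' i j) = det_deriv A H + det_deriv A H'"
proof -
  have *: "(\<chi> c. H i c + H' i c) = (\<chi> c. H i c) + (\<chi> c. H' i c)" for i
    by (simp add: vec_eq_iff)
  have "det (\<chi> r. if r = i then (\<chi> c. H i c + H' i c) else A $ r) =
     det (\<chi> r. if r = i then (\<chi> c. H i c) else A $ r) + det (\<chi> r. if r = i then (\<chi> c. H' i c) else A $ r)" for i
    using det_row_add[of i "\<lambda>_. \<chi> c. H i c" "\<lambda>_. \<chi> c. H' i c" "\<lambda>r. A $ r"]
    by (simp only: *)
  then show ?thesis by (simp add: det_deriv_def sum.distrib)
qed

text \<open>Vanishing of the covariant derivative of \<open>g\<close>, solved for the partial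
  derivative.\<close>

definition metric_compatible_at :: "metric \<Rightarrow> conn \<Rightarrow> vec4 \<Rightarrow> bool" where
  "metric_compatible_at g Gam x \<longleftrightarrow> (\<forall>\<mu> i j. pd \<mu> (\<lambda>y. g y $ i $ j) x =
     (\<Sum>k. Gam x k \<mu> i * g x $ k $ j) + (\<Sum>k. Gam x k \<mu> j * g x $ i $ k))"

text \<open>By compatibility the derivative of \<open>g\<close> is a product \<open>b g\<close> plus
  its transpose, and each of the two contributes the trace of \<open>b\<close>.\<close>

lemma pd_det_metric:
  assumes diff: "\<And>a b. (\<lambda>y. g y $ a $ b) differentiable at x"
    and sym: "transpose (g x) = g x" and compat: "metric_compatible_at g Gam x"
  shows "(\<lambda>y. det (g y)) differentiable at x" (is ?P1)
    and "pd \<mu> (\<lambda>y. det (g y)) x = 2 * (\<Sum>c. Gam x c \<mu> c) * det (g x)" (is ?P2)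
proof -
  have D: "((\<lambda>y. det (g y)) has_derivative
     (\<lambda>h. det_deriv (g x) (\<lambda>i j. frechet_derivative (\<lambda>y. g y $ i $ j) (at x) h))) (at x)"
    by (intro has_derivative_det has_derivative_pd diff)
  then show ?P1 by (rule differentiableI)
  have gs: "g x $ i $ j = g x $ j $ i" for i j
    using arg_cong[OF sym, of "\<lambda>m. m $ j $ i"] by (simp add: transpose_def)
  have "pd \<mu> (\<lambda>y. det (g y)) x = det_deriv (g x) (\<lambda>i j. pd \<mu> (\<lambda>y. g y $ i $ j) x)"
    using pdI[OF D, of \<mu>] by (simp add: pd_def)
  also have "\<dots> = det_deriv (g x) (\<lambda>i j. \<Sum>k. Gam x k \<mu> i * g x $ k $ j)
      + det_deriv (g x) (\<lambda>i j. \<Sum>k. Gam x k \<mu> j * g x $ i $ k)"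
    using compat by (simp add: metric_compatible_at_def det_deriv_add)
  also have "det_deriv (g x) (\<lambda>i j. \<Sum>k. Gam x k \<mu> j * g x $ i $ k) =
      det_deriv (g x) (\<lambda>i j. \<Sum>k. Gam x k \<mu> i * g x $ k $ j)"
    by (subst det_deriv_transpose) (simp add: sym gs)
  finally show ?P2
    using det_deriv_mult[of "g x" "\<lambda>i k. Gam x k \<mu> i"] by simp
qed

text \<open>Covering both signs avoids determining the sign of \<open>det (g x)\<close>.\<close>

lemma DERIV_sqrt_abs:
  assumes "z \<noteq> 0"
  shows "((\<lambda>z. sqrt \<bar>z\<bar>) has_real_derivative inverse (sqrt \<bar>z\<bar>) / 2 * sgn z) (at z)"
proof (cases "z > 0")
  case True
  have "((\<lambda>z. sqrt z) has_real_derivative inverse (sqrt \<bar>z\<bar>) / 2 * sgn z) (at z)"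
    using DERIV_real_sqrt[OF True] True by simp
  then show ?thesis
    by (rule has_field_derivative_transform_within_open[of _ _ _ "{0<..}"]) (use True in auto)
next
  case False
  then have z: "z < 0" using assms by simp
  have "((\<lambda>z. sqrt (- z)) has_real_derivative inverse (sqrt (- z)) / 2 * (- 1)) (at z)"
    by (rule DERIV_chain2[OF DERIV_real_sqrt]) (use z in \<open>auto intro!: derivative_eq_intros\<close>)
  then have "((\<lambda>z. sqrt (- z)) has_real_derivative inverse (sqrt \<bar>z\<bar>) / 2 * sgn z) (at z)"
    using z by simp
  then show ?thesis
    by (rule has_field_derivative_transform_within_open[of _ _ _ "{..<0}"]) (use z in auto)
qed

lemma pd_vol:
  assumes diff: "\<And>i j. (\<lambda>y. g y $ i $ j) differentiable at x"
    and sym: "transpose (g x) = g x" and compat: "metric_compatible_at g Gam x" and nz: "det (g x) \<noteq> 0"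
  shows "vol g differentiable at x" and "pd \<mu> (vol g) x = vol g x * (\<Sum>k. Gam x k \<mu> k)" (is ?P2)
proof -
  note det = pd_det_metric[OF diff sym compat]
  let ?D = "frechet_derivative (\<lambda>y. det (g y)) (at x)"
  have D: "((\<lambda>y. sqrt \<bar>det (g y)\<bar>) has_derivative
      (\<lambda>h. inverse (sqrt \<bar>det (g x)\<bar>) / 2 * (sgn (det (g x)) * ?D h))) (at x)"
    using has_derivative_compose[OF has_derivative_pd[OF det(1)] DERIV_sqrt_abs[OF nz, unfolded has_field_derivative_def]]
    by (simp add: mult.assoc)
  then show "vol g differentiable at x"
    unfolding vol_def[abs_def] by (rule differentiableI)
  have "pd \<mu> (vol g) x = inverse (sqrt \<bar>det (g x)\<bar>) / 2 * (sgn (det (g x)) * (2 * (\<Sum>k. Gam x k \<mu> k) * det (g x)))"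
    using pdI[OF D, of \<mu>] det(2)[of \<mu>] unfolding vol_def[abs_def] pd_def by simp
  also have "\<dots> = inverse (sqrt \<bar>det (g x)\<bar>) * \<bar>det (g x)\<bar> * (\<Sum>k. Gam x k \<mu> k)"
    by (simp add: abs_sgn)
  also have "inverse (sqrt \<bar>det (g x)\<bar>) * \<bar>det (g x)\<bar> = vol g x"
    by (simp add: vol_def inverse_eq_divide real_div_sqrt)
  finally show ?P2 .
qed

section \<open>The Levi-Civita symbol\<close>

definition rows4 :: "(4 \<Rightarrow> real) \<Rightarrow> (4 \<Rightarrow> real) \<Rightarrow> (4 \<Rightarrow> real) \<Rightarrow> (4 \<Rightarrow> real) \<Rightarrow> real ^ 4 ^ 4" where
  "rows4 a b c d = (\<chi> i j. if i = 0 then a j else if i = 1 then b j else if i = 2 then c j else d j)"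

text \<open>Identifies index tuples with maps on the index type, which links the Levi-Civita symbol
  to permutations.\<close>

definition quad :: "'a \<Rightarrow> 'a \<Rightarrow> 'a \<Rightarrow> 'a \<Rightarrow> 4 \<Rightarrow> 'a" where
  "quad a b c d i = (if i = 0 then a else if i = 1 then b else if i = 2 then c else d)"

lemma four_eq_zero [simp]: "(4::4) = 0"
  by simp

lemma UNIV_4': "UNIV = {0, 1, 2, 3::4}"
  using UNIV_4 by (simp add: insert_commute)

lemma all_4': "(\<forall>i::4. P i) \<longleftrightarrow> P 0 \<and> P 1 \<and> P 2 \<and> P 3"
  using forall_4[of P] by auto

lemma quad_simps [simp]: "quad a b c d 0 = a" "quad a b c d 1 = b" "quad a b c d 2 = c" "quad a b c d 3 = d"
  by (simp_all add: quad_def)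

lemma quad_eta [simp]: "quad (p 0) (p 1) (p 2) (p 3) = p"
  by (rule ext) (simp add: quad_def, metis exhaust_4 four_eq_zero)

lemma levi_civita_quad: "levi_civita a b c d = (if bij (quad a b c d) then of_int (sign (quad a b c d)) else 0)"
  by (simp add: levi_civita_def quad_def[abs_def])

lemma prod_rows4: "(\<Prod>i\<in>UNIV. rows4 a b c d $ i $ p i) = a (p 0) * (b (p 1) * (c (p 2) * d (p 3)))"
  unfolding UNIV_4' by (simp add: rows4_def)

lemma permutes_iff_bij: "p permutes UNIV \<longleftrightarrow> bij p"
  by (simp add: permutes_def bij_iff)

text \<open>Read as self-maps of the index type, the tuples that are no permutations contribute 0;
  the rest is the Leibniz formula.\<close>

lemma det_rows4:
  "det (rows4 a b c d) = (\<Sum>u j \<gamma> \<delta>. levi_civita u j \<gamma> \<delta> * a u * b j * c \<gamma> * d \<delta>)"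
proof -
  have "(\<Sum>u j \<gamma> \<delta>. levi_civita u j \<gamma> \<delta> * a u * b j * c \<gamma> * d \<delta>)
     = (\<Sum>p\<in>(UNIV :: (4 \<Rightarrow> 4) set). levi_civita (p 0) (p 1) (p 2) (p 3) * a (p 0) * b (p 1) * c (p 2) * d (p 3))"
    unfolding sum_to_tuple4
    by (rule sum.reindex_bij_witness[of _ "\<lambda>p. (p 0, p 1, p 2, p 3)" "\<lambda>(u, j, \<gamma>, \<delta>). quad u j \<gamma> \<delta>"]) auto
  also have "\<dots> = (\<Sum>p. if p permutes UNIV then of_int (sign p) * (\<Prod>i\<in>UNIV. rows4 a b c d $ i $ p i) else 0)"
    by (intro sum.cong refl) (simp add: levi_civita_quad prod_rows4 permutes_iff_bij mult.assoc)
  also have "\<dots> = det (rows4 a b c d)"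
    by (simp add: det_def sum.If_cases)
  finally show ?thesis ..
qed

lemma levi_civita_comp_transpose:
  fixes p :: "4 \<Rightarrow> 4"
  assumes "i \<noteq> j"
  shows "(if bij (p \<circ> Transposition.transpose i j) then of_int (sign (p \<circ> Transposition.transpose i j)) else 0 :: real)
     = - (if bij p then of_int (sign p) else 0)"
proof (cases "bij p")
  case True
  then have "p permutes UNIV" by (simp add: permutes_iff_bij)
  then have "permutation p" by (auto simp: permutation_permutes)
  then have "sign (p \<circ> Transposition.transpose i j) = sign p * sign (Transposition.transpose i j)"
    by (intro sign_compose) (auto simp: permutation_swap_id)
  then show ?thesis
    using True assms by (simp add: sign_swap_id bij_comp)
next
  case False
  have "\<not> bij (p \<circ> Transposition.transpose i j)"
  proof
    assume "bij (p \<circ> Transposition.transpose i j)"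
    then have "bij (p \<circ> Transposition.transpose i j \<circ> Transposition.transpose i j)"
      by (rule bij_comp[rotated]) simp
    then show False using False by (simp add: o_assoc[symmetric])
  qed
  then show ?thesis using False by simp
qed

lemma quad_transpose:
  "quad a b c d \<circ> Transposition.transpose 0 1 = quad b a c d"
  "quad a b c d \<circ> Transposition.transpose 1 2 = quad a c b d"
  "quad a b c d \<circ> Transposition.transpose 2 3 = quad a b d c"
  by (simp_all add: fun_eq_iff all_4' Transposition.transpose_def)

lemma levi_civita_swap:
  "levi_civita b a c d = - levi_civita a b c d"
  "levi_civita a c b d = - levi_civita a b c d"
  "levi_civita a b d c = - levi_civita a b c d"
  using levi_civita_comp_transpose[of 0 1 "quad a b c d"] levi_civita_comp_transpose[of 1 2 "quad a b c d"]
    levi_civita_comp_transpose[of 2 3 "quad a b c d"]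
  unfolding quad_transpose levi_civita_quad by simp_all

section \<open>Null frames\<close>

definition ctr :: "(4 \<Rightarrow> real) \<Rightarrow> (4 \<Rightarrow> real) \<Rightarrow> real" where
  "ctr p v = (\<Sum>i. p i * v i)"

definition low :: "real ^ 4 ^ 4 \<Rightarrow> (4 \<Rightarrow> real) \<Rightarrow> 4 \<Rightarrow> real" where
  "low Q u \<mu> = (\<Sum>i. Q $ \<mu> $ i * u i)"

lemma ctr_simps:
  "ctr (\<lambda>i. p i + q i) v = ctr p v + ctr q v"
  "ctr (\<lambda>i. p i - q i) v = ctr p v - ctr q v"
  "ctr (\<lambda>i. - p i) v = - ctr p v"
  "ctr (\<lambda>i. c * p i) v = c * ctr p v"
  "ctr (\<lambda>i. p i * c) v = ctr p v * c"
  "ctr (\<lambda>i. p i / c) v = ctr p v / c"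
  "ctr (\<lambda>i. 0) v = 0"
  by (simp_all add: ctr_def distrib_right left_diff_distrib sum.distrib sum_subtractf sum_negf)
     (simp_all add: sum_distrib_left sum_distrib_right sum_divide_distrib mult_ac)

lemma ctr_simps_right:
  "ctr p (\<lambda>i. v i + w i) = ctr p v + ctr p w"
  "ctr p (\<lambda>i. v i - w i) = ctr p v - ctr p w"
  "ctr p (\<lambda>i. - v i) = - ctr p v"
  "ctr p (\<lambda>i. c * v i) = c * ctr p v"
  "ctr p (\<lambda>i. v i * c) = ctr p v * c"
  "ctr p (\<lambda>i. v i / c) = ctr p v / c"
  "ctr p (\<lambda>i. 0) = 0"
  by (simp_all add: ctr_def distrib_left right_diff_distrib sum.distrib sum_subtractf sum_negf)
     (simp_all add: sum_distrib_left sum_distrib_right sum_divide_distrib mult_ac)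

lemma low_simps:
  "low Q (\<lambda>i. v i + w i) = (\<lambda>\<mu>. low Q v \<mu> + low Q w \<mu>)"
  "low Q (\<lambda>i. v i - w i) = (\<lambda>\<mu>. low Q v \<mu> - low Q w \<mu>)"
  "low Q (\<lambda>i. c * v i) = (\<lambda>\<mu>. c * low Q v \<mu>)"
  "low Q (\<lambda>i. v i * c) = (\<lambda>\<mu>. low Q v \<mu> * c)"
  "low Q (\<lambda>i. 0) = (\<lambda>\<mu>. 0)"
  by (simp_all add: low_def distrib_left right_diff_distrib sum.distrib sum_subtractf
      sum_distrib_left sum_distrib_right mult_ac fun_eq_iff)

lemma ctr_axis: "ctr p (\<lambda>i. if i = j then 1 else 0) = p j"
  by (simp add: ctr_def if_distrib[where f = "(*) _"] cong: if_cong)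

lemma ctr_swap: "ctr (\<lambda>b. ctr (\<lambda>a. F a b) u) v = ctr (\<lambda>a. ctr (\<lambda>b. F a b) v) u"
proof -
  have "ctr (\<lambda>b. ctr (\<lambda>a. F a b) u) v = (\<Sum>b a. F a b * u a * v b)"
    by (simp add: ctr_def sum_distrib_right)
  also have "\<dots> = (\<Sum>a b. F a b * v b * u a)"
    by (subst sum.swap) (simp add: mult_ac)
  finally show ?thesis
    by (simp add: ctr_def sum_distrib_right)
qed

lemma ctr_low_commute:
  assumes "transpose Q = Q"
  shows "ctr (low Q u) v = ctr (low Q v) u"
proof -
  have Q: "Q $ i $ j = Q $ j $ i" for i j
    using arg_cong[OF assms, of "\<lambda>m. m $ j $ i"] by (simp add: transpose_def)
  have "ctr (low Q u) v = (\<Sum>\<mu> a. Q $ \<mu> $ a * u a * v \<mu>)"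
    by (simp add: ctr_def low_def sum_distrib_right)
  also have "\<dots> = (\<Sum>a \<mu>. Q $ a $ \<mu> * v \<mu> * u a)"
    by (subst sum.swap) (simp add: Q mult_ac)
  also have "\<dots> = ctr (low Q v) u"
    by (simp add: ctr_def low_def sum_distrib_right)
  finally show ?thesis .
qed

lemma
  fixes A :: "real ^ 'n ^ 'n"
  assumes "invertible A"
  shows matrix_inv_right: "A ** matrix_inv A = mat 1"
    and matrix_inv_left: "matrix_inv A ** A = mat 1"
proof -
  have "A ** matrix_inv A = mat 1 \<and> matrix_inv A ** A = mat 1"
    unfolding matrix_inv_def by (rule someI_ex) (use assms in \<open>simp add: invertible_def\<close>)
  then show "A ** matrix_inv A = mat 1" "matrix_inv A ** A = mat 1" by auto
qed

text \<open>The normalisation in which \<open>l\<close> and \<open>n\<close> have product 2 suits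
  the Pauli matrices, whose components form such a frame; it is the source of the halves below. The
  expansion \<open>complete\<close> is included because all computations proceed by expanding and
  contracting.\<close>

locale null_frame =
  fixes Q :: "real ^ 4 ^ 4" and l n m1 m2 :: "4 \<Rightarrow> real"
  assumes Q_sym: "transpose Q = Q"
    and complete: "v i = ctr (low Q n) v / 2 * l i + ctr (low Q l) v / 2 * n i
      - ctr (low Q m1) v * m1 i - ctr (low Q m2) v * m2 i"
    and products: "ctr (low Q l) l = 0" "ctr (low Q l) n = 2" "ctr (low Q l) m1 = 0" "ctr (low Q l) m2 = 0"
      "ctr (low Q n) l = 2" "ctr (low Q n) n = 0" "ctr (low Q n) m1 = 0" "ctr (low Q n) m2 = 0"
      "ctr (low Q m1) l = 0" "ctr (low Q m1) n = 0" "ctr (low Q m1) m1 = - 1" "ctr (low Q m1) m2 = 0"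
      "ctr (low Q m2) l = 0" "ctr (low Q m2) n = 0" "ctr (low Q m2) m1 = 0" "ctr (low Q m2) m2 = - 1"
begin

abbreviation "L \<equiv> low Q l"
abbreviation "N \<equiv> low Q n"
abbreviation "M1 \<equiv> low Q m1"
abbreviation "M2 \<equiv> low Q m2"

lemma ctr_commute: "ctr (low Q u) v = ctr (low Q v) u"
  by (rule ctr_low_commute[OF Q_sym])

lemma complete_ctr:
  "ctr p v = ctr N v / 2 * ctr p l + ctr L v / 2 * ctr p n - ctr M1 v * ctr p m1 - ctr M2 v * ctr p m2"
proof -
  have "ctr p v = ctr p (\<lambda>i. ctr N v / 2 * l i + ctr L v / 2 * n i - ctr M1 v * m1 i - ctr M2 v * m2 i)"
    by (rule arg_cong[of _ _ "ctr p"], rule ext, rule complete)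
  then show ?thesis by (simp only: ctr_simps_right)
qed

lemma complete_covector:
  "p i = ctr p l / 2 * N i + ctr p n / 2 * L i - ctr p m1 * M1 i - ctr p m2 * M2 i"
  using complete_ctr[of p "\<lambda>j. if j = i then 1 else 0"] unfolding ctr_axis by (simp add: mult_ac)

text \<open>The contraction of the vanishing three-form with \<open>n\<close>, on which
  \<open>L\<close> takes the value 2, can be solved for \<open>f\<close>.\<close>

lemma two_form_annihilated_by_L:
  assumes anti: "\<And>\<mu> \<nu>. f \<mu> \<nu> = - f \<nu> \<mu>"
    and wedge: "\<And>t \<mu> \<nu>. f \<mu> \<nu> * L t + f \<nu> t * L \<mu> + f t \<mu> * L \<nu> = 0"
  defines "h \<equiv> \<lambda>\<nu>. ctr (\<lambda>i. f i \<nu>) n"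
  shows "f \<mu> \<nu> = (L \<mu> * h \<nu> - h \<mu> * L \<nu>) / 2" (is ?P1) and "ctr h n = 0"
proof -
  have "ctr (\<lambda>t. f \<mu> \<nu> * L t + f \<nu> t * L \<mu> + f t \<mu> * L \<nu>) n = 0"
    by (simp add: wedge ctr_simps)
  moreover have "ctr (\<lambda>t. f \<nu> t) n = - h \<nu>"
    unfolding h_def by (subst anti) (simp add: ctr_simps)
  ultimately show ?P1
    by (simp add: ctr_simps products h_def algebra_simps)
  have "ctr h n = (\<Sum>\<nu> i. f i \<nu> * n i * n \<nu>)"
    by (simp add: h_def ctr_def sum_distrib_right)
  also have "\<dots> = (\<Sum>i \<nu>. - (f \<nu> i * n \<nu> * n i))"
    by (subst sum.swap) (subst anti, simp add: mult_ac)
  also have "\<dots> = - ctr h n"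
    by (simp add: h_def ctr_def sum_distrib_right sum_negf)
  finally show "ctr h n = 0" by simp
qed

text \<open>The components along \<open>m1\<close> and \<open>m2\<close> say that \<open>f1\<close>
  and \<open>f2\<close> have zero wedge product with \<open>L\<close>, so each is \<open>L\<close>
  wedge some \<open>h\<close>. The component along \<open>l\<close> then links them: it removes the
  \<open>N\<close> part of both \<open>h\<close> and makes the matrix of their remaining components
  symmetric.\<close>

lemma first_Bianchi:
  assumes anti: "\<And>\<mu> \<nu>. f1 \<mu> \<nu> = - f1 \<nu> \<mu>" "\<And>\<mu> \<nu>. f2 \<mu> \<nu> = - f2 \<nu> \<mu>"
  defines "R \<equiv> \<lambda>\<kappa> t \<mu> \<nu>. f1 \<mu> \<nu> * (m1 \<kappa> * L t - l \<kappa> * M1 t) + f2 \<mu> \<nu> * (m2 \<kappa> * L t - l \<kappa> * M2 t)"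
  assumes bianchi: "\<And>\<kappa> t \<mu> \<nu>. R \<kappa> t \<mu> \<nu> + R \<kappa> \<mu> \<nu> t + R \<kappa> \<nu> t \<mu> = 0"
  defines "S \<equiv> \<lambda>f k. ctr (\<lambda>\<nu>. ctr (\<lambda>i. f i \<nu>) n) k"
  shows "f1 \<mu> \<nu> = - (S f1 m1 * (L \<mu> * M1 \<nu> - M1 \<mu> * L \<nu>) + S f1 m2 * (L \<mu> * M2 \<nu> - M2 \<mu> * L \<nu>)) / 2" (is ?P1)
    and "f2 \<mu> \<nu> = - (S f2 m1 * (L \<mu> * M1 \<nu> - M1 \<mu> * L \<nu>) + S f2 m2 * (L \<mu> * M2 \<nu> - M2 \<mu> * L \<nu>)) / 2" (is ?P2)
    and "S f1 m2 = S f2 m1"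
proof -
  have c: "ctr (\<lambda>\<kappa>. R \<kappa> t \<mu> \<nu> + R \<kappa> \<mu> \<nu> t + R \<kappa> \<nu> t \<mu>) p = 0" for p t \<mu> \<nu>
    by (simp add: bianchi ctr_simps)
  have q: "ctr l M1 = 0" "ctr l M2 = 0" "ctr m1 M1 = - 1" "ctr m1 M2 = 0" "ctr m2 M1 = 0" "ctr m2 M2 = - 1"
     "ctr l N = 2" "ctr m1 N = 0" "ctr m2 N = 0"
    using products by (simp_all add: ctr_def mult.commute)
  have w1: "f1 \<mu> \<nu> * L t + f1 \<nu> t * L \<mu> + f1 t \<mu> * L \<nu> = 0" for t \<mu> \<nu>
    using c[where p = M1, of t \<mu> \<nu>] by (simp add: R_def ctr_simps q)
  have w2: "f2 \<mu> \<nu> * L t + f2 \<nu> t * L \<mu> + f2 t \<mu> * L \<nu> = 0" for t \<mu> \<nu>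
    using c[where p = M2, of t \<mu> \<nu>] by (simp add: R_def ctr_simps q)
  have w3: "f1 \<mu> \<nu> * M1 t + f1 \<nu> t * M1 \<mu> + f1 t \<mu> * M1 \<nu> + (f2 \<mu> \<nu> * M2 t + f2 \<nu> t * M2 \<mu> + f2 t \<mu> * M2 \<nu>) = 0"
    for t \<mu> \<nu>
    using c[where p = N, of t \<mu> \<nu>] by (simp add: R_def ctr_simps q)
  define h1 where "h1 \<nu> = ctr (\<lambda>i. f1 i \<nu>) n" for \<nu>
  define h2 where "h2 \<nu> = ctr (\<lambda>i. f2 i \<nu>) n" for \<nu>
  have f1: "f1 \<mu> \<nu> = (L \<mu> * h1 \<nu> - h1 \<mu> * L \<nu>) / 2" and h1n: "ctr h1 n = 0" for \<mu> \<nu>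
    using two_form_annihilated_by_L[of f1, OF anti(1) w1] unfolding h1_def by blast+
  have f2: "f2 \<mu> \<nu> = (L \<mu> * h2 \<nu> - h2 \<mu> * L \<nu>) / 2" and h2n: "ctr h2 n = 0" for \<mu> \<nu>
    using two_form_annihilated_by_L[of f2, OF anti(2) w2] unfolding h2_def by blast+
  have e: "ctr (\<lambda>t. ctr (\<lambda>\<mu>. ctr (\<lambda>\<nu>. f1 \<mu> \<nu> * M1 t + f1 \<nu> t * M1 \<mu> + f1 t \<mu> * M1 \<nu>
      + (f2 \<mu> \<nu> * M2 t + f2 \<nu> t * M2 \<mu> + f2 t \<mu> * M2 \<nu>)) u) v) w = 0" for u v w
    by (simp add: w3 ctr_simps)
  \<comment> \<open>The value of the three-form on \<open>l\<close>, \<open>n\<close>,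
    \<open>m1\<close> isolates the \<open>N\<close> component of \<open>h1\<close>.\<close>
  have "ctr h1 l = 0" using e[of l n m1]
    unfolding f1 f2 by (simp add: ctr_simps products h1n h2n)
  moreover have "ctr h2 l = 0" using e[of l n m2]
    unfolding f1 f2 by (simp add: ctr_simps products h1n h2n)
  ultimately have h: "h1 \<nu> = - ctr h1 m1 * M1 \<nu> - ctr h1 m2 * M2 \<nu>" "h2 \<nu> = - ctr h2 m1 * M1 \<nu> - ctr h2 m2 * M2 \<nu>" for \<nu>
    using complete_covector[of h1 \<nu>] complete_covector[of h2 \<nu>] h1n h2n by simp_all
  have S: "S f1 = ctr h1" "S f2 = ctr h2"
    unfolding S_def h1_def h2_def by auto
  show ?P1
    unfolding S by (subst f1, subst (1 2) h(1)) (simp add: algebra_simps)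
  show ?P2
    unfolding S by (subst f2, subst (1 2) h(2)) (simp add: algebra_simps)
  show "S f1 m2 = S f2 m1" using e[of n m1 m2]
    unfolding f1 f2 S by (simp add: ctr_simps products h1n h2n)
qed

text \<open>The hypothesis is \<open>ds \<and> l \<and> m1 + dt \<and> l \<and> m2 = 0\<close>, with \<open>s\<close>, \<open>t\<close> standing for \<open>ds\<close>, \<open>dt\<close>.\<close>

lemma second_Bianchi:
  assumes "\<And>r \<mu> \<nu>.
      (s r * (L \<mu> * M1 \<nu> - M1 \<mu> * L \<nu>) + t r * (L \<mu> * M2 \<nu> - M2 \<mu> * L \<nu>))
    + (s \<mu> * (L \<nu> * M1 r - M1 \<nu> * L r) + t \<mu> * (L \<nu> * M2 r - M2 \<nu> * L r))
    + (s \<nu> * (L r * M1 \<mu> - M1 r * L \<mu>) + t \<nu> * (L r * M2 \<mu> - M2 r * L \<mu>)) = 0"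
  shows "ctr s l = 0" "ctr t l = 0" "ctr s m2 = ctr t m1"
proof -
  have e: "ctr (\<lambda>r. ctr (\<lambda>\<mu>. ctr (\<lambda>\<nu>. (s r * (L \<mu> * M1 \<nu> - M1 \<mu> * L \<nu>) + t r * (L \<mu> * M2 \<nu> - M2 \<mu> * L \<nu>))
    + (s \<mu> * (L \<nu> * M1 r - M1 \<nu> * L r) + t \<mu> * (L \<nu> * M2 r - M2 \<nu> * L r))
    + (s \<nu> * (L r * M1 \<mu> - M1 r * L \<mu>) + t \<nu> * (L r * M2 \<mu> - M2 r * L \<mu>))) u) v) w = 0" for u v w
    by (simp add: assms ctr_simps)
  \<comment> \<open>Evaluating the three-form on a triple of frame vectors isolates one condition at
    a time.\<close>
  show "ctr s l = 0" using e[of m1 n l] by (simp add: ctr_simps products)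
  show "ctr t l = 0" using e[of m2 n l] by (simp add: ctr_simps products)
  show "ctr s m2 = ctr t m1" using e[of m2 m1 n] by (simp add: ctr_simps products)
qed

text \<open>Such a form is built from \<open>L\<close>, \<open>M1\<close>, \<open>M2\<close> alone,
  and the third exterior power of a three-dimensional space is a line. The half stems from
  \<open>ctr L n = 2\<close>.\<close>

lemma three_form_annihilated_by_l:
  assumes anti: "\<And>a b c. W b a c = - W a b c" "\<And>a b c. W a c b = - W a b (c::4)"
    and l: "\<And>b c. ctr (\<lambda>a. W a b c) l = 0"
  shows "W a b c = ctr (\<lambda>c. ctr (\<lambda>b. ctr (\<lambda>a. W a b c) n) m1) m2 / 2 *
    (L a * (M1 b * M2 c - M2 b * M1 c) + M1 a * (M2 b * L c - L b * M2 c) + M2 a * (L b * M1 c - M1 b * L c))"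
proof -
  define w1 where "w1 u b c = ctr (\<lambda>a. W a b c) u" for u b c
  define w2 where "w2 u v c = ctr (\<lambda>b. w1 u b c) v" for u v c
  define w3 where "w3 u v w = ctr (\<lambda>c. w2 u v c) w" for u v w
  have w1: "w1 u c b = - w1 u b c" for u b c
    unfolding w1_def by (subst anti(2)) (simp only: ctr_simps)
  have w2: "w2 u v c = - w2 v u c" for u v c
  proof -
    have "w2 u v c = ctr (\<lambda>a. ctr (\<lambda>b. - W b a c) v) u"
      unfolding w2_def w1_def by (subst ctr_swap) (subst anti(1), rule refl)
    also have "\<dots> = - w2 v u c"
      by (simp only: ctr_simps w2_def w1_def)
    finally show ?thesis .
  qed
  have w3a: "w3 u v w = - w3 v u w" for u v w
  proof -
    have "w3 u v w = ctr (\<lambda>c. - w2 v u c) w"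
      unfolding w3_def by (intro arg_cong[of _ _ "\<lambda>f. ctr f w"] ext) (rule w2)
    then show ?thesis by (simp only: ctr_simps w3_def)
  qed
  have w3b: "w3 u v w = - w3 u w v" for u v w
  proof -
    have "w3 u v w = ctr (\<lambda>b. ctr (\<lambda>c. - w1 u c b) w) v"
      unfolding w3_def w2_def
      by (subst ctr_swap) (intro arg_cong[of _ _ "\<lambda>f. ctr f _"] ext, rule w1)
    also have "\<dots> = - w3 u w v"
      by (simp only: ctr_simps w3_def w2_def)
    finally show ?thesis .
  qed
  have l1: "w1 l b c = 0" for b c by (simp add: w1_def l)
  then have l2: "w2 u l c = 0" for u c by (subst w2) (simp add: w2_def ctr_simps)
  have l3: "w3 u v l = 0" for u v by (subst w3b) (simp add: w3_def l2 ctr_simps)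
  have e1: "W a b c = w1 n b c / 2 * L a - w1 m1 b c * M1 a - w1 m2 b c * M2 a" for a b c
    using complete_covector[of "\<lambda>a. W a b c" a] by (simp add: l1 flip: w1_def)
  have e2: "w1 u b c = w2 u n c / 2 * L b - w2 u m1 c * M1 b - w2 u m2 c * M2 b" for u b c
    using complete_covector[of "\<lambda>b. w1 u b c" b] by (simp add: l2 flip: w2_def)
  have e3: "w2 u v c = w3 u v n / 2 * L c - w3 u v m1 * M1 c - w3 u v m2 * M2 c" for u v c
    using complete_covector[of "\<lambda>c. w2 u v c" c] by (simp add: l3 flip: w3_def)
  have z: "w3 u u v = 0" "w3 u v v = 0" "w3 u v u = 0" for u v
    using w3a[of u u v] w3b[of u v v] w3a[of u v u] w3b[of v u u] by simp_all
  define c0 where "c0 = w3 n m1 m2"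
  have v: "w3 n m1 m2 = c0" "w3 n m2 m1 = - c0" "w3 m1 n m2 = - c0" "w3 m2 n m1 = c0" "w3 m1 m2 n = c0" "w3 m2 m1 n = - c0"
    using w3a[of m1 n m2] w3a[of m2 n m1] w3b[of n m2 m1] w3b[of m1 m2 n] w3b[of m2 m1 n]
    by (simp_all add: c0_def)
  have "W a b c = c0 / 2 *
    (L a * (M1 b * M2 c - M2 b * M1 c) + M1 a * (M2 b * L c - L b * M2 c) + M2 a * (L b * M1 c - M1 b * L c))"
    unfolding e1[of a] e2[of _ b] e3[of _ _ c] z v by (simp add: field_simps)
  then show ?thesis
    by (simp add: c0_def w3_def w2_def w1_def)
qed

lemma ginv_frame:
  assumes "invertible Q"
  shows "matrix_inv Q $ a $ b = (l a * n b + n a * l b) / 2 - m1 a * m1 b - m2 a * m2 b"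
proof -
  let ?H = "\<chi> a b. (l a * n b + n a * l b) / 2 - m1 a * m1 b - m2 a * m2 b"
  have "(\<Sum>b. ?H $ a $ b * Q $ b $ c) = (if a = c then 1 else 0)" for a c
  proof -
    have Qs: "Q $ i $ j = Q $ j $ i" for i j
      using arg_cong[OF Q_sym, of "\<lambda>m. m $ j $ i"] by (simp add: transpose_def)
    let ?e = "\<lambda>b. if b = c then 1 else 0 :: real"
    have "(\<Sum>b. ?H $ a $ b * Q $ b $ c) = ctr (\<lambda>b. Q $ b $ c) (\<lambda>b. (l a * n b + n a * l b) / 2 - m1 a * m1 b - m2 a * m2 b)"
      by (simp add: ctr_def mult.commute)
    also have "\<dots> = (l a * N c + n a * L c) / 2 - m1 a * M1 c - m2 a * M2 c"
      by (simp add: ctr_simps_right low_def[of Q _ c, unfolded Qs[of c], folded ctr_def])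
    also have "\<dots> = ?e a"
      using complete[of ?e a] unfolding ctr_axis by (simp add: field_simps)
    finally show ?thesis .
  qed
  then have "?H ** Q = mat 1"
    by (simp add: matrix_matrix_mult_def mat_def vec_eq_iff)
  then have "?H ** Q ** matrix_inv Q = matrix_inv Q" by simp
  then have "matrix_inv Q = ?H"
    by (simp add: matrix_inv_right[OF assms] flip: matrix_mul_assoc)
  then show ?thesis by simp
qed

end

section \<open>Null frames recognised by the inverse metric\<close>

definition frame_metric :: "real ^ 4 ^ 4" where
  "frame_metric = rows4 (quad 0 (1/2) 0 0) (quad (1/2) 0 0 0) (quad 0 0 (- 1) 0) (quad 0 0 0 (- 1))"

lemma sum_4': "sum f (UNIV :: 4 set) = f 0 + f 1 + f 2 + f 3"
  unfolding UNIV_4' by (simp add: add_ac)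

lemma rows4_simps [simp]:
  "rows4 a b c d $ 0 $ j = a j" "rows4 a b c d $ 1 $ j = b j" "rows4 a b c d $ 2 $ j = c j" "rows4 a b c d $ 3 $ j = d j"
  by (simp_all add: rows4_def)

text \<open>With the frame vectors as rows of \<open>E\<close>, the hypothesis reads: the inverse of
  \<open>Q\<close> is \<open>transpose E ** frame_metric ** E\<close>. Hence the Gram matrix
  \<open>E ** Q ** transpose E\<close> inverts \<open>frame_metric\<close>, which yields all scalar
  products at once, and taking determinants gives the second claim.\<close>

lemma
  fixes Q :: "real ^ 4 ^ 4"
  assumes sym: "transpose Q = Q" and inv: "invertible Q"
    and ginv: "\<And>a b. matrix_inv Q $ a $ b = (l a * n b + n a * l b) / 2 - m1 a * m1 b - m2 a * m2 b"
  shows null_frameI: "null_frame Q l n m1 m2"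
    and det_null_frame: "det frame_metric * (det (rows4 l n m1 m2))\<^sup>2 * det Q = 1"
proof -
  let ?E = "rows4 l n m1 m2"
  have E: "matrix_inv Q = transpose ?E ** frame_metric ** ?E"
    by (simp add: vec_eq_iff matrix_matrix_mult_def transpose_def sum_4' frame_metric_def ginv field_simps)
  then have 1: "transpose ?E ** (frame_metric ** ?E ** Q) = mat 1"
    using matrix_inv_left[OF inv] by (simp add: matrix_mul_assoc)
  then have 2: "frame_metric ** ?E ** Q ** transpose ?E = mat 1"
    by (simp add: matrix_left_right_inverse)
  show "det frame_metric * (det ?E)\<^sup>2 * det Q = 1"
    using arg_cong[OF 2, of det] by (simp add: det_mul power2_eq_square mult_ac)
  have c: "ctr (low Q u) v = (\<Sum>\<mu> a. u \<mu> * Q $ \<mu> $ a * v a)" for u v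
    unfolding ctr_low_commute[OF sym, of u v]
    by (simp add: ctr_def low_def sum_distrib_left mult_ac)
  have 3: "(frame_metric ** ?E ** Q ** transpose ?E) $ i $ j = (\<Sum>k. frame_metric $ i $ k * ctr (low Q (($) (?E $ k))) (($) (?E $ j)))" for i j
  proof -
    have "(frame_metric ** ?E ** Q ** transpose ?E) = frame_metric ** (?E ** Q ** transpose ?E)"
      by (simp add: matrix_mul_assoc)
    moreover have "(?E ** Q ** transpose ?E) $ k $ j = ctr (low Q (($) (?E $ k))) (($) (?E $ j))" for k
      unfolding c by (simp add: matrix_matrix_mult_def transpose_def sum_distrib_right) (rule sum.swap)
    ultimately show ?thesis
      by (simp add: matrix_matrix_mult_def)
  qed
  have rows: "($) (?E $ 0) = l" "($) (?E $ 1) = n" "($) (?E $ 2) = m1" "($) (?E $ 3) = m2"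
    by (simp_all add: fun_eq_iff)
  have 4: "(\<Sum>k. frame_metric $ i $ k * ctr (low Q (($) (?E $ k))) (($) (?E $ j))) = (if i = j then 1 else 0)" for i j
    unfolding 3[symmetric] 2 by (simp add: mat_def)
  note p = 4[of 0 0] 4[of 0 1] 4[of 0 2] 4[of 0 3] 4[of 1 0] 4[of 1 1] 4[of 1 2] 4[of 1 3]
    4[of 2 0] 4[of 2 1] 4[of 2 2] 4[of 2 3] 4[of 3 0] 4[of 3 1] 4[of 3 2] 4[of 3 3]
  note p = p[unfolded rows sum_4' frame_metric_def, simplified]
  have complete: "v a = ctr (low Q n) v / 2 * l a + ctr (low Q l) v / 2 * n a
      - ctr (low Q m1) v * m1 a - ctr (low Q m2) v * m2 a" for v a
  proof -
    have "v a = ((matrix_inv Q ** Q) *v (\<chi> i. v i)) $ a"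
      by (simp add: matrix_inv_left[OF inv])
    also have "\<dots> = (matrix_inv Q *v (\<chi> i. low Q v i)) $ a"
      unfolding matrix_vector_mul_assoc[symmetric] by (simp add: matrix_vector_mult_def low_def)
    also have "\<dots> = ctr (low Q v) (\<lambda>b. (l a * n b + n a * l b) / 2 - m1 a * m1 b - m2 a * m2 b)"
      by (simp add: matrix_vector_mult_def ctr_def ginv mult.commute)
    finally show ?thesis
      by (simp add: ctr_simps_right ctr_low_commute[OF sym, of v] field_simps)
  qed
  show "null_frame Q l n m1 m2"
    by (rule null_frame.intro[OF sym complete]) (use p in simp_all)
qed

section \<open>Connections adapted to a field of null frames\<close>

type_synonym vfield = "vec4 \<Rightarrow> 4 \<Rightarrow> real"

definition cov :: "conn \<Rightarrow> vfield \<Rightarrow> vec4 \<Rightarrow> 4 \<Rightarrow> 4 \<Rightarrow> real" where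
  "cov Gam v x \<mu> k = pd \<mu> (\<lambda>y. v y k) x + (\<Sum>t. Gam x k \<mu> t * v x t)"

lemma smooth_on_low:
  assumes "open V" "\<And>i j. smooth_on V (\<lambda>x. g x $ i $ j)" "\<And>i. smooth_on V (\<lambda>x. v x i)"
  shows "smooth_on V (\<lambda>x. low (g x) (v x) \<mu>)"
  unfolding low_def by (intro smooth_intros assms)

lemma smooth_on_ctr:
  assumes "open V" "\<And>i. smooth_on V (\<lambda>x. p x i)" "\<And>i. smooth_on V (\<lambda>x. v x i)"
  shows "smooth_on V (\<lambda>x. ctr (p x) (v x))"
  unfolding ctr_def by (intro smooth_intros assms)

lemma pd_low:
  assumes diff: "\<And>i j. (\<lambda>y. g y $ i $ j) differentiable at x" "\<And>i. (\<lambda>y. v y i) differentiable at x"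
    and compat: "metric_compatible_at g Gam x"
  shows "pd \<mu> (\<lambda>y. low (g y) (v y) i) x =
    (\<Sum>k. Gam x k \<mu> i * low (g x) (v x) k) + low (g x) (cov Gam v x \<mu>) i"
proof -
  have "pd \<mu> (\<lambda>y. low (g y) (v y) i) x = (\<Sum>j. pd \<mu> (\<lambda>y. g y $ i $ j) x * v x j + g x $ i $ j * pd \<mu> (\<lambda>y. v y j) x)"
    unfolding low_def using diff by (simp add: pd_sum pd_mult)
  also have "\<dots> = (\<Sum>j k. Gam x k \<mu> i * (g x $ k $ j * v x j))
      + (\<Sum>j k. g x $ i $ k * (Gam x k \<mu> j * v x j)) + (\<Sum>j. g x $ i $ j * pd \<mu> (\<lambda>y. v y j) x)"
    using compat
    by (simp add: metric_compatible_at_def sum.distrib distrib_right sum_distrib_right; simp add: mult_ac)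
  also have "\<dots> = (\<Sum>k j. Gam x k \<mu> i * (g x $ k $ j * v x j))
      + (\<Sum>k j. g x $ i $ k * (Gam x k \<mu> j * v x j)) + (\<Sum>j. g x $ i $ j * pd \<mu> (\<lambda>y. v y j) x)"
    by (subst (1 2) sum.swap) (rule refl)
  finally show ?thesis
    by (simp add: low_def cov_def sum_distrib_left distrib_left sum.distrib)
qed

lemma pd_ctr_low:
  assumes diff: "\<And>i j. (\<lambda>y. g y $ i $ j) differentiable at x"
      "\<And>i. (\<lambda>y. u y i) differentiable at x" "\<And>i. (\<lambda>y. v y i) differentiable at x"
    and compat: "metric_compatible_at g Gam x"
  shows "pd \<mu> (\<lambda>y. ctr (low (g y) (u y)) (v y)) x =
    ctr (low (g x) (cov Gam u x \<mu>)) (v x) + ctr (low (g x) (u x)) (cov Gam v x \<mu>)"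
proof -
  have d: "(\<lambda>y. low (g y) (u y) i) differentiable at x" for i
    unfolding low_def by (intro differentiable_sum ballI differentiable_mult diff) simp
  have "pd \<mu> (\<lambda>y. ctr (low (g y) (u y)) (v y)) x =
     (\<Sum>i. pd \<mu> (\<lambda>y. low (g y) (u y) i) x * v x i + low (g x) (u x) i * pd \<mu> (\<lambda>y. v y i) x)"
    unfolding ctr_def using diff d by (simp add: pd_sum pd_mult)
  also have "\<dots> = (\<Sum>i k. low (g x) (u x) k * (Gam x k \<mu> i * v x i)) + ctr (low (g x) (cov Gam u x \<mu>)) (v x)
      + (\<Sum>i. low (g x) (u x) i * pd \<mu> (\<lambda>y. v y i) x)"
    unfolding pd_low[OF diff(1,2) compat]
    by (simp add: ctr_def sum.distrib distrib_right sum_distrib_right; simp add: mult_ac)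
  also have "(\<Sum>i k. low (g x) (u x) k * (Gam x k \<mu> i * v x i)) =
      (\<Sum>k i. low (g x) (u x) k * (Gam x k \<mu> i * v x i))"
    by (rule sum.swap)
  also have "\<dots> = (\<Sum>k. low (g x) (u x) k * (\<Sum>i. Gam x k \<mu> i * v x i))"
    by (simp add: sum_distrib_left)
  finally show ?thesis
    unfolding ctr_def[of _ "cov Gam v x \<mu>"] cov_def[of Gam v] by (simp add: distrib_left sum.distrib)
qed

text \<open>The commutator of covariant derivatives acts as the curvature. Two summands are enough
  to describe the derivative of any vector of an adapted frame.\<close>

lemma ricci_identity:
  assumes V: "open V" "x \<in> V" and Gam: "\<And>t \<mu> \<nu>. (\<lambda>y. Gam y t \<mu> \<nu>) differentiable at x"
    and v: "\<And>i. smooth_on V (\<lambda>y. v y i)"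
    and diff: "\<And>i. (\<lambda>y. b y i) differentiable at x" "\<And>i. (\<lambda>y. u y i) differentiable at x"
      "\<And>i. (\<lambda>y. c y i) differentiable at x" "\<And>i. (\<lambda>y. w y i) differentiable at x"
    and cov: "\<And>y \<nu> k. y \<in> V \<Longrightarrow> cov Gam v y \<nu> k = b y \<nu> * u y k + c y \<nu> * w y k"
  shows "(\<Sum>t. curvature Gam x k t \<mu> \<nu> * v x t) =
     (pd \<mu> (\<lambda>y. b y \<nu>) x - pd \<nu> (\<lambda>y. b y \<mu>) x) * u x k + (pd \<mu> (\<lambda>y. c y \<nu>) x - pd \<nu> (\<lambda>y. c y \<mu>) x) * w x k
     + b x \<nu> * cov Gam u x \<mu> k - b x \<mu> * cov Gam u x \<nu> k + c x \<nu> * cov Gam w x \<mu> k - c x \<mu> * cov Gam w x \<nu> k"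
proof -
  \<comment> \<open>The connection acts on the upper index only. A term for the lower index would
    bring in the torsion upon antisymmetrisation.\<close>
  define Z where "Z \<mu> \<nu> = pd \<mu> (\<lambda>y. cov Gam v y \<nu> k) x + (\<Sum>h. Gam x k \<mu> h * cov Gam v x \<nu> h)" for \<mu> \<nu>
  have dv: "(\<lambda>y. v y i) differentiable at x" "pd \<mu> (\<lambda>y. v y i) differentiable at x" for i \<mu>
    using v V by (auto intro!: smooth_on_differentiable[OF V(1)] smooth_on_pd)
  have 1: "Z \<mu> \<nu> = pd \<mu> (\<lambda>y. b y \<nu>) x * u x k + pd \<mu> (\<lambda>y. c y \<nu>) x * w x k
      + b x \<nu> * cov Gam u x \<mu> k + c x \<nu> * cov Gam w x \<mu> k" for \<mu> \<nu>
  proof -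
    have "pd \<mu> (\<lambda>y. cov Gam v y \<nu> k) x = pd \<mu> (\<lambda>y. b y \<nu> * u y k + c y \<nu> * w y k) x"
      by (rule pd_cong[OF V cov])
    also have "\<dots> = pd \<mu> (\<lambda>y. b y \<nu>) x * u x k + b x \<nu> * pd \<mu> (\<lambda>y. u y k) x
      + (pd \<mu> (\<lambda>y. c y \<nu>) x * w x k + c x \<nu> * pd \<mu> (\<lambda>y. w y k) x)"
      using diff by (simp add: pd_add pd_mult)
    finally show ?thesis
      unfolding Z_def by (simp add: cov[OF V(2)]) (simp add: cov_def algebra_simps sum.distrib flip: sum_distrib_left)
  qed
  have 2: "Z \<mu> \<nu> = pd \<mu> (pd \<nu> (\<lambda>y. v y k)) x
      + (\<Sum>t. pd \<mu> (\<lambda>y. Gam y k \<nu> t) x * v x t)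
      + (\<Sum>t. Gam x k \<nu> t * pd \<mu> (\<lambda>y. v y t) x) + (\<Sum>h. Gam x k \<mu> h * pd \<nu> (\<lambda>y. v y h) x)
      + (\<Sum>t. (\<Sum>h. Gam x k \<mu> h * Gam x h \<nu> t) * v x t)" for \<mu> \<nu>
  proof -
    have "pd \<mu> (\<lambda>y. cov Gam v y \<nu> k) x = pd \<mu> (pd \<nu> (\<lambda>y. v y k)) x
      + (\<Sum>t. pd \<mu> (\<lambda>y. Gam y k \<nu> t) x * v x t + Gam x k \<nu> t * pd \<mu> (\<lambda>y. v y t) x)"
      unfolding cov_def by (simp add: pd_add pd_sum pd_mult dv Gam)
    moreover have "(\<Sum>h. Gam x k \<mu> h * cov Gam v x \<nu> h) = (\<Sum>h. Gam x k \<mu> h * pd \<nu> (\<lambda>y. v y h) x)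
      + (\<Sum>h t. Gam x k \<mu> h * Gam x h \<nu> t * v x t)"
      by (simp add: cov_def distrib_left sum.distrib sum_distrib_left mult.assoc)
    moreover have "(\<Sum>h t. Gam x k \<mu> h * Gam x h \<nu> t * v x t)
      = (\<Sum>t. (\<Sum>h. Gam x k \<mu> h * Gam x h \<nu> t) * v x t)"
      unfolding sum_distrib_right by (rule sum.swap)
    ultimately show ?thesis by (simp add: Z_def sum.distrib)
  qed
  have "(\<Sum>t. curvature Gam x k t \<mu> \<nu> * v x t) = Z \<mu> \<nu> - Z \<nu> \<mu>"
    unfolding 2 curvature_def pd_commute[OF V(1) v V(2), of \<nu> \<mu>]
    by (simp add: left_diff_distrib distrib_right sum.distrib sum_subtractf)
  then show ?thesis unfolding 1 by (simp add: algebra_simps)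
qed

section \<open>Properties of the Levi-Civita connection\<close>

lemma transpose_eqD: "transpose Q = Q \<Longrightarrow> Q $ i $ j = Q $ j $ i"
  by (drule arg_cong[of _ _ "\<lambda>m. m $ j $ i"]) (simp add: transpose_def)

lemma christoffel_sym:
  assumes "open V" "x \<in> V" "\<And>y. y \<in> V \<Longrightarrow> transpose (g y) = g y"
  shows "christoffel g x t \<mu> \<nu> = christoffel g x t \<nu> \<mu>"
proof -
  have "pd k (\<lambda>y. g y $ \<mu> $ \<nu>) x = pd k (\<lambda>y. g y $ \<nu> $ \<mu>) x" for k
    by (rule pd_cong[OF assms(1,2) transpose_eqD[OF assms(3)]])
  then show ?thesis
    by (simp add: christoffel_def add.commute)
qed

lemma metric_compatible_christoffel:
  assumes V: "open V" "x \<in> V" and sym: "\<And>y. y \<in> V \<Longrightarrow> transpose (g y) = g y" and inv: "invertible (g x)"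
  shows "metric_compatible_at g (christoffel g) x"
proof -
  define X where "X \<mu> a \<sigma> = pd \<mu> (\<lambda>y. g y $ a $ \<sigma>) x + pd a (\<lambda>y. g y $ \<mu> $ \<sigma>) x - pd \<sigma> (\<lambda>y. g y $ \<mu> $ a) x" for \<mu> a \<sigma>
  have gs: "g y $ i $ j = g y $ j $ i" if "y \<in> V" for y i j
    by (rule transpose_eqD[OF sym[OF that]])
  have pds: "pd k (\<lambda>y. g y $ \<mu> $ \<nu>) x = pd k (\<lambda>y. g y $ \<nu> $ \<mu>) x" for k \<mu> \<nu>
    by (rule pd_cong[OF V gs])
  have id: "(\<Sum>k. g x $ b $ k * ginv g x $ k $ \<sigma>) = (if b = \<sigma> then 1 else 0)" for b \<sigma>
    using arg_cong[OF matrix_inv_right[OF inv], of "\<lambda>m. m $ b $ \<sigma>"]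
    by (simp add: ginv_def matrix_matrix_mult_def mat_def)
  have low: "(\<Sum>k. g x $ b $ k * christoffel g x k \<mu> a) = X \<mu> a b / 2" for b \<mu> a
  proof -
    have "(\<Sum>k. g x $ b $ k * christoffel g x k \<mu> a) =
      (\<Sum>k \<sigma>. g x $ b $ k * ginv g x $ k $ \<sigma> * X \<mu> a \<sigma> / 2)"
      by (simp add: christoffel_def sum_distrib_left flip: X_def; simp add: mult_ac)
    also have "\<dots> = (\<Sum>\<sigma>. (\<Sum>k. g x $ b $ k * ginv g x $ k $ \<sigma>) * X \<mu> a \<sigma> / 2)"
      unfolding sum_distrib_right sum_divide_distrib by (rule sum.swap)
    also have "\<dots> = X \<mu> a b / 2"
      by (simp add: id if_distrib[where f = "\<lambda>z. z * _ / 2"] cong: if_cong)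
    finally show ?thesis .
  qed
  show ?thesis
    unfolding metric_compatible_at_def
  proof (intro allI)
    fix \<mu> a b
    have "(\<Sum>k. christoffel g x k \<mu> a * g x $ k $ b) = X \<mu> a b / 2"
      "(\<Sum>k. christoffel g x k \<mu> b * g x $ a $ k) = X \<mu> b a / 2"
      unfolding low[symmetric] by (simp_all add: gs[OF V(2), of b] mult.commute)
    then show "pd \<mu> (\<lambda>y. g y $ a $ b) x =
     (\<Sum>k. christoffel g x k \<mu> a * g x $ k $ b) + (\<Sum>k. christoffel g x k \<mu> b * g x $ a $ k)"
      using pds[of \<mu> a b] pds[of a \<mu> b] pds[of b \<mu> a] by (simp add: X_def)
  qed
qed

lemma curvature_cyclic:
  assumes "open V" "x \<in> V" "\<And>y t \<mu> \<nu>. y \<in> V \<Longrightarrow> Gam y t \<mu> \<nu> = Gam y t \<nu> \<mu>"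
  shows "curvature Gam x k t \<mu> \<nu> + curvature Gam x k \<mu> \<nu> t + curvature Gam x k \<nu> t \<mu> = 0"
proof -
  have "pd r (\<lambda>y. Gam y k i j) x = pd r (\<lambda>y. Gam y k j i) x" for r i j
    by (rule pd_cong[OF assms])
  note this[of \<mu> \<nu> t] this[of \<nu> \<mu> t] this[of t \<mu> \<nu>]
  moreover have "(\<Sum>h. Gam x k r h * Gam x h i j) = (\<Sum>h. Gam x k r h * Gam x h j i)" for r i j
    by (intro sum.cong refl) (simp add: assms(3)[OF assms(2), of _ i j])
  note this[of \<mu> \<nu> t] this[of \<nu> \<mu> t] this[of t \<mu> \<nu>]
  ultimately show ?thesis
    by (simp add: curvature_def)
qed

text \<open>Serves two frames: the one read off from the Pauli matrices and the one adapted to the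
  spinor.\<close>

locale pp_frame =
  fixes V :: "vec4 set" and g :: metric and l n m1 m2 :: vfield
  assumes V: "open V"
    and smooth_g: "smooth_on V (\<lambda>x. g x $ i $ j)"
    and smooth_frame: "smooth_on V (\<lambda>x. l x i)" "smooth_on V (\<lambda>x. n x i)"
      "smooth_on V (\<lambda>x. m1 x i)" "smooth_on V (\<lambda>x. m2 x i)"
    and frame: "x \<in> V \<Longrightarrow> null_frame (g x) (l x) (n x) (m1 x) (m2 x)"
    and invertible_g: "x \<in> V \<Longrightarrow> invertible (g x)"
begin

abbreviation "lc x \<equiv> low (g x) (l x)"
abbreviation "mc1 x \<equiv> low (g x) (m1 x)"
abbreviation "mc2 x \<equiv> low (g x) (m2 x)"

definition wedge :: "(4 \<Rightarrow> real) \<Rightarrow> (4 \<Rightarrow> real) \<Rightarrow> 4 \<Rightarrow> 4 \<Rightarrow> real" where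
  "wedge p q \<mu> \<nu> = p \<mu> * q \<nu> - q \<mu> * p \<nu>"

lemma sym_g: "x \<in> V \<Longrightarrow> transpose (g x) = g x"
  using null_frame.Q_sym[OF frame] .

lemma diff_at: "smooth_on V f \<Longrightarrow> x \<in> V \<Longrightarrow> f differentiable at x"
  using smooth_on_differentiable[OF V] .

lemmas diffs = smooth_g[THEN diff_at] smooth_frame[THEN diff_at]

lemma smooth_low: "(\<And>i. smooth_on V (\<lambda>x. v x i)) \<Longrightarrow> smooth_on V (\<lambda>x. low (g x) (v x) \<mu>)"
  by (rule smooth_on_low[OF V smooth_g])

lemma ginv_eq: "x \<in> V \<Longrightarrow> ginv g x $ i $ j =
    (l x i * n x j + n x i * l x j) / 2 - m1 x i * m1 x j - m2 x i * m2 x j"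
  unfolding ginv_def by (rule null_frame.ginv_frame[OF frame invertible_g])

lemma smooth_ginv: "smooth_on V (\<lambda>x. ginv g x $ i $ j)"
proof -
  have "smooth_on V (\<lambda>x. (l x i * n x j + n x i * l x j) * (1/2) - m1 x i * m1 x j - m2 x i * m2 x j)"
    by (intro smooth_intros V smooth_frame)
  then show ?thesis
    by (rule smooth_on_cong[OF V, THEN iffD1, rotated]) (simp add: ginv_eq)
qed

lemma smooth_christoffel: "smooth_on V (\<lambda>x. christoffel g x t \<mu> \<nu>)"
  unfolding christoffel_def by (intro smooth_intros V smooth_ginv smooth_g)

lemma christoffel_compatible: "x \<in> V \<Longrightarrow> metric_compatible_at g (christoffel g) x"
  by (rule metric_compatible_christoffel[OF V _ sym_g invertible_g])

lemma christoffel_symmetric: "x \<in> V \<Longrightarrow> christoffel g x t \<mu> \<nu> = christoffel g x t \<nu> \<mu>"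
  by (rule christoffel_sym[OF V _ sym_g])

lemma raise_low:
  assumes "x \<in> V"
  shows "(\<Sum>i. ginv g x $ \<mu> $ i * low (g x) v i) = v \<mu>"
proof -
  interpret null_frame "g x" "l x" "n x" "m1 x" "m2 x" by (rule frame[OF assms])
  have "(\<Sum>i. ginv g x $ \<mu> $ i * low (g x) v i) =
     ctr (low (g x) v) (\<lambda>i. (l x \<mu> * n x i + n x \<mu> * l x i) / 2 - m1 x \<mu> * m1 x i - m2 x \<mu> * m2 x i)"
    by (simp add: ginv_eq[OF assms] ctr_def mult.commute)
  also have "\<dots> = v \<mu>"
    using complete[of v \<mu>] by (simp add: ctr_simps_right ctr_commute[of v] field_simps)
  finally show ?thesis .
qed

text \<open>A metric connection for which \<open>l\<close> is parallel takes values in the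
  stabiliser of \<open>l\<close> in the Lorentz algebra: null rotations, with one-forms
  \<open>A1\<close>, \<open>A2\<close>, and the rotation of the plane of \<open>m1\<close>,
  \<open>m2\<close>, with one-form \<open>B\<close>.\<close>

definition adapted_at :: "conn \<Rightarrow> vfield \<Rightarrow> vfield \<Rightarrow> vfield \<Rightarrow> vec4 \<Rightarrow> bool" where
  "adapted_at Gam A1 A2 B x \<longleftrightarrow> metric_compatible_at g Gam x \<and> (\<forall>\<mu> k. cov Gam l x \<mu> k = 0 \<and>
     cov Gam m1 x \<mu> k = A1 x \<mu> * l x k - B x \<mu> * m2 x k \<and>
     cov Gam m2 x \<mu> k = A2 x \<mu> * l x k + B x \<mu> * m1 x k)"

context
  fixes Gam A1 A2 B x
  assumes x: "x \<in> V" and ad: "adapted_at Gam A1 A2 B x"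
begin

interpretation null_frame "g x" "l x" "n x" "m1 x" "m2 x" by (rule frame[OF x])

lemma adapted_simps:
  "cov Gam l x \<mu> = (\<lambda>k. 0)"
  "cov Gam m1 x \<mu> = (\<lambda>k. A1 x \<mu> * l x k - B x \<mu> * m2 x k)"
  "cov Gam m2 x \<mu> = (\<lambda>k. A2 x \<mu> * l x k + B x \<mu> * m1 x k)"
  using ad by (auto simp: adapted_at_def)

lemma adapted_compatible: "metric_compatible_at g Gam x"
  using ad by (simp add: adapted_at_def)

text \<open>Differentiating the constant products of \<open>n\<close> with the frame determines
  every component.\<close>

lemma adapted_cov_n: "cov Gam n x \<mu> k = 2 * A1 x \<mu> * m1 x k + 2 * A2 x \<mu> * m2 x k"
proof -
  have const: "ctr (low (g x) (cov Gam u x \<mu>)) (n x) + ctr (low (g x) (u x)) (cov Gam n x \<mu>) = 0"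
    if "\<And>y. y \<in> V \<Longrightarrow> ctr (low (g y) (u y)) (n y) = c" "\<And>i. smooth_on V (\<lambda>y. u y i)" for u c
  proof -
    have "pd \<mu> (\<lambda>y. ctr (low (g y) (u y)) (n y)) x = 0"
      by (rule pd_zero_on[OF V x]) (rule that(1))
    moreover have "pd \<mu> (\<lambda>y. ctr (low (g y) (u y)) (n y)) x =
      ctr (low (g x) (cov Gam u x \<mu>)) (n x) + ctr (low (g x) (u x)) (cov Gam n x \<mu>)"
      by (intro pd_ctr_low diffs[OF x] diff_at[OF that(2) x] adapted_compatible)
    ultimately show ?thesis by simp
  qed
  have "ctr (low (g x) (n x)) (cov Gam n x \<mu>) = 0"
    using const[of n 0] null_frame.products[OF frame] smooth_frame ctr_commute[of "cov Gam n x \<mu>" "n x"] by simp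
  moreover have "ctr (low (g x) (l x)) (cov Gam n x \<mu>) = 0"
    using const[of l 2] null_frame.products[OF frame] smooth_frame by (simp add: adapted_simps low_simps ctr_simps ctr_commute)
  moreover have "ctr (low (g x) (m1 x)) (cov Gam n x \<mu>) = - 2 * A1 x \<mu>"
    using const[of m1 0] null_frame.products[OF frame] smooth_frame
    by (simp add: adapted_simps low_simps ctr_simps products x)
  moreover have "ctr (low (g x) (m2 x)) (cov Gam n x \<mu>) = - 2 * A2 x \<mu>"
    using const[of m2 0] null_frame.products[OF frame] smooth_frame
    by (simp add: adapted_simps low_simps ctr_simps products x)
  ultimately show ?thesis
    by (subst complete) simp
qed

lemma adapted_pd:
  "pd \<mu> (\<lambda>y. l y k) x = - (\<Sum>t. Gam x k \<mu> t * l x t)"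
  "pd \<mu> (\<lambda>y. m1 y k) x = A1 x \<mu> * l x k - B x \<mu> * m2 x k - (\<Sum>t. Gam x k \<mu> t * m1 x t)"
  "pd \<mu> (\<lambda>y. m2 y k) x = A2 x \<mu> * l x k + B x \<mu> * m1 x k - (\<Sum>t. Gam x k \<mu> t * m2 x t)"
  using fun_cong[OF adapted_simps(1)[of \<mu>], of k] fun_cong[OF adapted_simps(2)[of \<mu>], of k]
    fun_cong[OF adapted_simps(3)[of \<mu>], of k]
  by (simp_all add: cov_def)

lemma adapted_pd_low:
  "pd \<mu> (\<lambda>y. lc y i) x = (\<Sum>k. Gam x k \<mu> i * lc x k)"
  "pd \<mu> (\<lambda>y. mc1 y i) x = (\<Sum>k. Gam x k \<mu> i * mc1 x k) + A1 x \<mu> * lc x i - B x \<mu> * mc2 x i"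
  "pd \<mu> (\<lambda>y. mc2 y i) x = (\<Sum>k. Gam x k \<mu> i * mc2 x k) + A2 x \<mu> * lc x i + B x \<mu> * mc1 x i"
  using x by (simp_all add: pd_low[OF diffs(1) _ adapted_compatible] diffs adapted_simps low_simps)

end

text \<open>As \<open>B\<close> is closed, the rotation part of the curvature vanishes and only null
  rotations remain. The wedge terms are commutators of the rotation with null rotations.\<close>

lemma curvature_adapted:
  assumes Gam: "\<And>t \<mu> \<nu>. smooth_on V (\<lambda>y. Gam y t \<mu> \<nu>)"
    and ad: "\<And>y. y \<in> V \<Longrightarrow> adapted_at Gam A1 A2 B y" and x: "x \<in> V"
    and diff: "\<And>i. (\<lambda>y. A1 y i) differentiable at x" "\<And>i. (\<lambda>y. A2 y i) differentiable at x"
      "\<And>i. (\<lambda>y. B y i) differentiable at x"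
    and closed: "\<And>\<mu> \<nu>. pd \<mu> (\<lambda>y. B y \<nu>) x = pd \<nu> (\<lambda>y. B y \<mu>) x"
  shows "curvature Gam x k t \<mu> \<nu> =
      (pd \<mu> (\<lambda>y. A1 y \<nu>) x - pd \<nu> (\<lambda>y. A1 y \<mu>) x + wedge (B x) (A2 x) \<mu> \<nu>) * (m1 x k * lc x t - l x k * mc1 x t)
    + (pd \<mu> (\<lambda>y. A2 y \<nu>) x - pd \<nu> (\<lambda>y. A2 y \<mu>) x - wedge (B x) (A1 x) \<mu> \<nu>) * (m2 x k * lc x t - l x k * mc2 x t)"
proof -
  interpret null_frame "g x" "l x" "n x" "m1 x" "m2 x" by (rule frame[OF x])
  let ?d1 = "pd \<mu> (\<lambda>y. A1 y \<nu>) x - pd \<nu> (\<lambda>y. A1 y \<mu>) x" and ?d2 = "pd \<mu> (\<lambda>y. A2 y \<nu>) x - pd \<nu> (\<lambda>y. A2 y \<mu>) x"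
  have Ricci: "ctr (\<lambda>t. curvature Gam x k t \<mu> \<nu>) (v x) =
     (pd \<mu> (\<lambda>y. b y \<nu>) x - pd \<nu> (\<lambda>y. b y \<mu>) x) * u x k + (pd \<mu> (\<lambda>y. c y \<nu>) x - pd \<nu> (\<lambda>y. c y \<mu>) x) * w x k
     + b x \<nu> * cov Gam u x \<mu> k - b x \<mu> * cov Gam u x \<nu> k + c x \<nu> * cov Gam w x \<mu> k - c x \<mu> * cov Gam w x \<nu> k"
    if "\<And>i. smooth_on V (\<lambda>y. v y i)" "\<And>i. (\<lambda>y. b y i) differentiable at x" "\<And>i. (\<lambda>y. u y i) differentiable at x"
      "\<And>i. (\<lambda>y. c y i) differentiable at x" "\<And>i. (\<lambda>y. w y i) differentiable at x"
      "\<And>y \<nu> k. y \<in> V \<Longrightarrow> cov Gam v y \<nu> k = b y \<nu> * u y k + c y \<nu> * w y k" for v b u c w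
    unfolding ctr_def using that by (intro ricci_identity[OF V x diff_at[OF Gam x]])
  note d = diff diffs(2-5)[OF x]
  note as = adapted_simps[OF _ ad]
  have cl: "ctr (\<lambda>t. curvature Gam x k t \<mu> \<nu>) (l x) = 0"
    using Ricci[of l "\<lambda>_ _. 0" "\<lambda>_ _. 0" "\<lambda>_ _. 0" "\<lambda>_ _. 0"] smooth_frame as by simp
  have c1: "ctr (\<lambda>t. curvature Gam x k t \<mu> \<nu>) (m1 x) = (?d1 + wedge (B x) (A2 x) \<mu> \<nu>) * l x k"
    using Ricci[of m1 A1 l "\<lambda>y i. - B y i" m2] smooth_frame d
    by (simp add: as x pd_minus closed[of \<nu> \<mu>]; simp add: wedge_def algebra_simps)
  have c2: "ctr (\<lambda>t. curvature Gam x k t \<mu> \<nu>) (m2 x) = (?d2 - wedge (B x) (A1 x) \<mu> \<nu>) * l x k"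
    using Ricci[of m2 A2 l B m1] smooth_frame d
    by (simp add: as x closed[of \<nu> \<mu>]; simp add: wedge_def algebra_simps)
  have dn: "pd \<mu> (\<lambda>y. 2 * A1 y \<nu>) x = 2 * pd \<mu> (\<lambda>y. A1 y \<nu>) x" "pd \<mu> (\<lambda>y. 2 * A2 y \<nu>) x = 2 * pd \<mu> (\<lambda>y. A2 y \<nu>) x" for \<mu> \<nu>
    by (simp_all add: pd_mult diff)
  have cn: "ctr (\<lambda>t. curvature Gam x k t \<mu> \<nu>) (n x) =
      2 * (?d1 + wedge (B x) (A2 x) \<mu> \<nu>) * m1 x k + 2 * (?d2 - wedge (B x) (A1 x) \<mu> \<nu>) * m2 x k"
    using Ricci[of n "\<lambda>y i. 2 * A1 y i" m1 "\<lambda>y i. 2 * A2 y i" m2] smooth_frame d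
    by (simp add: as x dn adapted_cov_n[OF _ ad]; simp add: wedge_def algebra_simps)
  show ?thesis
    using complete_covector[of "\<lambda>t. curvature Gam x k t \<mu> \<nu>" t] unfolding cl c1 c2 cn
    by (simp add: field_simps)
qed

end

section \<open>Levi-Civita curvature with parallel Ricci tensor\<close>

lemma pd_cmult:
  fixes f :: "vec4 \<Rightarrow> real"
  shows "f differentiable at x \<Longrightarrow> pd \<mu> (\<lambda>y. f y * c) x = pd \<mu> f x * c"
  by (simp add: pd_mult)

text \<open>The rotation form is 0 here: a parallel spinor fixes \<open>l\<close> and, up to
  multiples of \<open>l\<close>, also \<open>m1\<close> and \<open>m2\<close>.\<close>

locale parallel_frame = pp_frame +
  fixes a1 a2 :: vfield
  assumes smooth_a: "smooth_on V (\<lambda>x. a1 x i)" "smooth_on V (\<lambda>x. a2 x i)"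
    and adapted: "x \<in> V \<Longrightarrow> adapted_at (christoffel g) a1 a2 (\<lambda>_ _. 0) x"
    and ricci_parallel: "x \<in> V \<Longrightarrow> cov_deriv2 (christoffel g) (ricci (christoffel g)) x \<mu> i j = 0"
begin

definition curl :: "vfield \<Rightarrow> vec4 \<Rightarrow> 4 \<Rightarrow> 4 \<Rightarrow> real" where
  "curl a x \<mu> \<nu> = pd \<mu> (\<lambda>y. a y \<nu>) x - pd \<nu> (\<lambda>y. a y \<mu>) x"

definition curl_comp :: "vfield \<Rightarrow> vfield \<Rightarrow> vec4 \<Rightarrow> real" where
  "curl_comp a m x = ctr (\<lambda>\<nu>. ctr (\<lambda>i. curl a x i \<nu>) (n x)) (m x)"

text \<open>The Levi-Civita curvature is \<open>- 1/2 \<Sum> s\<^sub>i\<^sub>j (m\<^sub>i \<and> l) \<otimes> (l \<and> m\<^sub>j)\<close>.\<close>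

abbreviation "s11 \<equiv> curl_comp a1 m1"
abbreviation "s12 \<equiv> curl_comp a1 m2"
abbreviation "s21 \<equiv> curl_comp a2 m1"
abbreviation "s22 \<equiv> curl_comp a2 m2"

lemma smooth_s: "smooth_on V s11" "smooth_on V s12" "smooth_on V s21" "smooth_on V s22"
  unfolding curl_comp_def curl_def ctr_def
  by (intro smooth_intros smooth_a smooth_frame V)+

lemma curvature_lc:
  assumes x: "x \<in> V"
  shows "curvature (christoffel g) x k t \<mu> \<nu> =
     curl a1 x \<mu> \<nu> * (m1 x k * lc x t - l x k * mc1 x t) + curl a2 x \<mu> \<nu> * (m2 x k * lc x t - l x k * mc2 x t)"
  using curvature_adapted[OF smooth_christoffel adapted x] smooth_a[THEN diff_at, OF x]
  by (simp add: curl_def wedge_def)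

lemma
  assumes x: "x \<in> V"
  shows curl_a: "curl a1 x \<mu> \<nu> = - (s11 x * wedge (lc x) (mc1 x) \<mu> \<nu> + s12 x * wedge (lc x) (mc2 x) \<mu> \<nu>) / 2" (is ?P1)
     "curl a2 x \<mu> \<nu> = - (s21 x * wedge (lc x) (mc1 x) \<mu> \<nu> + s22 x * wedge (lc x) (mc2 x) \<mu> \<nu>) / 2" (is ?P2)
    and s12_eq_s21: "s12 x = s21 x"
proof -
  interpret null_frame "g x" "l x" "n x" "m1 x" "m2 x" by (rule frame[OF x])
  have anti: "curl a x \<mu> \<nu> = - curl a x \<nu> \<mu>" for a \<mu> \<nu> by (simp add: curl_def)
  have "curvature (christoffel g) x k t \<mu> \<nu> + curvature (christoffel g) x k \<mu> \<nu> t + curvature (christoffel g) x k \<nu> t \<mu> = 0"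
    for k t \<mu> \<nu>
    by (rule curvature_cyclic[OF V x]) (rule christoffel_symmetric)
  note B = first_Bianchi[of "curl a1 x" "curl a2 x", OF anti anti this[unfolded curvature_lc[OF x]]]
  show ?P1 ?P2
    "s12 x = s21 x"
    unfolding curl_comp_def wedge_def by (rule B)+
qed

lemma ricci_lc:
  assumes x: "x \<in> V"
  shows "ricci (christoffel g) x t \<nu> = (s11 x + s22 x) * (- 1 / 2) * (lc x t * lc x \<nu>)"
proof -
  interpret null_frame "g x" "l x" "n x" "m1 x" "m2 x" by (rule frame[OF x])
  have "ricci (christoffel g) x t \<nu> =
      (ctr (\<lambda>k. curl a1 x k \<nu>) (m1 x) + ctr (\<lambda>k. curl a2 x k \<nu>) (m2 x)) * lc x t
      - ctr (\<lambda>k. curl a1 x k \<nu>) (l x) * mc1 x t - ctr (\<lambda>k. curl a2 x k \<nu>) (l x) * mc2 x t"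
    unfolding ricci_def curvature_lc[OF x] ctr_def
    by (simp add: sum_distrib_left sum_distrib_right sum.distrib sum_subtractf algebra_simps)
  then show ?thesis
    unfolding curl_a[OF x] wedge_def by (simp add: ctr_simps products; simp add: field_simps)
qed

text \<open>Since \<open>l\<close> is parallel, differentiating the Ricci tensor only differentiates
  its scalar factor; evaluation on \<open>n\<close>, \<open>n\<close> then extracts that
  derivative.\<close>

lemma pd_trace:
  assumes x: "x \<in> V"
  shows "pd \<mu> s11 x + pd \<mu> s22 x = 0"
proof -
  interpret null_frame "g x" "l x" "n x" "m1 x" "m2 x" by (rule frame[OF x])
  let ?c = "\<lambda>y. (s11 y + s22 y) * (- 1 / 2)"
  have dc: "?c differentiable at x"
    by (intro differentiable_mult differentiable_add differentiable_const smooth_s[THEN diff_at, OF x])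
  have dl: "(\<lambda>y. lc y i) differentiable at x" for i
    by (intro diff_at[OF smooth_low x] smooth_frame)
  have "pd \<mu> ?c x * (lc x i * lc x j) = 0" for i j
  proof -
    have "pd \<mu> (\<lambda>y. ricci (christoffel g) y i j) x = pd \<mu> (\<lambda>y. ?c y * (lc y i * lc y j)) x"
      by (rule pd_cong[OF V x ricci_lc])
    also have "\<dots> = pd \<mu> ?c x * (lc x i * lc x j) + ?c x * (pd \<mu> (\<lambda>y. lc y i) x * lc x j + lc x i * pd \<mu> (\<lambda>y. lc y j) x)"
      by (subst pd_mult[OF dc differentiable_mult[OF dl dl]]) (simp only: pd_mult[OF dl dl])
    also have "\<dots> = pd \<mu> ?c x * (lc x i * lc x j) + (?c x * ((\<Sum>k. christoffel g x k \<mu> i * lc x k) * lc x j)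
      + ?c x * (lc x i * (\<Sum>k. christoffel g x k \<mu> j * lc x k)))"
      unfolding adapted_pd_low[OF x adapted[OF x]] by (simp only: distrib_left)
    \<comment> \<open>This sum and the next are the connection terms of
      \<open>cov_deriv2\<close>.\<close>
    also have "?c x * ((\<Sum>k. christoffel g x k \<mu> i * lc x k) * lc x j) =
      (\<Sum>k. christoffel g x k \<mu> i * ricci (christoffel g) x k j)"
      unfolding ricci_lc[OF x] sum_distrib_left sum_distrib_right by (intro sum.cong refl) (simp only: mult_ac)
    also have "?c x * (lc x i * (\<Sum>k. christoffel g x k \<mu> j * lc x k)) =
      (\<Sum>k. christoffel g x k \<mu> j * ricci (christoffel g) x i k)"
      unfolding ricci_lc[OF x] sum_distrib_left sum_distrib_right by (intro sum.cong refl) (simp only: mult_ac)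
    finally show ?thesis
      using ricci_parallel[OF x, of \<mu> i j] unfolding cov_deriv2_def by linarith
  qed
  then have "ctr (\<lambda>j. ctr (\<lambda>i. pd \<mu> ?c x * (lc x i * lc x j)) (n x)) (n x) = 0"
    by (simp only: ctr_simps)
  then have "pd \<mu> ?c x = 0"
    by (simp add: ctr_simps products)
  moreover have "pd \<mu> ?c x = pd \<mu> (\<lambda>y. s11 y + s22 y) x * (- 1 / 2)"
    by (intro pd_cmult differentiable_add smooth_s[THEN diff_at, OF x])
  ultimately show ?thesis
    using smooth_s[THEN diff_at, OF x] by (simp add: pd_add)
qed

lemma curl_closed:
  assumes x: "x \<in> V" and a: "\<And>i. smooth_on V (\<lambda>y. a y i)"
  shows "pd r (\<lambda>y. curl a y \<mu> \<nu>) x + pd \<mu> (\<lambda>y. curl a y \<nu> r) x + pd \<nu> (\<lambda>y. curl a y r \<mu>) x = 0"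
  unfolding curl_def
  using pd_commute[OF V a x, of r \<mu> \<nu>] pd_commute[OF V a x, of r \<nu> \<mu>] pd_commute[OF V a x, of \<mu> \<nu> r]
  by (simp add: pd_diff diff_at[OF smooth_on_pd[OF a] x])

text \<open>For the torsion-free connection dl = 0, and dm_i = a_i wedge l is annihilated by a
  further factor \<open>l\<close>.\<close>

lemma wedge_closed:
  assumes x: "x \<in> V"
  shows "pd r (\<lambda>y. wedge (lc y) (mc1 y) \<mu> \<nu>) x + pd \<mu> (\<lambda>y. wedge (lc y) (mc1 y) \<nu> r) x
     + pd \<nu> (\<lambda>y. wedge (lc y) (mc1 y) r \<mu>) x = 0" (is ?P1)
    "pd r (\<lambda>y. wedge (lc y) (mc2 y) \<mu> \<nu>) x + pd \<mu> (\<lambda>y. wedge (lc y) (mc2 y) \<nu> r) x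
     + pd \<nu> (\<lambda>y. wedge (lc y) (mc2 y) r \<mu>) x = 0" (is ?P2)
proof -
  have d: "(\<lambda>y. low (g y) (v y) i) differentiable at x" if "\<And>i. smooth_on V (\<lambda>y. v y i)" for v i
    by (intro diff_at[OF smooth_low x] that)
  note d = d[OF smooth_frame(1)] d[OF smooth_frame(3)] d[OF smooth_frame(4)]
  have s: "(\<Sum>k. christoffel g x k \<mu> i * p k) = (\<Sum>k. christoffel g x k i \<mu> * p k)" for p \<mu> i
    by (subst christoffel_symmetric[OF x]) (rule refl)
  note s = s[of r \<mu>] s[of r \<nu>] s[of \<mu> \<nu>]
  show ?P1 ?P2
    unfolding wedge_def
    by (simp_all add: pd_diff pd_mult differentiable_mult d adapted_pd_low[OF x adapted[OF x]] s algebra_simps)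
qed

text \<open>Closedness of the curls makes the rows of \<open>s\<close> constant along
  \<open>l\<close> and curl free in the plane of \<open>m1\<close>, \<open>m2\<close>. By symmetry
  and constant trace, the curl of one row is up to sign the divergence of the other.\<close>

lemma
  assumes x: "x \<in> V"
  shows s_along_l: "ctr (\<lambda>\<mu>. pd \<mu> s11 x) (l x) = 0" (is ?P1) "ctr (\<lambda>\<mu>. pd \<mu> s12 x) (l x) = 0" (is ?P2)
      "ctr (\<lambda>\<mu>. pd \<mu> s21 x) (l x) = 0" (is ?P3) "ctr (\<lambda>\<mu>. pd \<mu> s22 x) (l x) = 0" (is ?P4)
    and s_divergence: "ctr (\<lambda>\<mu>. pd \<mu> s11 x) (m1 x) + ctr (\<lambda>\<mu>. pd \<mu> s12 x) (m2 x) = 0" (is ?P5)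
      "ctr (\<lambda>\<mu>. pd \<mu> s21 x) (m1 x) + ctr (\<lambda>\<mu>. pd \<mu> s22 x) (m2 x) = 0" (is ?P6)
proof -
  interpret null_frame "g x" "l x" "n x" "m1 x" "m2 x" by (rule frame[OF x])
  let ?w1 = "\<lambda>y. wedge (lc y) (mc1 y)" and ?w2 = "\<lambda>y. wedge (lc y) (mc2 y)"
  have d: "(\<lambda>y. low (g y) (v y) i) differentiable at x" if "\<And>i. smooth_on V (\<lambda>y. v y i)" for v i
    by (intro diff_at[OF smooth_low x] that)
  note d = d[OF smooth_frame(1)] d[OF smooth_frame(3)] d[OF smooth_frame(4)]
  have dw: "(\<lambda>y. ?w1 y \<mu> \<nu>) differentiable at x" "(\<lambda>y. ?w2 y \<mu> \<nu>) differentiable at x" for \<mu> \<nu>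
    unfolding wedge_def by (intro differentiable_diff differentiable_mult d)+
  have *: "ctr (\<lambda>\<mu>. pd \<mu> s x) (l x) = 0 \<and> ctr (\<lambda>\<mu>. pd \<mu> t x) (l x) = 0 \<and> ctr (\<lambda>\<mu>. pd \<mu> s x) (m2 x) = ctr (\<lambda>\<mu>. pd \<mu> t x) (m1 x)"
    if a: "\<And>i. smooth_on V (\<lambda>y. a y i)" and st: "smooth_on V s" "smooth_on V t"
     and c: "\<And>y \<mu> \<nu>. y \<in> V \<Longrightarrow> curl a y \<mu> \<nu> = - (s y * ?w1 y \<mu> \<nu> + t y * ?w2 y \<mu> \<nu>) / 2" for a s t
  proof -
    have "pd r (\<lambda>y. curl a y \<mu> \<nu>) x = - (pd r s x * ?w1 x \<mu> \<nu> + s x * pd r (\<lambda>y. ?w1 y \<mu> \<nu>) x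
      + (pd r t x * ?w2 x \<mu> \<nu> + t x * pd r (\<lambda>y. ?w2 y \<mu> \<nu>) x)) / 2" for r \<mu> \<nu>
    proof -
      have "pd r (\<lambda>y. curl a y \<mu> \<nu>) x = pd r (\<lambda>y. (s y * ?w1 y \<mu> \<nu> + t y * ?w2 y \<mu> \<nu>) * (- 1 / 2)) x"
      by (rule pd_cong[OF V x]) (subst c, assumption, simp add: field_simps)
      also have "\<dots> = pd r (\<lambda>y. s y * ?w1 y \<mu> \<nu> + t y * ?w2 y \<mu> \<nu>) x * (- 1 / 2)"
      by (intro pd_cmult differentiable_add differentiable_mult dw st[THEN diff_at, OF x])
      finally show ?thesis
      by (simp add: pd_mult pd_add differentiable_mult dw st[THEN diff_at, OF x]; simp add: field_simps)
    qed
    note pd_curl = this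
    have e: "pd r (\<lambda>y. curl a y \<mu> \<nu>) x + pd \<mu> (\<lambda>y. curl a y \<nu> r) x + pd \<nu> (\<lambda>y. curl a y r \<mu>) x = 0" for r \<mu> \<nu>
      by (rule curl_closed[OF x]) (rule a)
    have "(pd r s x * ?w1 x \<mu> \<nu> + pd r t x * ?w2 x \<mu> \<nu>) + (pd \<mu> s x * ?w1 x \<nu> r + pd \<mu> t x * ?w2 x \<nu> r)
      + (pd \<nu> s x * ?w1 x r \<mu> + pd \<nu> t x * ?w2 x r \<mu>) = 0" for r \<mu> \<nu>
    proof -
      have "(pd r s x * ?w1 x \<mu> \<nu> + pd r t x * ?w2 x \<mu> \<nu>) + (pd \<mu> s x * ?w1 x \<nu> r + pd \<mu> t x * ?w2 x \<nu> r)
      + (pd \<nu> s x * ?w1 x r \<mu> + pd \<nu> t x * ?w2 x r \<mu>)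
      + s x * (pd r (\<lambda>y. ?w1 y \<mu> \<nu>) x + pd \<mu> (\<lambda>y. ?w1 y \<nu> r) x + pd \<nu> (\<lambda>y. ?w1 y r \<mu>) x)
      + t x * (pd r (\<lambda>y. ?w2 y \<mu> \<nu>) x + pd \<mu> (\<lambda>y. ?w2 y \<nu> r) x + pd \<nu> (\<lambda>y. ?w2 y r \<mu>) x) = 0"
      using e[of r \<mu> \<nu>] unfolding pd_curl by (simp add: field_simps)
      then show ?thesis
      unfolding wedge_closed[OF x] by simp
    qed
    from second_Bianchi[OF this[unfolded wedge_def]] show ?thesis by blast
  qed
  note s1 = *[OF smooth_a(1) smooth_s(1,2) curl_a(1)] and s2 = *[OF smooth_a(2) smooth_s(3,4) curl_a(2)]
  show ?P1 ?P2 ?P3 ?P4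
    using s1 s2 by auto
  have sym: "pd \<mu> s12 x = pd \<mu> s21 x" for \<mu>
    by (rule pd_cong[OF V x s12_eq_s21])
  have tr: "pd \<mu> s11 x = - pd \<mu> s22 x" for \<mu>
    using pd_trace[OF x, of \<mu>] by simp
  show ?P5
    using s1 s2 unfolding tr sym by (simp add: ctr_simps)
  show ?P6
    using s1 s2 unfolding tr sym by (simp add: ctr_simps)
qed

section \<open>The Yang--Mills equation\<close>

lemma det_g: "x \<in> V \<Longrightarrow> det (g x) \<noteq> 0"
  using invertible_g invertible_det_nz by blast

lemma vol_pos: "x \<in> V \<Longrightarrow> vol g x > 0"
  using det_g by (simp add: vol_def)

lemma vol_diff: "x \<in> V \<Longrightarrow> vol g differentiable at x"
  by (intro pd_vol(1)[OF diffs(1) sym_g christoffel_compatible det_g])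

lemma pd_vol_g: "x \<in> V \<Longrightarrow> pd \<mu> (vol g) x = vol g x * (\<Sum>k. christoffel g x k \<mu> k)"
  by (intro pd_vol(2)[OF diffs(1) sym_g christoffel_compatible det_g])

text \<open>The form \<open>a\<close> enters twice, through the divergence of \<open>m\<close> and
  through the change of \<open>m\<close> along \<open>l\<close>, and the two contributions cancel.
  The Christoffel terms cancel by their symmetry.\<close>

lemma divergence_bivector:
  assumes x: "x \<in> V" and ml: "m = m1 \<and> a = a1 \<or> m = m2 \<and> a = a2"
  shows "(\<Sum>\<nu>. pd \<nu> (\<lambda>y. vol g y * wedge (l y) (m y) \<mu> \<nu>) x) = 0"
proof -
  let ?G = "christoffel g x" and ?vol = "vol g x"
  note lc = adapted_pd[OF x adapted[OF x]]
  have dm: "(\<lambda>y. m y i) differentiable at x" for i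
    using ml diffs(4,5)[OF x] by auto
  have pdm: "pd \<nu> (\<lambda>y. m y i) x = a x \<nu> * l x i - (\<Sum>t. ?G i \<nu> t * m x t)" for \<nu> i
    using ml lc by auto
  note d = vol_diff[OF x] diffs(2)[OF x] dm
  have "(\<Sum>\<nu>. pd \<nu> (\<lambda>y. vol g y * wedge (l y) (m y) \<mu> \<nu>) x) =
    (\<Sum>\<nu>. ?vol * ((\<Sum>k. ?G k \<nu> k) * (l x \<mu> * m x \<nu> - m x \<mu> * l x \<nu>)
      + (- (\<Sum>t. ?G \<mu> \<nu> t * l x t) * m x \<nu> + l x \<mu> * (a x \<nu> * l x \<nu> - (\<Sum>t. ?G \<nu> \<nu> t * m x t))
      - ((a x \<nu> * l x \<mu> - (\<Sum>t. ?G \<mu> \<nu> t * m x t)) * l x \<nu> - m x \<mu> * (\<Sum>t. ?G \<nu> \<nu> t * l x t)))))"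
    unfolding wedge_def
    by (intro sum.cong refl) (simp add: pd_mult pd_diff d differentiable_mult differentiable_diff pd_vol_g[OF x] lc pdm; simp add: algebra_simps)
  also have "\<dots> = ?vol * (l x \<mu> * ((\<Sum>\<nu> k. ?G k \<nu> k * m x \<nu>) - (\<Sum>\<nu> t. ?G \<nu> \<nu> t * m x t))
      - m x \<mu> * ((\<Sum>\<nu> k. ?G k \<nu> k * l x \<nu>) - (\<Sum>\<nu> t. ?G \<nu> \<nu> t * l x t))
      - ((\<Sum>\<nu> t. ?G \<mu> \<nu> t * l x t * m x \<nu>) - (\<Sum>\<nu> t. ?G \<mu> \<nu> t * m x t * l x \<nu>)))"
    by (simp add: sum_distrib_left sum_distrib_right sum.distrib sum_subtractf sum_negf algebra_simps)
  also have "(\<Sum>\<nu> k. ?G k \<nu> k * m x \<nu>) = (\<Sum>\<nu> t. ?G \<nu> \<nu> t * m x t)"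
    by (subst sum.swap, subst christoffel_symmetric[OF x]) (rule refl)
  also have "(\<Sum>\<nu> k. ?G k \<nu> k * l x \<nu>) = (\<Sum>\<nu> t. ?G \<nu> \<nu> t * l x t)"
    by (subst sum.swap, subst christoffel_symmetric[OF x]) (rule refl)
  also have "(\<Sum>\<nu> t. ?G \<mu> \<nu> t * l x t * m x \<nu>) = (\<Sum>\<nu> t. ?G \<mu> \<nu> t * m x t * l x \<nu>)"
    by (subst sum.swap, subst christoffel_symmetric[OF x]) (simp add: mult_ac)
  finally show ?thesis by simp
qed

section \<open>Null rotations and the Yang-Mills equation\<close>

definition X1 :: "vec4 \<Rightarrow> 4 \<Rightarrow> 4 \<Rightarrow> real" where "X1 x k t = m1 x k * lc x t - l x k * mc1 x t"
definition X2 :: "vec4 \<Rightarrow> 4 \<Rightarrow> 4 \<Rightarrow> real" where "X2 x k t = m2 x k * lc x t - l x k * mc2 x t"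

lemma X_diff:
  assumes x: "x \<in> V"
  shows "(\<lambda>y. X1 y k t) differentiable at x" "(\<lambda>y. X2 y k t) differentiable at x"
  unfolding X1_def X2_def
  by (intro differentiable_diff differentiable_mult diffs[OF x] diff_at[OF smooth_low x] smooth_frame)+

text \<open>Null rotations about \<open>l\<close> commute, so \<open>A1\<close> and
  \<open>A2\<close> drop out; the rotation \<open>B\<close> turns one endomorphism into the
  other.\<close>

lemma cov_X:
  assumes x: "x \<in> V" and ad: "adapted_at Gam A1 A2 B x"
  shows "pd \<nu> (\<lambda>y. X1 y k t) x + (\<Sum>h. Gam x k \<nu> h * X1 x h t) - (\<Sum>h. Gam x h \<nu> t * X1 x k h)
      = - B x \<nu> * X2 x k t" (is ?X1)
    and "pd \<nu> (\<lambda>y. X2 y k t) x + (\<Sum>h. Gam x k \<nu> h * X2 x h t) - (\<Sum>h. Gam x h \<nu> t * X2 x k h)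
      = B x \<nu> * X1 x k t" (is ?X2)
proof -
  have dlow: "(\<lambda>y. lc y i) differentiable at x" "(\<lambda>y. mc1 y i) differentiable at x" "(\<lambda>y. mc2 y i) differentiable at x" for i
    by (intro diff_at[OF smooth_low x] smooth_frame)+
  note simps = pd_diff pd_mult differentiable_mult dlow diffs[OF x] adapted_pd[OF x ad] adapted_pd_low[OF x ad]
  show ?X1 ?X2 unfolding X1_def X2_def
    by (simp_all add: simps; simp add: sum_distrib_left sum_distrib_right sum_subtractf algebra_simps)+
qed

text \<open>The left hand side has three parts. Derivatives of the coefficients vanish by
  \<open>along_l\<close> and \<open>div\<close>. The bivectors are divergence free for the
  Levi-Civita connection, which the volume density accounts for, as \<open>Gam\<close> acts on the
  endomorphism indices only. The endomorphisms contribute \<open>B\<close>, a multiple of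
  \<open>l\<close>, contracted with bivectors orthogonal to \<open>l\<close>.\<close>

lemma ym_equation_if_adapted:
  assumes x: "x \<in> V" and ad: "adapted_at Gam A1 A2 B x" and B: "\<And>\<nu>. B x \<nu> = b * lc x \<nu>"
    and cu: "\<And>y k t \<mu> \<nu>. y \<in> V \<Longrightarrow> curv_up g Gam y k t \<mu> \<nu> =
      (p1 y * wedge (l y) (m1 y) \<mu> \<nu> + q1 y * wedge (l y) (m2 y) \<mu> \<nu>) * X1 y k t
     + (p2 y * wedge (l y) (m1 y) \<mu> \<nu> + q2 y * wedge (l y) (m2 y) \<mu> \<nu>) * X2 y k t"
    and diff: "p1 differentiable at x" "q1 differentiable at x" "p2 differentiable at x" "q2 differentiable at x"
    and along_l: "ctr (\<lambda>\<nu>. pd \<nu> p1 x) (l x) = 0" "ctr (\<lambda>\<nu>. pd \<nu> q1 x) (l x) = 0"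
      "ctr (\<lambda>\<nu>. pd \<nu> p2 x) (l x) = 0" "ctr (\<lambda>\<nu>. pd \<nu> q2 x) (l x) = 0"
    and div: "ctr (\<lambda>\<nu>. pd \<nu> p1 x) (m1 x) + ctr (\<lambda>\<nu>. pd \<nu> q1 x) (m2 x) = 0"
      "ctr (\<lambda>\<nu>. pd \<nu> p2 x) (m1 x) + ctr (\<lambda>\<nu>. pd \<nu> q2 x) (m2 x) = 0"
  shows "ym_equation_at g Gam x"
  unfolding ym_equation_at_def
proof (intro allI)
  fix k t \<mu>
  interpret null_frame "g x" "l x" "n x" "m1 x" "m2 x" by (rule frame[OF x])
  let ?v = "vol g x" and ?pdU = "\<Sum>\<nu>. pd \<nu> (\<lambda>y. vol g y * curv_up g Gam y k t \<mu> \<nu>) x"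
  let ?Q = "\<Sum>\<nu> h. Gam x k \<nu> h * curv_up g Gam x h t \<mu> \<nu>" and ?R = "\<Sum>\<nu> h. Gam x h \<nu> t * curv_up g Gam x k h \<mu> \<nu>"
  let ?L = "\<lambda>X \<nu>. \<Sum>h. Gam x k \<nu> h * X x h t" and ?r = "\<lambda>X \<nu>. \<Sum>h. Gam x h \<nu> t * X x k h"
  let ?w1 = "\<lambda>y \<nu>. vol g y * wedge (l y) (m1 y) \<mu> \<nu>" and ?w2 = "\<lambda>y \<nu>. vol g y * wedge (l y) (m2 y) \<mu> \<nu>"
  have dw: "(\<lambda>y. ?w1 y \<nu>) differentiable at x" "(\<lambda>y. ?w2 y \<nu>) differentiable at x" for \<nu>
    unfolding wedge_def by (intro differentiable_mult differentiable_diff diffs[OF x] vol_diff[OF x])+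
  \<comment> \<open>For the coefficients of \<open>X1\<close> and \<open>X2\<close>:
    \<open>E\<close> is the bivector times the volume density, \<open>d\<close> its derivative with
    the scalars frozen, \<open>e\<close> that with the bivectors frozen.\<close>
  define E1 where "E1 \<nu> = p1 x * ?w1 x \<nu> + q1 x * ?w2 x \<nu>" for \<nu>
  define E2 where "E2 \<nu> = p2 x * ?w1 x \<nu> + q2 x * ?w2 x \<nu>" for \<nu>
  define d1 where "d1 \<nu> = p1 x * pd \<nu> (\<lambda>y. ?w1 y \<nu>) x + q1 x * pd \<nu> (\<lambda>y. ?w2 y \<nu>) x" for \<nu>
  define d2 where "d2 \<nu> = p2 x * pd \<nu> (\<lambda>y. ?w1 y \<nu>) x + q2 x * pd \<nu> (\<lambda>y. ?w2 y \<nu>) x" for \<nu>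
  define e1 where "e1 \<nu> = pd \<nu> p1 x * ?w1 x \<nu> + pd \<nu> q1 x * ?w2 x \<nu>" for \<nu>
  define e2 where "e2 \<nu> = pd \<nu> p2 x * ?w1 x \<nu> + pd \<nu> q2 x * ?w2 x \<nu>" for \<nu>
  have U: "?v * curv_up g Gam x k t \<mu> \<nu> = E1 \<nu> * X1 x k t + E2 \<nu> * X2 x k t" for k t \<nu>
    unfolding cu[OF x] E1_def E2_def by (simp add: algebra_simps)
  have pdU: "pd \<nu> (\<lambda>y. vol g y * curv_up g Gam y k t \<mu> \<nu>) x =
      (e1 \<nu> + d1 \<nu>) * X1 x k t + E1 \<nu> * pd \<nu> (\<lambda>y. X1 y k t) x
    + ((e2 \<nu> + d2 \<nu>) * X2 x k t + E2 \<nu> * pd \<nu> (\<lambda>y. X2 y k t) x)" for \<nu>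
  proof -
    have "pd \<nu> (\<lambda>y. vol g y * curv_up g Gam y k t \<mu> \<nu>) x =
      pd \<nu> (\<lambda>y. (p1 y * ?w1 y \<nu> + q1 y * ?w2 y \<nu>) * X1 y k t + (p2 y * ?w1 y \<nu> + q2 y * ?w2 y \<nu>) * X2 y k t) x"
      by (rule pd_cong[OF V x]) (simp add: cu algebra_simps)
    also have "\<dots> = (pd \<nu> p1 x * ?w1 x \<nu> + p1 x * pd \<nu> (\<lambda>y. ?w1 y \<nu>) x + (pd \<nu> q1 x * ?w2 x \<nu> + q1 x * pd \<nu> (\<lambda>y. ?w2 y \<nu>) x)) * X1 x k t
      + (p1 x * ?w1 x \<nu> + q1 x * ?w2 x \<nu>) * pd \<nu> (\<lambda>y. X1 y k t) x
      + ((pd \<nu> p2 x * ?w1 x \<nu> + p2 x * pd \<nu> (\<lambda>y. ?w1 y \<nu>) x + (pd \<nu> q2 x * ?w2 x \<nu> + q2 x * pd \<nu> (\<lambda>y. ?w2 y \<nu>) x)) * X2 x k t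
      + (p2 x * ?w1 x \<nu> + q2 x * ?w2 x \<nu>) * pd \<nu> (\<lambda>y. X2 y k t) x)"
      by (simp add: pd_add pd_mult[where f = "\<lambda>y. _ y + _ y"] pd_mult[where g = "\<lambda>y. ?w1 y \<nu>"] pd_mult[where g = "\<lambda>y. ?w2 y \<nu>"]
      differentiable_add differentiable_mult diff dw X_diff[OF x])
    finally show ?thesis
      unfolding e1_def e2_def d1_def d2_def E1_def E2_def by (simp add: algebra_simps)
  qed
  have sd: "(\<Sum>\<nu>. d1 \<nu>) = 0" "(\<Sum>\<nu>. d2 \<nu>) = 0"
    unfolding d1_def d2_def
    using divergence_bivector[OF x, of m1 a1 \<mu>] divergence_bivector[OF x, of m2 a2 \<mu>]
    by (simp_all add: sum.distrib flip: sum_distrib_left)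
  have "(\<Sum>\<nu>. pd \<nu> f x * ?w1 x \<nu> + pd \<nu> h x * ?w2 x \<nu>) =
      ?v * (l x \<mu> * (ctr (\<lambda>\<nu>. pd \<nu> f x) (m1 x) + ctr (\<lambda>\<nu>. pd \<nu> h x) (m2 x))
      - m1 x \<mu> * ctr (\<lambda>\<nu>. pd \<nu> f x) (l x) - m2 x \<mu> * ctr (\<lambda>\<nu>. pd \<nu> h x) (l x))" for f h
    unfolding wedge_def ctr_def by (simp add: sum_distrib_left sum.distrib sum_subtractf algebra_simps)
  then have se: "(\<Sum>\<nu>. e1 \<nu>) = 0" "(\<Sum>\<nu>. e2 \<nu>) = 0"
    unfolding e1_def e2_def by (simp_all add: along_l div)
  have l0: "ctr E1 (lc x) = 0" "ctr E2 (lc x) = 0"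
  proof -
    have c: "ctr (l x) (lc x) = 0" "ctr (m1 x) (lc x) = 0" "ctr (m2 x) (lc x) = 0"
      using products by (simp_all add: ctr_def mult.commute)
    show "ctr E1 (lc x) = 0" "ctr E2 (lc x) = 0"
      unfolding E1_def[abs_def] E2_def[abs_def] wedge_def by (simp_all add: ctr_simps c)
  qed
  have "?v * (?Q - ?R) = (\<Sum>\<nu> h. Gam x k \<nu> h * (?v * curv_up g Gam x h t \<mu> \<nu>))
     - (\<Sum>\<nu> h. Gam x h \<nu> t * (?v * curv_up g Gam x k h \<mu> \<nu>))"
    by (simp add: right_diff_distrib sum_distrib_left; simp add: mult_ac)
  also have "\<dots> = (\<Sum>\<nu>. E1 \<nu> * (?L X1 \<nu> - ?r X1 \<nu>) + E2 \<nu> * (?L X2 \<nu> - ?r X2 \<nu>))"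
    unfolding U by (simp add: sum_distrib_left sum.distrib sum_subtractf algebra_simps)
  finally have G: "?v * (?Q - ?R) = (\<Sum>\<nu>. E1 \<nu> * (?L X1 \<nu> - ?r X1 \<nu>) + E2 \<nu> * (?L X2 \<nu> - ?r X2 \<nu>))" .
  have "?pdU + ?v * (?Q - ?R) = (\<Sum>\<nu>. (e1 \<nu> + d1 \<nu>) * X1 x k t + (e2 \<nu> + d2 \<nu>) * X2 x k t
      + E1 \<nu> * (pd \<nu> (\<lambda>y. X1 y k t) x + ?L X1 \<nu> - ?r X1 \<nu>) + E2 \<nu> * (pd \<nu> (\<lambda>y. X2 y k t) x + ?L X2 \<nu> - ?r X2 \<nu>))"
    unfolding G pdU sum.distrib[symmetric] by (intro sum.cong refl) (simp only: algebra_simps)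
  also have "\<dots> = (\<Sum>\<nu>. (e1 \<nu> + d1 \<nu>) * X1 x k t + (e2 \<nu> + d2 \<nu>) * X2 x k t
      + E1 \<nu> * (- (b * lc x \<nu>) * X2 x k t) + E2 \<nu> * (b * lc x \<nu> * X1 x k t))"
    unfolding cov_X[OF x ad] B ..
  also have "\<dots> = ((\<Sum>\<nu>. e1 \<nu>) + (\<Sum>\<nu>. d1 \<nu>)) * X1 x k t + ((\<Sum>\<nu>. e2 \<nu>) + (\<Sum>\<nu>. d2 \<nu>)) * X2 x k t
      - ctr E1 (lc x) * b * X2 x k t + ctr E2 (lc x) * b * X1 x k t"
    unfolding ctr_def by (simp add: sum_distrib_left sum_distrib_right sum.distrib sum_subtractf sum_negf algebra_simps)
  finally have z: "?pdU + ?v * (?Q - ?R) = 0" by (simp add: se sd l0)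
  have r: "P + v * (Q - R) = 0 \<Longrightarrow> v \<noteq> 0 \<Longrightarrow> 1 / v * P + Q - R = 0" for P Q R v :: real
    by (simp add: field_simps)
  show "1 / ?v * ?pdU + ?Q - ?R = 0"
    by (rule r[OF z]) (use vol_pos[OF x] in simp)
qed

lemma curv_up_if_curvature:
  assumes x: "x \<in> V"
    and R: "\<And>k t \<mu> \<nu>. curvature Gam x k t \<mu> \<nu> =
      (p1 * wedge (lc x) (mc1 x) \<mu> \<nu> + q1 * wedge (lc x) (mc2 x) \<mu> \<nu>) * X1 x k t
     + (p2 * wedge (lc x) (mc1 x) \<mu> \<nu> + q2 * wedge (lc x) (mc2 x) \<mu> \<nu>) * X2 x k t"
  shows "curv_up g Gam x k t \<mu> \<nu> =
      (p1 * wedge (l x) (m1 x) \<mu> \<nu> + q1 * wedge (l x) (m2 x) \<mu> \<nu>) * X1 x k t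
     + (p2 * wedge (l x) (m1 x) \<mu> \<nu> + q2 * wedge (l x) (m2 x) \<mu> \<nu>) * X2 x k t"
proof -
  have r: "(\<Sum>i j. ginv g x $ \<mu> $ i * ginv g x $ \<nu> $ j * wedge (low (g x) u) (low (g x) v) i j) = wedge u v \<mu> \<nu>" for u v
  proof -
    have "(\<Sum>i j. ginv g x $ \<mu> $ i * ginv g x $ \<nu> $ j * wedge (low (g x) u) (low (g x) v) i j) =
      (\<Sum>i. ginv g x $ \<mu> $ i * low (g x) u i) * (\<Sum>j. ginv g x $ \<nu> $ j * low (g x) v j)
     - (\<Sum>i. ginv g x $ \<mu> $ i * low (g x) v i) * (\<Sum>j. ginv g x $ \<nu> $ j * low (g x) u j)"
      unfolding sum_product by (simp add: wedge_def right_diff_distrib sum_subtractf; simp add: mult_ac)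
    then show ?thesis by (simp add: raise_low[OF x] wedge_def)
  qed
  have "curv_up g Gam x k t \<mu> \<nu> =
      (p1 * (\<Sum>i j. ginv g x $ \<mu> $ i * ginv g x $ \<nu> $ j * wedge (lc x) (mc1 x) i j)
      + q1 * (\<Sum>i j. ginv g x $ \<mu> $ i * ginv g x $ \<nu> $ j * wedge (lc x) (mc2 x) i j)) * X1 x k t
    + (p2 * (\<Sum>i j. ginv g x $ \<mu> $ i * ginv g x $ \<nu> $ j * wedge (lc x) (mc1 x) i j)
      + q2 * (\<Sum>i j. ginv g x $ \<mu> $ i * ginv g x $ \<nu> $ j * wedge (lc x) (mc2 x) i j)) * X2 x k t"
    unfolding curv_up_def R
    by (simp add: sum_distrib_left sum_distrib_right distrib_left distrib_right sum.distrib; simp add: mult_ac)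
  then show ?thesis unfolding r .
qed

text \<open>All products of the endomorphisms \<open>X1\<close>, \<open>X2\<close> are trace free. The contraction involves no metric, whence the Lagrangian vanishes for every metric.\<close>

lemma trace_curvature_square:
  assumes x: "x \<in> V"
    and R: "\<And>k t \<mu> \<nu>. curvature Gam x k t \<mu> \<nu> = F1 \<mu> \<nu> * X1 x k t + F2 \<mu> \<nu> * X2 x k t"
  shows "(\<Sum>k t. curvature Gam x k t \<mu> \<nu> * curvature Gam x t k i j) = 0"
proof -
  interpret null_frame "g x" "l x" "n x" "m1 x" "m2 x" by (rule frame[OF x])
  have tr: "(\<Sum>k t. (u k * p t - u' k * p' t) * (v t * q k - v' t * q' k)) =
     ctr q u * ctr p v - ctr q' u * ctr p v' - ctr q u' * ctr p' v + ctr q' u' * ctr p' v'" for u p u' p' v q v' q'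
    unfolding ctr_def sum_product
    by (simp add: left_diff_distrib right_diff_distrib sum_subtractf sum.distrib; simp add: mult_ac)
  have "(\<Sum>k t. X1 x k t * X1 x t k) = 0" "(\<Sum>k t. X1 x k t * X2 x t k) = 0"
    "(\<Sum>k t. X2 x k t * X1 x t k) = 0" "(\<Sum>k t. X2 x k t * X2 x t k) = 0"
    unfolding X1_def X2_def tr by (simp_all add: products)
  moreover have "(\<Sum>k t. curvature Gam x k t \<mu> \<nu> * curvature Gam x t k i j) =
      F1 \<mu> \<nu> * F1 i j * (\<Sum>k t. X1 x k t * X1 x t k) + F1 \<mu> \<nu> * F2 i j * (\<Sum>k t. X1 x k t * X2 x t k)
    + F2 \<mu> \<nu> * F1 i j * (\<Sum>k t. X2 x k t * X1 x t k) + F2 \<mu> \<nu> * F2 i j * (\<Sum>k t. X2 x k t * X2 x t k)"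
    unfolding R
    by (simp add: sum_distrib_left distrib_left distrib_right sum.distrib; simp add: mult_ac)
  ultimately show ?thesis by simp
qed

end

section \<open>Axial torsion\<close>

text \<open>The difference of \<open>K\<close> and half of \<open>T\<close> is symmetric in the last
  two indices and antisymmetric in the outer two, which forces it to vanish, as in the uniqueness of
  the Levi-Civita connection.\<close>

lemma contortion_of_axial_torsion:
  assumes anti: "\<And>i \<mu> j. K j \<mu> i = - K i \<mu> j"
    and T: "\<And>i \<mu> j. K i \<mu> j - K i j \<mu> = T i \<mu> j"
    and T_anti: "\<And>i \<mu> j. T \<mu> i j = - T i \<mu> j" "\<And>i \<mu> j. T i j \<mu> = - T i \<mu> j"
  shows "K i \<mu> j = T i \<mu> j / (2 :: real)"
  using anti[of i \<mu> j] anti[of \<mu> i j] anti[of i j \<mu>] T[of i \<mu> j] T[of \<mu> i j] T[of j i \<mu>]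
    T_anti(1)[of i \<mu> j] T_anti(1)[of i j \<mu>] T_anti(2)[of i \<mu> j] T_anti(1)[of \<mu> j i] T_anti(2)[of \<mu> i j] T_anti(2)[of j i \<mu>]
  by linarith

locale axial_torsion_frame = parallel_frame +
  fixes Gam :: conn and phi :: "vec4 \<Rightarrow> real" and k :: "real \<Rightarrow> real"
  assumes smooth_Gam: "smooth_on V (\<lambda>x. Gam x t \<mu> \<nu>)"
    and compatible_Gam: "x \<in> V \<Longrightarrow> metric_compatible_at g Gam x"
    and torsion_Gam: "x \<in> V \<Longrightarrow> torsion_low g Gam x t \<mu> \<nu> = hodge1 g (\<lambda>y i. k (phi y) * l y i) x t \<mu> \<nu>"
    and smooth_phi: "smooth_on V phi" and pd_phi: "x \<in> V \<Longrightarrow> pd \<mu> phi x = lc x \<mu>"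
    and smooth_k: "smooth_on UNIV k"
begin

text \<open>This is locally constant, and its sign compares the frame with the coordinate orientation.\<close>

definition orient :: "vec4 \<Rightarrow> real" where
  "orient x = vol g x * det (rows4 (l x) (n x) (m1 x) (m2 x)) / 2"

text \<open>By \<open>det_null_frame\<close> the square of \<open>orient\<close> is a nonzero
  constant (in fact 1), so the product rule makes the derivative vanish. No connectedness of
  \<open>V\<close> enters.\<close>

lemma
  assumes x: "x \<in> V"
  shows diff_orient: "orient differentiable at x" and pd_orient: "pd \<mu> orient x = 0"
proof -
  have ginv: "matrix_inv (g y) $ i $ j = (l y i * n y j + n y i * l y j) / 2 - m1 y i * m1 y j - m2 y i * m2 y j"
    if "y \<in> V" for y i j
    using ginv_eq[OF that] by (simp add: ginv_def)
  have sq: "orient y * orient y = 1 / (4 * \<bar>det frame_metric\<bar>)" if y: "y \<in> V" for y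
  proof -
    let ?d = "det (rows4 (l y) (n y) (m1 y) (m2 y))"
    have d: "det frame_metric * ?d\<^sup>2 * det (g y) = 1"
      by (rule det_null_frame[OF sym_g[OF y] invertible_g[OF y] ginv[OF y]])
    have "4 * (orient y * orient y) = \<bar>det (g y)\<bar> * ?d\<^sup>2"
      by (simp add: orient_def power2_eq_square vol_def algebra_simps flip: real_sqrt_mult)
    moreover have "\<bar>det frame_metric\<bar> * (\<bar>det (g y)\<bar> * ?d\<^sup>2) = 1"
      using arg_cong[OF d, of abs] by (simp add: abs_mult mult_ac)
    moreover have "p = 1 / (4 * c)" if "4 * p = q" "c * q = 1" for p q c :: real
      using that by (cases "c = 0") (auto simp: field_simps)
    ultimately show ?thesis by blast
  qed
  have "(\<lambda>y. det (rows4 (l y) (n y) (m1 y) (m2 y))) differentiable at x"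
    unfolding det_rows4 using diffs[OF x]
    by (intro differentiable_sum ballI differentiable_mult) auto
  then have "(\<lambda>y. vol g y * det (rows4 (l y) (n y) (m1 y) (m2 y)) * (1 / 2)) differentiable at x"
    by (intro differentiable_mult vol_diff[OF x]) auto
  then show d: "orient differentiable at x"
    by (simp add: orient_def[abs_def])
  have "pd \<mu> (\<lambda>y. orient y * orient y) x = 0"
    by (rule pd_zero_on[OF V x sq])
  then have "orient x * pd \<mu> orient x = 0"
    by (simp add: pd_mult[OF d d])
  moreover have "orient x \<noteq> 0"
  proof
    assume "orient x = 0"
    moreover have "det frame_metric \<noteq> 0"
      using det_null_frame[OF sym_g[OF x] invertible_g[OF x] ginv[OF x]] by auto
    ultimately show False using sq[OF x] by simp
  qed
  ultimately show "pd \<mu> orient x = 0" by simp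
qed

text \<open>Indexed by the order because differentiation raises \<open>j\<close> by one, the
  gradient of the phase being \<open>l\<close>. Orders 0, 1, 2 enter the torsion, the curvature and
  the derivative of the curvature.\<close>

definition strength :: "nat \<Rightarrow> vec4 \<Rightarrow> real" where
  "strength j x = orient x * ((deriv ^^ j) k) (phi x)"

lemma smooth_deriv:
  fixes f :: "real \<Rightarrow> real"
  assumes "smooth_on UNIV f"
  shows "(f has_real_derivative deriv f z) (at z)" and "smooth_on UNIV (deriv f)"
proof -
  have d: "f differentiable at z" for z
    by (rule smooth_on_differentiable[OF open_UNIV assms UNIV_I])
  show 1: "(f has_real_derivative deriv f z) (at z)" for z
    using d[of z] by (simp add: DERIV_deriv_iff_real_differentiable)
  have "frechet_derivative f (at z) 1 = deriv f z" for z
    using frechet_derivativeI[OF 1[of z, unfolded has_field_derivative_def]] by simp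
  then show "smooth_on UNIV (deriv f)"
    using assms unfolding smooth_on_def by (metis (mono_tags, lifting) Basis_real_def Ck_on.simps(2) Ck_on_cong insertI1 open_UNIV)
qed

lemma
  assumes x: "x \<in> V"
  shows diff_strength: "strength j differentiable at x" (is ?P1)
    and pd_strength: "pd \<mu> (strength j) x = strength (Suc j) x * lc x \<mu>" (is ?P2)
proof -
  have sm: "smooth_on UNIV ((deriv ^^ j) k)" for j
    by (induction j) (auto intro: smooth_k smooth_deriv(2))
  have dphi: "phi differentiable at x" by (rule diff_at[OF smooth_phi x])
  have D: "((\<lambda>y. ((deriv ^^ j) k) (phi y)) has_derivative
      (\<lambda>h. deriv ((deriv ^^ j) k) (phi x) * frechet_derivative phi (at x) h)) (at x)"
    using has_derivative_compose[OF has_derivative_pd[OF dphi] smooth_deriv(1)[OF sm, unfolded has_field_derivative_def]]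
    by simp
  then have d: "(\<lambda>y. ((deriv ^^ j) k) (phi y)) differentiable at x" by (rule differentiableI)
  show ?P1
    unfolding strength_def[abs_def] by (intro differentiable_mult diff_orient[OF x] d)
  have "pd \<mu> (\<lambda>y. ((deriv ^^ j) k) (phi y)) x = ((deriv ^^ Suc j) k) (phi x) * lc x \<mu>"
    using pdI[OF D, of \<mu>] pd_phi[OF x, of \<mu>] by (simp add: pd_def)
  then show ?P2
    unfolding strength_def[abs_def] by (simp add: pd_mult[OF diff_orient[OF x] d] pd_orient[OF x])
qed

text \<open>The one-forms of the full connection; the terms with \<open>strength\<close> result from
  applying the contortion to \<open>m1\<close> and \<open>m2\<close>.\<close>

abbreviation "A1 x \<mu> \<equiv> a1 x \<mu> + strength 0 x / 2 * mc2 x \<mu>"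
abbreviation "A2 x \<mu> \<equiv> a2 x \<mu> - strength 0 x / 2 * mc1 x \<mu>"
abbreviation "B x \<mu> \<equiv> strength 0 x / 2 * lc x \<mu>"

text \<open>The contraction of the volume form with \<open>l\<close> is itself annihilated by
  \<open>l\<close>, hence a multiple of the wedge product of \<open>l\<close>, \<open>m1\<close>,
  \<open>m2\<close>; its value on \<open>n\<close>, \<open>m1\<close>, \<open>m2\<close> is the
  determinant of the frame.\<close>

lemma torsion_frame:
  assumes x: "x \<in> V"
  shows "torsion_low g Gam x \<kappa> \<mu> \<nu> = strength 0 x *
    (lc x \<kappa> * (mc1 x \<mu> * mc2 x \<nu> - mc2 x \<mu> * mc1 x \<nu>) + mc1 x \<kappa> * (mc2 x \<mu> * lc x \<nu> - lc x \<mu> * mc2 x \<nu>)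
     + mc2 x \<kappa> * (lc x \<mu> * mc1 x \<nu> - mc1 x \<mu> * lc x \<nu>))"
proof -
  interpret null_frame "g x" "l x" "n x" "m1 x" "m2 x" by (rule frame[OF x])
  define W where "W a b c = (\<Sum>i. l x i * levi_civita i a b c)" for a b c
  have T: "torsion_low g Gam x \<kappa> \<mu> \<nu> = vol g x * k (phi x) * W \<kappa> \<mu> \<nu>"
    by (simp add: torsion_Gam[OF x] hodge1_def W_def sum_distrib_left mult_ac)
  have anti: "W b a c = - W a b c" "W a c b = - W a b c" for a b c
    unfolding W_def levi_civita_swap(2)[of _ b a] levi_civita_swap(3)[of _ _ c b] by (simp_all add: sum_negf)
  have "ctr (\<lambda>a. W a b c) (l x) = (\<Sum>a i. l x i * levi_civita i a b c * l x a)" for b c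
    by (simp add: ctr_def W_def sum_distrib_right)
  also have "\<dots> b c = (\<Sum>i a. - (l x a * levi_civita a i b c * l x i))" for b c
    by (subst sum.swap, subst levi_civita_swap(1)) (simp add: mult_ac)
  finally have "ctr (\<lambda>a. W a b c) (l x) = - ctr (\<lambda>a. W a b c) (l x)" for b c
    by (simp add: ctr_def W_def sum_distrib_right sum_negf)
  then have l0: "ctr (\<lambda>a. W a b c) (l x) = 0" for b c
    by (metis neg_equal_zero)
  have "ctr (\<lambda>c. ctr (\<lambda>b. ctr (\<lambda>a. W a b c) (n x)) (m1 x)) (m2 x) =
     (\<Sum>d \<gamma> j i. levi_civita i j \<gamma> d * l x i * n x j * m1 x \<gamma> * m2 x d)"
    by (simp add: ctr_def W_def sum_distrib_right; simp add: mult_ac)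
  also have "\<dots> = det (rows4 (l x) (n x) (m1 x) (m2 x))"
    unfolding det_rows4 sum_to_tuple4
    by (rule sum.reindex_bij_witness[of _ "\<lambda>(i, j, \<gamma>, d). (d, \<gamma>, j, i)" "\<lambda>(d, \<gamma>, j, i). (i, j, \<gamma>, d)"]) auto
  finally show ?thesis
    using three_form_annihilated_by_l[of W, OF anti l0, of \<kappa> \<mu> \<nu>]
    unfolding T by (simp add: strength_def orient_def)
qed

text \<open>Compatibility of both connections makes the contortion antisymmetric in its outer
  indices, so it is half the torsion. It leaves \<open>l\<close> parallel because \<open>l\<close>,
  \<open>m1\<close>, \<open>m2\<close> are all orthogonal to \<open>l\<close>.\<close>

lemma adapted_Gam:
  assumes x: "x \<in> V"
  shows "adapted_at Gam A1 A2 B x"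
proof -
  interpret null_frame "g x" "l x" "n x" "m1 x" "m2 x" by (rule frame[OF x])
  note lc = adapted[OF x, unfolded adapted_at_def]
  define K where "K c \<mu> \<nu> = Gam x c \<mu> \<nu> - christoffel g x c \<mu> \<nu>" for c \<mu> \<nu>
  define Kl where "Kl c \<mu> \<nu> = low (g x) (\<lambda>h. K h \<mu> \<nu>) c" for c \<mu> \<nu>
  note gs = transpose_eqD[OF Q_sym]
  have "Kl j \<mu> i = - Kl i \<mu> j" for i \<mu> j
  proof -
    have "(\<Sum>c. Gam x c \<mu> i * g x $ c $ j) + (\<Sum>c. Gam x c \<mu> j * g x $ i $ c) =
      (\<Sum>c. christoffel g x c \<mu> i * g x $ c $ j) + (\<Sum>c. christoffel g x c \<mu> j * g x $ i $ c)"
      using compatible_Gam[OF x] christoffel_compatible[OF x] unfolding metric_compatible_at_def by metis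
    moreover have "Kl j \<mu> i = (\<Sum>c. Gam x c \<mu> i * g x $ c $ j) - (\<Sum>c. christoffel g x c \<mu> i * g x $ c $ j)"
      unfolding Kl_def K_def low_def by (simp add: sum_subtractf right_diff_distrib gs[of j] mult.commute)
    moreover have "Kl i \<mu> j = (\<Sum>c. Gam x c \<mu> j * g x $ i $ c) - (\<Sum>c. christoffel g x c \<mu> j * g x $ i $ c)"
      unfolding Kl_def K_def low_def by (simp add: sum_subtractf right_diff_distrib mult.commute)
    ultimately show ?thesis by linarith
  qed
  moreover have "Kl i \<mu> j - Kl i j \<mu> = torsion_low g Gam x i \<mu> j" for i \<mu> j
    unfolding Kl_def K_def low_def torsion_low_def torsion_def sum_subtractf[symmetric]
    by (intro sum.cong refl) (simp add: christoffel_symmetric[OF x, of _ j \<mu>] algebra_simps)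
  ultimately have Kl: "Kl c \<mu> \<nu> = torsion_low g Gam x c \<mu> \<nu> / 2" for c \<mu> \<nu>
    by (rule contortion_of_axial_torsion) (simp_all add: torsion_frame[OF x] algebra_simps)
  have K: "K c \<mu> \<nu> = strength 0 x / 2 *
    (l x c * (mc1 x \<mu> * mc2 x \<nu> - mc2 x \<mu> * mc1 x \<nu>) + m1 x c * (mc2 x \<mu> * lc x \<nu> - lc x \<mu> * mc2 x \<nu>)
     + m2 x c * (lc x \<mu> * mc1 x \<nu> - mc1 x \<mu> * lc x \<nu>))" for c \<mu> \<nu>
  proof -
    let ?v = "\<lambda>c. strength 0 x / 2 *
    (l x c * (mc1 x \<mu> * mc2 x \<nu> - mc2 x \<mu> * mc1 x \<nu>) + m1 x c * (mc2 x \<mu> * lc x \<nu> - lc x \<mu> * mc2 x \<nu>)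
     + m2 x c * (lc x \<mu> * mc1 x \<nu> - mc1 x \<mu> * lc x \<nu>))"
    have "low (g x) ?v i = strength 0 x / 2 *
    (lc x i * (mc1 x \<mu> * mc2 x \<nu> - mc2 x \<mu> * mc1 x \<nu>) + mc1 x i * (mc2 x \<mu> * lc x \<nu> - lc x \<mu> * mc2 x \<nu>)
     + mc2 x i * (lc x \<mu> * mc1 x \<nu> - mc1 x \<mu> * lc x \<nu>))" for i
      by (simp only: low_simps)
    then have "low (g x) ?v i = low (g x) (\<lambda>h. K h \<mu> \<nu>) i" for i
      unfolding Kl_def[symmetric] Kl torsion_frame[OF x] by simp
    then show ?thesis
      using raise_low[OF x, of c ?v] raise_low[OF x, of c "\<lambda>h. K h \<mu> \<nu>"] by simp
  qed
  have cov: "cov Gam v x \<mu> c = cov (christoffel g) v x \<mu> c + strength 0 x / 2 *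
    (l x c * (mc1 x \<mu> * ctr (mc2 x) (v x) - mc2 x \<mu> * ctr (mc1 x) (v x))
     + m1 x c * (mc2 x \<mu> * ctr (lc x) (v x) - lc x \<mu> * ctr (mc2 x) (v x))
     + m2 x c * (lc x \<mu> * ctr (mc1 x) (v x) - mc1 x \<mu> * ctr (lc x) (v x)))" for v \<mu> c
  proof -
    have "cov Gam v x \<mu> c = cov (christoffel g) v x \<mu> c + ctr (\<lambda>\<nu>. K c \<mu> \<nu>) (v x)"
      by (simp add: cov_def ctr_def K_def left_diff_distrib sum_subtractf)
    then show ?thesis unfolding K by (simp add: ctr_simps)
  qed
  show ?thesis
    unfolding adapted_at_def cov
    using lc compatible_Gam[OF x] by (simp add: products algebra_simps)
qed

text \<open>The matrix \<open>s\<close> with torsion corrections, times -1/2. The diagonal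
  corrections come from \<open>B\<close> wedge the contortion part of \<open>A1\<close>,
  \<open>A2\<close>, the antisymmetric off-diagonal ones from the derivative of
  \<open>k\<close>.\<close>

definition "P1 x = (s11 x + strength 0 x * strength 0 x * (1 / 2)) * (- 1 / 2)"
definition "Q1 x = (s12 x - strength 1 x) * (- 1 / 2)"
definition "P2 x = (s21 x + strength 1 x) * (- 1 / 2)"
definition "Q2 x = (s22 x + strength 0 x * strength 0 x * (1 / 2)) * (- 1 / 2)"

lemma
  assumes x: "x \<in> V"
  shows diff_PQ: "P1 differentiable at x" "Q1 differentiable at x" "P2 differentiable at x" "Q2 differentiable at x"
    and pd_PQ: "pd \<mu> P1 x = (pd \<mu> s11 x + strength 0 x * strength 1 x * lc x \<mu>) * (- 1 / 2)" (is ?P5)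
      "pd \<mu> Q1 x = (pd \<mu> s12 x - strength 2 x * lc x \<mu>) * (- 1 / 2)" (is ?P6)
      "pd \<mu> P2 x = (pd \<mu> s21 x + strength 2 x * lc x \<mu>) * (- 1 / 2)" (is ?P7)
      "pd \<mu> Q2 x = (pd \<mu> s22 x + strength 0 x * strength 1 x * lc x \<mu>) * (- 1 / 2)" (is ?P8)
proof -
  note d = smooth_s[THEN diff_at, OF x] diff_strength[OF x]
  show "P1 differentiable at x" "Q1 differentiable at x" "P2 differentiable at x" "Q2 differentiable at x"
    unfolding P1_def[abs_def] Q1_def[abs_def] P2_def[abs_def] Q2_def[abs_def]
    by (intro differentiable_mult differentiable_add differentiable_diff d differentiable_const)+
  have sq: "pd \<mu> (\<lambda>y. strength 0 y * strength 0 y * (1 / 2)) x = strength 0 x * strength 1 x * lc x \<mu>"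
    by (subst pd_cmult) (simp_all add: differentiable_mult d pd_mult pd_strength[OF x])
  have dsq: "(\<lambda>y. strength 0 y * strength 0 y * (1 / 2)) differentiable at x"
    by (intro differentiable_mult d differentiable_const)
  have s2: "pd \<mu> (strength 1) x = strength 2 x * lc x \<mu>"
    using pd_strength[OF x, of \<mu> 1] by (simp add: numeral_2_eq_2)
  show ?P5
    unfolding P1_def[abs_def]
    by (subst pd_cmult, intro differentiable_add d dsq) (simp only: pd_add[OF d(1) dsq] sq)
  show ?P8
    unfolding Q2_def[abs_def]
    by (subst pd_cmult, intro differentiable_add d dsq) (simp only: pd_add[OF d(4) dsq] sq)
  show ?P6
    unfolding Q1_def[abs_def]
    by (subst pd_cmult, intro differentiable_diff d) (simp only: pd_diff[OF d(2) d(5)] s2)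
  show ?P7
    unfolding P2_def[abs_def]
    by (subst pd_cmult, intro differentiable_add d) (simp only: pd_add[OF d(3) d(5)] s2)
qed

text \<open>Terms that mix \<open>a1\<close>, \<open>a2\<close> with the torsion cancel between the
  curls of \<open>A1\<close>, \<open>A2\<close> and their wedge products with
  \<open>B\<close>.\<close>

lemma curvature_Gam:
  assumes x: "x \<in> V"
  shows "curvature Gam x c t \<mu> \<nu> =
      (P1 x * wedge (lc x) (mc1 x) \<mu> \<nu> + Q1 x * wedge (lc x) (mc2 x) \<mu> \<nu>) * X1 x c t
     + (P2 x * wedge (lc x) (mc1 x) \<mu> \<nu> + Q2 x * wedge (lc x) (mc2 x) \<mu> \<nu>) * X2 x c t"
proof -
  have dlow: "(\<lambda>y. lc y i) differentiable at x" "(\<lambda>y. mc1 y i) differentiable at x" "(\<lambda>y. mc2 y i) differentiable at x" for i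
    by (intro diff_at[OF smooth_low x] smooth_frame)+
  have da: "(\<lambda>y. a1 y i) differentiable at x" "(\<lambda>y. a2 y i) differentiable at x" for i
    using smooth_a[THEN diff_at, OF x] by auto
  have dt: "(\<lambda>y. strength 0 y * (1 / 2)) differentiable at x"
    by (intro differentiable_mult diff_strength[OF x] differentiable_const)
  have pt: "pd \<mu> (\<lambda>y. strength 0 y * (1 / 2)) x = strength 1 x * lc x \<mu> * (1 / 2)" for \<mu>
    by (subst pd_cmult) (simp_all add: diff_strength[OF x] pd_strength[OF x])
  have half: "strength 0 y / 2 * z = strength 0 y * (1 / 2) * z" for y z by simp
  have d: "(\<lambda>y. A1 y i) differentiable at x" "(\<lambda>y. A2 y i) differentiable at x" "(\<lambda>y. B y i) differentiable at x" for i
    unfolding half by (intro differentiable_mult[OF dt] differentiable_add differentiable_diff dlow da)+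
  \<comment> \<open>Christoffel contractions are symmetric in the free indices and thus drop out of
    every curl.\<close>
  define G where "G \<mu> \<nu> p = (\<Sum>c. christoffel g x c \<mu> \<nu> * p c)" for \<mu> \<nu> and p :: "4 \<Rightarrow> real"
  have G: "G \<mu> \<nu> p = G \<nu> \<mu> p" for \<mu> \<nu> p
    unfolding G_def by (subst christoffel_symmetric[OF x]) (rule refl)
  note low = adapted_pd_low[OF x adapted[OF x], folded G_def]
  have pA1: "pd \<mu> (\<lambda>y. A1 y \<nu>) x = pd \<mu> (\<lambda>y. a1 y \<nu>) x + (strength 1 x * lc x \<mu> * (1 / 2) * mc2 x \<nu>
      + strength 0 x * (1 / 2) * (G \<mu> \<nu> (mc2 x) + a2 x \<mu> * lc x \<nu>))" for \<mu> \<nu>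
    unfolding half pd_add[OF da(1) differentiable_mult[OF dt dlow(3)]] pd_mult[OF dt dlow(3)] pt low by simp
  have pA2: "pd \<mu> (\<lambda>y. A2 y \<nu>) x = pd \<mu> (\<lambda>y. a2 y \<nu>) x - (strength 1 x * lc x \<mu> * (1 / 2) * mc1 x \<nu>
      + strength 0 x * (1 / 2) * (G \<mu> \<nu> (mc1 x) + a1 x \<mu> * lc x \<nu>))" for \<mu> \<nu>
    unfolding half pd_diff[OF da(2) differentiable_mult[OF dt dlow(2)]] pd_mult[OF dt dlow(2)] pt low by simp
  have pB: "pd \<mu> (\<lambda>y. B y \<nu>) x = strength 1 x * lc x \<mu> * (1 / 2) * lc x \<nu> + strength 0 x * (1 / 2) * G \<mu> \<nu> (lc x)" for \<mu> \<nu>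
    unfolding half pd_mult[OF dt dlow(1)] pt low by simp
  have closed: "pd \<mu> (\<lambda>y. B y \<nu>) x = pd \<nu> (\<lambda>y. B y \<mu>) x" for \<mu> \<nu>
    unfolding pB using G[of \<mu> \<nu>] by simp
  have f1: "pd \<mu> (\<lambda>y. A1 y \<nu>) x - pd \<nu> (\<lambda>y. A1 y \<mu>) x + wedge (B x) (A2 x) \<mu> \<nu> =
      P1 x * wedge (lc x) (mc1 x) \<mu> \<nu> + Q1 x * wedge (lc x) (mc2 x) \<mu> \<nu>"
  proof -
    have "pd \<mu> (\<lambda>y. A1 y \<nu>) x - pd \<nu> (\<lambda>y. A1 y \<mu>) x + wedge (B x) (A2 x) \<mu> \<nu> = curl a1 x \<mu> \<nu>
      + strength 1 x / 2 * wedge (lc x) (mc2 x) \<mu> \<nu> - strength 0 x * strength 0 x / 4 * wedge (lc x) (mc1 x) \<mu> \<nu>"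
      unfolding pA1 curl_def wedge_def using G[of \<mu> \<nu>] by (simp add: field_simps)
    then show ?thesis
      unfolding curl_a[OF x] P1_def Q1_def by (simp add: field_simps)
  qed
  have f2: "pd \<mu> (\<lambda>y. A2 y \<nu>) x - pd \<nu> (\<lambda>y. A2 y \<mu>) x - wedge (B x) (A1 x) \<mu> \<nu> =
      P2 x * wedge (lc x) (mc1 x) \<mu> \<nu> + Q2 x * wedge (lc x) (mc2 x) \<mu> \<nu>"
  proof -
    have "pd \<mu> (\<lambda>y. A2 y \<nu>) x - pd \<nu> (\<lambda>y. A2 y \<mu>) x - wedge (B x) (A1 x) \<mu> \<nu> = curl a2 x \<mu> \<nu>
      - strength 1 x / 2 * wedge (lc x) (mc1 x) \<mu> \<nu> - strength 0 x * strength 0 x / 4 * wedge (lc x) (mc2 x) \<mu> \<nu>"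
      unfolding pA2 curl_def wedge_def using G[of \<mu> \<nu>] by (simp add: field_simps)
    then show ?thesis
      unfolding curl_a[OF x] P2_def Q2_def by (simp add: field_simps)
  qed
  show ?thesis
    unfolding f1[symmetric] f2[symmetric] X1_def X2_def
    by (rule curvature_adapted) (intro smooth_Gam adapted_Gam x d closed; assumption)+
qed

text \<open>The torsion corrections have gradients along \<open>lc\<close>, which vanish on
  \<open>l\<close>, \<open>m1\<close>, \<open>m2\<close>; what remains are the conditions on
  \<open>s\<close>.\<close>

lemma ym_equation_Gam:
  assumes x: "x \<in> V"
  shows "ym_equation_at g Gam x"
proof -
  interpret null_frame "g x" "l x" "n x" "m1 x" "m2 x" by (rule frame[OF x])
  show ?thesis
  proof (rule ym_equation_if_adapted[OF x adapted_Gam[OF x] refl])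
    show "curv_up g Gam y c t \<mu> \<nu> =
      (P1 y * wedge (l y) (m1 y) \<mu> \<nu> + Q1 y * wedge (l y) (m2 y) \<mu> \<nu>) * X1 y c t
     + (P2 y * wedge (l y) (m1 y) \<mu> \<nu> + Q2 y * wedge (l y) (m2 y) \<mu> \<nu>) * X2 y c t" if "y \<in> V" for y c t \<mu> \<nu>
      by (rule curv_up_if_curvature[OF that curvature_Gam[OF that]])
    show "P1 differentiable at x" "Q1 differentiable at x" "P2 differentiable at x" "Q2 differentiable at x"
      by (rule diff_PQ[OF x])+
    show "ctr (\<lambda>\<nu>. pd \<nu> P1 x) (l x) = 0" "ctr (\<lambda>\<nu>. pd \<nu> Q1 x) (l x) = 0"
      "ctr (\<lambda>\<nu>. pd \<nu> P2 x) (l x) = 0" "ctr (\<lambda>\<nu>. pd \<nu> Q2 x) (l x) = 0"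
      unfolding pd_PQ[OF x] by (simp_all add: ctr_simps products s_along_l[OF x])
    show "ctr (\<lambda>\<nu>. pd \<nu> P1 x) (m1 x) + ctr (\<lambda>\<nu>. pd \<nu> Q1 x) (m2 x) = 0"
      "ctr (\<lambda>\<nu>. pd \<nu> P2 x) (m1 x) + ctr (\<lambda>\<nu>. pd \<nu> Q2 x) (m2 x) = 0"
      unfolding pd_PQ[OF x] using s_divergence[OF x] by (simp_all add: ctr_simps products)
  qed
qed

section \<open>Vanishing Lagrangian and the two variations\<close>

lemma trace_curvature_Gam:
  "x \<in> V \<Longrightarrow> (\<Sum>c t. curvature Gam x c t \<mu> \<nu> * curvature Gam x t c i j) = 0"
  by (rule trace_curvature_square[OF _ curvature_Gam])

lemma ym_scalar_Gam:
  assumes x: "x \<in> V"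
  shows "ym_scalar g' Gam x = 0"
proof -
  let ?R = "curvature Gam x"
  have "ym_scalar g' Gam x = (\<Sum>(c, t, \<mu>, \<nu>, i, j)\<in>UNIV.
      ?R c t \<mu> \<nu> * (ginv g' x $ \<mu> $ i * ginv g' x $ \<nu> $ j * ?R t c i j))"
    by (simp only: ym_scalar_def curv_up_def sum_distrib_left sum_to_tuple6)
  also have "\<dots> = (\<Sum>(\<mu>, \<nu>, i, j, c, t)\<in>UNIV.
      ginv g' x $ \<mu> $ i * ginv g' x $ \<nu> $ j * (?R c t \<mu> \<nu> * ?R t c i j))"
    by (rule sum.reindex_bij_witness[of _ "\<lambda>(\<mu>, \<nu>, i, j, c, t). (c, t, \<mu>, \<nu>, i, j)"
      "\<lambda>(c, t, \<mu>, \<nu>, i, j). (\<mu>, \<nu>, i, j, c, t)"]) auto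
  also have "\<dots> = (\<Sum>\<mu> \<nu> i j.
      ginv g' x $ \<mu> $ i * ginv g' x $ \<nu> $ j * (\<Sum>c t. ?R c t \<mu> \<nu> * ?R t c i j))"
    by (simp only: sum_distrib_left sum_to_tuple6)
  finally show ?thesis by (simp add: trace_curvature_Gam[OF x])
qed

lemma ym_H_Gam:
  assumes x: "x \<in> V"
  shows "ym_H g Gam x \<nu> r = 0"
proof -
  let ?R = "curvature Gam x"
  have "ym_H g Gam x \<nu> r = (\<Sum>(c, t, \<mu>, i, j)\<in>UNIV.
      ?R c t \<mu> \<nu> * (ginv g x $ \<mu> $ i * ginv g x $ r $ j * ?R t c i j))"
    by (simp only: ym_H_def curv_up_def sum_distrib_left sum_to_tuple5)
  also have "\<dots> = (\<Sum>(\<mu>, i, j, c, t)\<in>UNIV.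
      ginv g x $ \<mu> $ i * ginv g x $ r $ j * (?R c t \<mu> \<nu> * ?R t c i j))"
    by (rule sum.reindex_bij_witness[of _ "\<lambda>(\<mu>, i, j, c, t). (c, t, \<mu>, i, j)"
      "\<lambda>(c, t, \<mu>, i, j). (\<mu>, i, j, c, t)"]) auto
  also have "\<dots> = (\<Sum>\<mu> i j.
      ginv g x $ \<mu> $ i * ginv g x $ r $ j * (\<Sum>c t. ?R c t \<mu> \<nu> * ?R t c i j))"
    by (simp only: sum_distrib_left sum_to_tuple5)
  finally show ?thesis by (simp add: trace_curvature_Gam[OF x])
qed

text \<open>The action is 0 along the whole variation, even where
  \<open>g x + t *\<^sub>R h x\<close> is degenerate.\<close>

lemma EL_metric_Gam: "EL_metric V g Gam"
  unfolding EL_metric_def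
proof (intro allI impI, elim conjE)
  fix K and h :: metric
  assume "K \<subseteq> V"
  then have "integral K (\<lambda>x. vol g' x * ym_scalar g' Gam x) = integral K (\<lambda>_. 0)" for g'
    by (intro integral_cong) (auto simp: ym_scalar_Gam)
  then show "((\<lambda>t. ym_action K (\<lambda>x. g x + t *\<^sub>R h x) Gam) has_real_derivative 0) (at 0)"
    by (simp add: ym_action_def)
qed

lemma EL_connection_Gam: "EL_connection V g Gam"
proof (rule EL_connection_if_ym_equation[OF V _ _ _ _ smooth_Gam])
  have sm: "smooth_on V (\<lambda>y. curv_up g Gam y c t \<mu> \<nu>)" for c t \<mu> \<nu>
    unfolding curv_up_def curvature_def by (intro smooth_intros V smooth_ginv smooth_Gam)
  have cv: "continuous_on V (vol g)"
    using vol_diff V by (intro differentiable_imp_continuous_on) (simp add: differentiable_on_eq_differentiable_at)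
  show "vol g x \<noteq> 0" if "x \<in> V" for x using vol_pos[OF that] by simp
  show "transpose (ginv g x) = ginv g x" if "x \<in> V" for x
    by (simp add: transpose_def vec_eq_iff ginv_eq[OF that] algebra_simps)
  show "continuous_on V (vol g)" by (rule cv)
  show "continuous_on V (\<lambda>x. ginv g x $ \<mu> $ \<nu>)" for \<mu> \<nu>
    by (rule smooth_on_continuous[OF smooth_ginv])
  show "(\<lambda>y. vol g y * curv_up g Gam y c t \<mu> \<nu>) differentiable at x" if "x \<in> V" for c t \<mu> \<nu> x
    by (intro differentiable_mult vol_diff diff_at[OF sm] that)
  show "continuous_on V (pd r (\<lambda>y. vol g y * curv_up g Gam y c t \<mu> \<nu>))" for r c t \<mu> \<nu>
  proof -
    \<comment> \<open>The derivative of the volume density is expressed by Christoffel symbols,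
      which makes its continuity visible.\<close>
    have "continuous_on V (\<lambda>x. vol g x * (\<Sum>c. christoffel g x c r c) * curv_up g Gam x c t \<mu> \<nu>
      + vol g x * pd r (\<lambda>y. curv_up g Gam y c t \<mu> \<nu>) x)"
      by (intro continuous_intros cv smooth_on_continuous smooth_on_pd smooth_christoffel sm)
    then show ?thesis
      by (rule continuous_on_cong[THEN iffD1, rotated 2]) (simp_all add: pd_mult vol_diff diff_at[OF sm] pd_vol_g)
  qed
  show "ym_equation_at g Gam x" if "x \<in> V" for x by (rule ym_equation_Gam[OF that])
qed

end

section \<open>The null frame of a parallel spinor\<close>

lemma sum_2': "sum f (UNIV :: 2 set) = f 0 + f 1"
proof -
  have "(2::2) = 0" by simp
  then show ?thesis by (simp only: sum_2 add.commute)
qed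

lemma all_2': "(\<forall>i::2. P i) \<longleftrightarrow> P 0 \<and> P 1"
proof -
  have "(2::2) = 0" by simp
  then show ?thesis by (simp only: forall_2 conj_commute)
qed

lemma invertible_if_lorentzian:
  assumes "lorentzian Q"
  shows "invertible Q"
proof -
  obtain P where P: "transpose P ** Q ** P = minkowski"
    using assms by (auto simp: lorentzian_def)
  have "minkowski ** minkowski = mat 1"
    by (simp add: vec_eq_iff matrix_matrix_mult_def minkowski_def mat_def if_distrib[where f = "\<lambda>z. z * _"] cong: if_cong)
  then have "det minkowski * det minkowski = 1"
    by (metis det_I det_mul)
  then have "det Q \<noteq> 0"
    using arg_cong[OF P, of det] by (auto simp: det_mul)
  then show ?thesis by (simp add: invertible_det_nz)
qed

text \<open>Keeps coefficients apart from vectors, so that one product rule,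
  \<open>cov_lin_comb\<close>, serves the frame.\<close>

definition lin_comb :: "real \<Rightarrow> real \<Rightarrow> real \<Rightarrow> real \<Rightarrow> real \<Rightarrow> real \<Rightarrow> real \<Rightarrow> real \<Rightarrow> real" where
  "lin_comb a b c d L N M1 M2 = a * L + b * N + c * M1 + d * M2"

text \<open>
  With \<open>chi\<^sup>0 = p + i q\<close>, \<open>chi\<^sup>1 = r + i s\<close> and the spinor \<open>(- cnj chi\<^sup>1, cnj chi\<^sup>0)\<close>, these are the vectors
  \<open>l\<close>, \<open>n\<close>, \<open>m\<^sub>1 + i m\<^sub>2\<close> of the spin frame formed by the two, in terms of the Pauli matrices
  \<open>\<sigma>\<^sub>0\<^sub>0 = L\<close>, \<open>\<sigma>\<^sub>1\<^sub>1 = N\<close>, \<open>\<sigma>\<^sub>0\<^sub>1 = M1 + i M2\<close>.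
\<close>

definition spin_l :: "real \<Rightarrow> real \<Rightarrow> real \<Rightarrow> real \<Rightarrow> real \<Rightarrow> real \<Rightarrow> real \<Rightarrow> real \<Rightarrow> real" where
  "spin_l p q r s = lin_comb (p * p + q * q) (r * r + s * s) (2 * (p * r + q * s)) (2 * (p * s - q * r))"

definition spin_n :: "real \<Rightarrow> real \<Rightarrow> real \<Rightarrow> real \<Rightarrow> real \<Rightarrow> real \<Rightarrow> real \<Rightarrow> real \<Rightarrow> real" where
  "spin_n p q r s = lin_comb (r * r + s * s) (p * p + q * q) (2 * - (p * r + q * s)) (2 * (q * r - p * s))"

definition spin_m1 :: "real \<Rightarrow> real \<Rightarrow> real \<Rightarrow> real \<Rightarrow> real \<Rightarrow> real \<Rightarrow> real \<Rightarrow> real \<Rightarrow> real" where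
  "spin_m1 p q r s = lin_comb (q * s - p * r) (p * r - q * s) (p * p - q * q - r * r + s * s) (2 * - (p * q + r * s))"

definition spin_m2 :: "real \<Rightarrow> real \<Rightarrow> real \<Rightarrow> real \<Rightarrow> real \<Rightarrow> real \<Rightarrow> real \<Rightarrow> real \<Rightarrow> real" where
  "spin_m2 p q r s = lin_comb (- (p * s + q * r)) (p * s + q * r) (2 * (p * q - r * s)) (p * p - q * q + r * r - s * s)"

lemmas spin_defs = spin_l_def spin_n_def spin_m1_def spin_m2_def lin_comb_def

text \<open>The unnormalised spin frame has determinant \<open>D\<close>, the squared norm of
  \<open>chi\<close>, and a change of spin frame scales the metric by the squared modulus of its
  determinant.\<close>

lemma spin_frame_metric:
  fixes p q r s :: real
  defines "D \<equiv> p * p + q * q + r * r + s * s"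
  shows "(spin_l p q r s L N M1 M2 * spin_n p q r s L' N' M1' M2' + spin_n p q r s L N M1 M2 * spin_l p q r s L' N' M1' M2') / 2
      - spin_m1 p q r s L N M1 M2 * spin_m1 p q r s L' N' M1' M2' - spin_m2 p q r s L N M1 M2 * spin_m2 p q r s L' N' M1' M2'
    = D * D * ((L * N' + N * L') / 2 - M1 * M1' - M2 * M2')"
  unfolding spin_defs D_def by (simp add: field_simps)

text \<open>The hypotheses say that the Pauli vectors and \<open>chi\<close> move under the same
  trace-free spin connection, with entries from \<open>a\<close>, \<open>b\<close>,
  \<open>u1\<close>, \<open>u2\<close>, \<open>w1\<close>, \<open>w2\<close>. \<open>E1\<close> and
  \<open>E2\<close> record how the second spinor moves along \<open>chi\<close>; the terms with
  \<open>D'\<close>, the derivative of \<open>D\<close>, disappear once the vectors are divided by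
  \<open>D\<close>.\<close>

lemma lin_comb_deriv:
  fixes p q r s L N M1 M2 p' q' r' s' L' N' M1' M2' a b u1 u2 w1 w2 :: real
  assumes frame: "L' = 2 * (a * L - u1 * M1 - u2 * M2)" "N' = - 2 * (a * N + w1 * M1 + w2 * M2)"
      "M1' = 2 * b * M2 - w1 * L - u1 * N" "M2' = - 2 * b * M1 - w2 * L - u2 * N"
    and spinor: "p' = w1 * r + w2 * s - a * p - b * q" "q' = w1 * s - w2 * r - a * q + b * p"
      "r' = u1 * p - u2 * q + a * r + b * s" "s' = u1 * q + u2 * p + a * s - b * r"
  defines "D \<equiv> p * p + q * q + r * r + s * s" and "D' \<equiv> 2 * (p * p' + q * q' + r * r' + s * s')"
  defines "E1 \<equiv> 2 * (u2 + w2) * (p * q + r * s) - (u1 + w1) * (p * p - q * q - r * r + s * s) - 4 * a * (p * r - q * s)"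
    and "E2 \<equiv> - 2 * (u1 + w1) * (p * q - r * s) - (u2 + w2) * (p * p - q * q + r * r - s * s) - 4 * a * (p * s + q * r)"
  shows "spin_l p q r s L' N' M1' M2' + lin_comb (2 * (p * p' + q * q')) (2 * (r * r' + s * s'))
      (2 * (p' * r + p * r' + (q' * s + q * s'))) (2 * (p' * s + p * s' - (q' * r + q * r'))) L N M1 M2 = 0"
   and "D * (spin_m1 p q r s L' N' M1' M2' + lin_comb (q' * s + q * s' - (p' * r + p * r')) (p' * r + p * r' - (q' * s + q * s'))
      (2 * (p * p' - q * q' - r * r' + s * s')) (2 * - (p' * q + p * q' + (r' * s + r * s'))) L N M1 M2) =
      E1 * spin_l p q r s L N M1 M2 + D' * spin_m1 p q r s L N M1 M2"
   and "D * (spin_m2 p q r s L' N' M1' M2' + lin_comb (- (p' * s + p * s' + (q' * r + q * r'))) (p' * s + p * s' + (q' * r + q * r'))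
      (2 * (p' * q + p * q' - (r' * s + r * s'))) (2 * (p * p' - q * q' + r * r' - s * s')) L N M1 M2) =
      E2 * spin_l p q r s L N M1 M2 + D' * spin_m2 p q r s L N M1 M2"
  unfolding spin_defs D_def D'_def E1_def E2_def assms(1-8)
  by algebra+

lemma cov_cong:
  assumes "open V" "x \<in> V" "\<And>y i. y \<in> V \<Longrightarrow> v y i = w y i"
  shows "cov Gam v x \<mu> k = cov Gam w x \<mu> k"
proof -
  have "pd \<mu> (\<lambda>y. v y k) x = pd \<mu> (\<lambda>y. w y k) x"
    by (rule pd_cong[OF assms])
  then show ?thesis
    by (simp add: cov_def assms(2,3))
qed

lemma cov_scale:
  assumes "f differentiable at x" "\<And>i. (\<lambda>y. v y i) differentiable at x"
  shows "cov Gam (\<lambda>y i. f y * v y i) x \<mu> k = pd \<mu> f x * v x k + f x * cov Gam v x \<mu> k"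
  unfolding cov_def using assms by (simp add: pd_mult distrib_left sum_distrib_left; simp add: mult_ac)

lemma cov_lin_comb:
  assumes f: "f1 differentiable at x" "f2 differentiable at x" "f3 differentiable at x" "f4 differentiable at x"
    and v: "\<And>i. (\<lambda>y. v1 y i) differentiable at x" "\<And>i. (\<lambda>y. v2 y i) differentiable at x"
      "\<And>i. (\<lambda>y. v3 y i) differentiable at x" "\<And>i. (\<lambda>y. v4 y i) differentiable at x"
  shows "cov Gam (\<lambda>y i. lin_comb (f1 y) (f2 y) (f3 y) (f4 y) (v1 y i) (v2 y i) (v3 y i) (v4 y i)) x \<mu> k =
    lin_comb (f1 x) (f2 x) (f3 x) (f4 x) (cov Gam v1 x \<mu> k) (cov Gam v2 x \<mu> k) (cov Gam v3 x \<mu> k) (cov Gam v4 x \<mu> k)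
    + lin_comb (pd \<mu> f1 x) (pd \<mu> f2 x) (pd \<mu> f3 x) (pd \<mu> f4 x) (v1 x k) (v2 x k) (v3 x k) (v4 x k)"
  unfolding cov_def lin_comb_def
  by (simp add: pd_add pd_mult differentiable_add differentiable_mult f v; simp add: algebra_simps sum.distrib sum_distrib_left)

lemma pd_complex:
  assumes "f differentiable at x"
  shows "Re (pd \<mu> f x) = pd \<mu> (\<lambda>y. Re (f y)) x" "Im (pd \<mu> f x) = pd \<mu> (\<lambda>y. Im (f y)) x"
  using pd_bounded_linear[OF bounded_linear_Re assms] pd_bounded_linear[OF bounded_linear_Im assms] by simp_all

section \<open>A parallel spinor in one chart\<close>

locale parallel_spinor =
  fixes V :: "vec4 set" and g :: metric and sg :: pauli and chi :: spinor
  assumes V: "open V"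
    and smooth_g: "smooth_on V (\<lambda>x. g x $ i $ j)"
    and lorentzian_g: "x \<in> V \<Longrightarrow> lorentzian (g x)"
    and smooth_sg: "smooth_on V (\<lambda>x. sg x i $ a $ b)"
    and pauli: "x \<in> V \<Longrightarrow> pauli_matrices_at g sg x"
    and smooth_chi: "smooth_on V (\<lambda>x. chi x $ a)"
    and chi_nonzero: "x \<in> V \<Longrightarrow> chi x \<noteq> 0"
    and parallel: "x \<in> V \<Longrightarrow> cov_deriv_spinor g sg (christoffel g) chi x \<mu> a = 0"
begin

text \<open>Real components of the Hermitian Pauli matrices. The Clifford relation makes them a null
  frame, not yet adapted to the spinor.\<close>

definition "vL x i = Re (sg x i $ 0 $ 0)"
definition "vN x i = Re (sg x i $ 1 $ 1)"
definition "vM1 x i = Re (sg x i $ 0 $ 1)"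
definition "vM2 x i = Im (sg x i $ 0 $ 1)"
definition "p x = Re (chi x $ 0)"
definition "q x = Im (chi x $ 0)"
definition "r x = Re (chi x $ 1)"
definition "s x = Im (chi x $ 1)"

lemma smooth_Re_Im: "smooth_on V f \<Longrightarrow> smooth_on V (\<lambda>x. Re (f x))" "smooth_on V f \<Longrightarrow> smooth_on V (\<lambda>x. Im (f x))"
  by (rule smooth_on_bounded_linear[OF V bounded_linear_Re] smooth_on_bounded_linear[OF V bounded_linear_Im]; assumption)+

lemma smooth_v: "smooth_on V (\<lambda>x. vL x i)" "smooth_on V (\<lambda>x. vN x i)" "smooth_on V (\<lambda>x. vM1 x i)" "smooth_on V (\<lambda>x. vM2 x i)"
  unfolding vL_def vN_def vM1_def vM2_def by (intro smooth_Re_Im smooth_sg)+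

lemma smooth_pqrs: "smooth_on V p" "smooth_on V q" "smooth_on V r" "smooth_on V s"
  unfolding p_def[abs_def] q_def[abs_def] r_def[abs_def] s_def[abs_def] by (intro smooth_Re_Im smooth_chi)+

lemma sg_eq:
  assumes "x \<in> V"
  shows "sg x i $ 0 $ 0 = Complex (vL x i) 0" (is ?P1)
    "sg x i $ 1 $ 1 = Complex (vN x i) 0" (is ?P2)
    "sg x i $ 0 $ 1 = Complex (vM1 x i) (vM2 x i)" (is ?P3)
    "sg x i $ 1 $ 0 = Complex (vM1 x i) (- vM2 x i)" (is ?P4)
proof -
  have h: "sg x i $ b $ a = cnj (sg x i $ a $ b)" for a b
    using pauli[OF assms] unfolding pauli_matrices_at_def by blast
  have "Im (sg x i $ a $ a) = 0" for a
    using arg_cong[OF h[of a a], of Im] by simp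
  then show ?P1 ?P2 ?P3 ?P4
    unfolding vL_def vN_def vM1_def vM2_def using h[of 0 1] by (simp_all add: complex_eq_iff)
qed

lemma pauli_up_eq:
  assumes "x \<in> V"
  shows "pauli_up sg x i 0 0 = Complex (vN x i) 0" "pauli_up sg x i 1 1 = Complex (vL x i) 0"
    "pauli_up sg x i 0 1 = Complex (- vM1 x i) (vM2 x i)" "pauli_up sg x i 1 0 = Complex (- vM1 x i) (- vM2 x i)"
  unfolding pauli_up_def sum_2' spinor_eps_def by (simp_all add: sg_eq[OF assms] complex_eq_iff)

lemma ginv_eq:
  assumes "x \<in> V"
  shows "ginv g x $ i $ j = (vL x i * vN x j + vN x i * vL x j) / 2 - vM1 x i * vM1 x j - vM2 x i * vM2 x j"
proof -
  \<comment> \<open>The spinor indices 0, 0 of the Clifford relation already determine the inverse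
    metric.\<close>
  have "(\<Sum>d. sg x i $ 0 $ d * pauli_up sg x j 0 d) + (\<Sum>d. sg x j $ 0 $ d * pauli_up sg x i 0 d)
      = 2 * of_real (ginv g x $ i $ j) * (if (0::2) = 0 then 1 else 0)"
    using pauli[OF assms] unfolding pauli_matrices_at_def by blast
  from arg_cong[OF this, of Re] show ?thesis
    unfolding sum_2' sg_eq[OF assms] pauli_up_eq[OF assms] by (simp add: field_simps)
qed

lemma sym_g: "x \<in> V \<Longrightarrow> transpose (g x) = g x"
  using lorentzian_g by (simp add: lorentzian_def)

lemma invertible_g: "x \<in> V \<Longrightarrow> invertible (g x)"
  by (rule invertible_if_lorentzian[OF lorentzian_g])

sublocale pauli: pp_frame V g vL vN vM1 vM2
proof (rule pp_frame.intro[OF V smooth_g smooth_v _ invertible_g])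
  fix x assume x: "x \<in> V"
  show "null_frame (g x) (vL x) (vN x) (vM1 x) (vM2 x)"
    by (rule null_frameI[OF sym_g[OF x] invertible_g[OF x] ginv_eq[OF x, unfolded ginv_def]])
qed

abbreviation "D \<equiv> cov (christoffel g)"

text \<open>Six real one-forms, as many as the Lorentz algebra has dimensions. The weights 1/4 and
  1/2 make them, up to sign, the real and imaginary parts of the spin connection
  coefficients.\<close>

definition "ca x \<mu> = ctr (low (g x) (vN x)) (D vL x \<mu>) * (1 / 4)"
definition "cb x \<mu> = ctr (low (g x) (vM1 x)) (D vM2 x \<mu>) * (1 / 2)"
definition "cu1 x \<mu> = ctr (low (g x) (vM1 x)) (D vL x \<mu>) * (1 / 2)"
definition "cu2 x \<mu> = ctr (low (g x) (vM2 x)) (D vL x \<mu>) * (1 / 2)"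
definition "cw1 x \<mu> = ctr (low (g x) (vM1 x)) (D vN x \<mu>) * (1 / 2)"
definition "cw2 x \<mu> = ctr (low (g x) (vM2 x)) (D vN x \<mu>) * (1 / 2)"

lemma frame_product_const:
  assumes x: "x \<in> V" and uv: "\<And>y. y \<in> V \<Longrightarrow> ctr (low (g y) (u y)) (v y) = c"
    "\<And>i. (\<lambda>y. u y i) differentiable at x" "\<And>i. (\<lambda>y. v y i) differentiable at x"
  shows "ctr (low (g x) (v x)) (D u x \<mu>) + ctr (low (g x) (u x)) (D v x \<mu>) = 0"
proof -
  have "pd \<mu> (\<lambda>y. ctr (low (g y) (u y)) (v y)) x = 0"
    by (rule pd_zero_on[OF V x uv(1)])
  moreover have "pd \<mu> (\<lambda>y. ctr (low (g y) (u y)) (v y)) x =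
      ctr (low (g x) (D u x \<mu>)) (v x) + ctr (low (g x) (u x)) (D v x \<mu>)"
    by (intro pd_ctr_low pauli.diffs(1)[OF x] uv pauli.christoffel_compatible x)
  ultimately show ?thesis
    by (simp add: ctr_low_commute[OF sym_g[OF x], of "D u x \<mu>"])
qed

text \<open>Scalar products of frame vectors are constant, which reduces the sixteen products to
  six.\<close>

lemma frame_products:
  assumes x: "x \<in> V"
  shows "ctr (low (g x) (vL x)) (D vL x \<mu>) = 0" (is ?P1)
    "ctr (low (g x) (vL x)) (D vN x \<mu>) = - 4 * ca x \<mu>" (is ?P2)
    "ctr (low (g x) (vL x)) (D vM1 x \<mu>) = - 2 * cu1 x \<mu>" (is ?P3)
    "ctr (low (g x) (vL x)) (D vM2 x \<mu>) = - 2 * cu2 x \<mu>" (is ?P4)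
    "ctr (low (g x) (vN x)) (D vL x \<mu>) = 4 * ca x \<mu>" (is ?P5)
    "ctr (low (g x) (vN x)) (D vN x \<mu>) = 0" (is ?P6)
    "ctr (low (g x) (vN x)) (D vM1 x \<mu>) = - 2 * cw1 x \<mu>" (is ?P7)
    "ctr (low (g x) (vN x)) (D vM2 x \<mu>) = - 2 * cw2 x \<mu>" (is ?P8)
    "ctr (low (g x) (vM1 x)) (D vL x \<mu>) = 2 * cu1 x \<mu>" (is ?P9)
    "ctr (low (g x) (vM1 x)) (D vN x \<mu>) = 2 * cw1 x \<mu>" (is ?P10)
    "ctr (low (g x) (vM1 x)) (D vM1 x \<mu>) = 0" (is ?P11)
    "ctr (low (g x) (vM1 x)) (D vM2 x \<mu>) = 2 * cb x \<mu>" (is ?P12)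
    "ctr (low (g x) (vM2 x)) (D vL x \<mu>) = 2 * cu2 x \<mu>" (is ?P13)
    "ctr (low (g x) (vM2 x)) (D vN x \<mu>) = 2 * cw2 x \<mu>" (is ?P14)
    "ctr (low (g x) (vM2 x)) (D vM1 x \<mu>) = - 2 * cb x \<mu>" (is ?P15)
    "ctr (low (g x) (vM2 x)) (D vM2 x \<mu>) = 0" (is ?P16)
proof -
  note c = null_frame.products[OF pauli.frame] and d = pauli.diffs(2-5)[OF x] and const = frame_product_const[OF x, where \<mu> = \<mu>]
  note e = const[OF c(1) d(1) d(1)] const[OF c(2) d(1) d(2)] const[OF c(3) d(1) d(3)] const[OF c(4) d(1) d(4)]
    const[OF c(6) d(2) d(2)] const[OF c(7) d(2) d(3)] const[OF c(8) d(2) d(4)] const[OF c(11) d(3) d(3)]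
    const[OF c(12) d(3) d(4)] const[OF c(16) d(4) d(4)]
  show ?P1 ?P2 ?P3 ?P4 ?P5 ?P6 ?P7 ?P8 ?P9 ?P10 ?P11 ?P12 ?P13 ?P14 ?P15 ?P16
    unfolding ca_def cb_def cu1_def cu2_def cw1_def cw2_def using e by simp_all
qed

lemma frame_derivs:
  assumes x: "x \<in> V"
  shows "D vL x \<mu> k = 2 * (ca x \<mu> * vL x k - cu1 x \<mu> * vM1 x k - cu2 x \<mu> * vM2 x k)" (is ?P1)
    "D vN x \<mu> k = - 2 * (ca x \<mu> * vN x k + cw1 x \<mu> * vM1 x k + cw2 x \<mu> * vM2 x k)" (is ?P2)
    "D vM1 x \<mu> k = 2 * cb x \<mu> * vM2 x k - cw1 x \<mu> * vL x k - cu1 x \<mu> * vN x k" (is ?P3)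
    "D vM2 x \<mu> k = - 2 * cb x \<mu> * vM1 x k - cw2 x \<mu> * vL x k - cu2 x \<mu> * vN x k" (is ?P4)
proof -
  interpret null_frame "g x" "vL x" "vN x" "vM1 x" "vM2 x" by (rule pauli.frame[OF x])
  note c = complete[of "D vL x \<mu>" k] complete[of "D vN x \<mu>" k] complete[of "D vM1 x \<mu>" k] complete[of "D vM2 x \<mu>" k]
  show ?P1 ?P2 ?P3 ?P4
    using c unfolding frame_products[OF x] by simp_all
qed

lemma cov_pauli:
  assumes x: "x \<in> V"
  defines "S \<equiv> \<lambda>b d i \<mu>. pd \<mu> (\<lambda>y. sg y i $ b $ d) x + (\<Sum>j. of_real (christoffel g x i \<mu> j) * sg x j $ b $ d)"
  shows "S 0 0 i \<mu> = Complex (D vL x \<mu> i) 0" (is ?P1) "S 1 1 i \<mu> = Complex (D vN x \<mu> i) 0" (is ?P2)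
    "S 0 1 i \<mu> = Complex (D vM1 x \<mu> i) (D vM2 x \<mu> i)" (is ?P3) "S 1 0 i \<mu> = Complex (D vM1 x \<mu> i) (- D vM2 x \<mu> i)" (is ?P4)
proof -
  have d: "(\<lambda>y. sg y i $ b $ d) differentiable at x" for b d
    by (rule pauli.diff_at[OF smooth_sg x])
  have pdr: "pd \<mu> (\<lambda>y. Re (sg y i $ b $ d)) x = pd \<mu> f x" "pd \<mu> (\<lambda>y. Im (sg y i $ b $ d)) x = pd \<mu> h x"
    if "\<And>y. y \<in> V \<Longrightarrow> sg y i $ b $ d = Complex (f y) (h y)" for b d f h
    by (intro pd_cong[OF V x]; simp add: that)+
  have S: "S b d' i \<mu> = Complex (D u x \<mu> i) (pd \<mu> (h i) x + (\<Sum>j. christoffel g x i \<mu> j * h j x))"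
    if "\<And>y j. y \<in> V \<Longrightarrow> sg y j $ b $ d' = Complex (u y j) (h j y)" for b d' u h
    unfolding S_def cov_def complex_eq_iff using pdr[OF that] that[OF x]
    by (simp add: pd_complex[OF d])
  show ?P1 using S[of 0 0 vL "\<lambda>_ _. 0"] by (simp add: sg_eq)
  show ?P2 using S[of 1 1 vN "\<lambda>_ _. 0"] by (simp add: sg_eq)
  show ?P3
    using S[of 0 1 vM1 "\<lambda>j y. vM2 y j"] by (simp add: sg_eq cov_def)
  show ?P4
    using S[of 1 0 vM1 "\<lambda>j y. - vM2 y j"] by (simp add: sg_eq cov_def pd_minus pauli.diffs[OF x] sum_negf)
qed

lemma low_pauli_up:
  assumes x: "x \<in> V"
  defines "U \<equiv> \<lambda>a d i. \<Sum>j. of_real (g x $ i $ j) * pauli_up sg x j a d"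
  shows "U 0 0 i = Complex (low (g x) (vN x) i) 0" "U 1 1 i = Complex (low (g x) (vL x) i) 0"
    "U 0 1 i = Complex (- low (g x) (vM1 x) i) (low (g x) (vM2 x) i)"
    "U 1 0 i = Complex (- low (g x) (vM1 x) i) (- low (g x) (vM2 x) i)"
  unfolding U_def low_def complex_eq_iff pauli_up_eq[OF x] by (simp_all add: sum_negf)

lemma spin_conn_eq:
  assumes x: "x \<in> V"
  shows "spin_conn g sg (christoffel g) x 0 \<mu> 0 = Complex (ca x \<mu>) (- cb x \<mu>)"
    "spin_conn g sg (christoffel g) x 0 \<mu> 1 = Complex (- cw1 x \<mu>) (cw2 x \<mu>)"
    "spin_conn g sg (christoffel g) x 1 \<mu> 0 = Complex (- cu1 x \<mu>) (- cu2 x \<mu>)"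
    "spin_conn g sg (christoffel g) x 1 \<mu> 1 = Complex (- ca x \<mu>) (cb x \<mu>)"
  unfolding spin_conn_def sum_2' cov_pauli[OF x] low_pauli_up[OF x] complex_eq_iff
  using frame_products[OF x, of \<mu>]
  by (simp_all add: sum.distrib sum_subtractf sum_negf flip: ctr_def)

lemma spinor_derivs:
  assumes x: "x \<in> V"
  shows "pd \<mu> p x = cw1 x \<mu> * r x + cw2 x \<mu> * s x - ca x \<mu> * p x - cb x \<mu> * q x" (is ?P1)
    "pd \<mu> q x = cw1 x \<mu> * s x - cw2 x \<mu> * r x - ca x \<mu> * q x + cb x \<mu> * p x" (is ?P2)
    "pd \<mu> r x = cu1 x \<mu> * p x - cu2 x \<mu> * q x + ca x \<mu> * r x + cb x \<mu> * s x" (is ?P3)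
    "pd \<mu> s x = cu1 x \<mu> * q x + cu2 x \<mu> * p x + ca x \<mu> * s x - cb x \<mu> * r x" (is ?P4)
proof -
  have d: "(\<lambda>y. chi y $ a) differentiable at x" for a
    by (rule pauli.diff_at[OF smooth_chi x])
  note c = pd_complex[OF d, of \<mu>]
  have "pd \<mu> (\<lambda>y. chi y $ a) x = - (spin_conn g sg (christoffel g) x a \<mu> 0 * chi x $ 0 + spin_conn g sg (christoffel g) x a \<mu> 1 * chi x $ 1)" for a
    using parallel[OF x, of \<mu> a] unfolding cov_deriv_spinor_def sum_2' by (simp only: eq_neg_iff_add_eq_0)
  note e = arg_cong[OF this[of 0], of Re] arg_cong[OF this[of 0], of Im] arg_cong[OF this[of 1], of Re] arg_cong[OF this[of 1], of Im]
  show ?P1 ?P2 ?P3 ?P4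
    using e unfolding c spin_conn_eq[OF x] p_def[abs_def] q_def[abs_def] r_def[abs_def] s_def[abs_def]
    by simp_all
qed

definition "dd x = p x * p x + q x * q x + r x * r x + s x * s x"
definition "di x = inverse (dd x)"
definition "fl x i = spin_l (p x) (q x) (r x) (s x) (vL x i) (vN x i) (vM1 x i) (vM2 x i)"
definition "fn x i = spin_n (p x) (q x) (r x) (s x) (vL x i) (vN x i) (vM1 x i) (vM2 x i)"
definition "fm1 x i = spin_m1 (p x) (q x) (r x) (s x) (vL x i) (vN x i) (vM1 x i) (vM2 x i)"
definition "fm2 x i = spin_m2 (p x) (q x) (r x) (s x) (vL x i) (vN x i) (vM1 x i) (vM2 x i)"
definition "e1 x \<mu> = 2 * (cu2 x \<mu> + cw2 x \<mu>) * (p x * q x + r x * s x)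
   - (cu1 x \<mu> + cw1 x \<mu>) * (p x * p x - q x * q x - r x * r x + s x * s x) - 4 * ca x \<mu> * (p x * r x - q x * s x)"
definition "e2 x \<mu> = - 2 * (cu1 x \<mu> + cw1 x \<mu>) * (p x * q x - r x * s x)
   - (cu2 x \<mu> + cw2 x \<mu>) * (p x * p x - q x * q x + r x * r x - s x * s x) - 4 * ca x \<mu> * (p x * s x + q x * r x)"

lemma null_vector_eq:
  assumes "x \<in> V"
  shows "null_vector sg chi x i = fl x i"
  unfolding null_vector_def sum_2' sg_eq[OF assms] fl_def spin_defs
  by (simp add: p_def q_def r_def s_def algebra_simps)

lemma dd_pos:
  assumes "x \<in> V"
  shows "dd x > 0"
proof -
  have "chi x $ 0 \<noteq> 0 \<or> chi x $ 1 \<noteq> 0"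
    using chi_nonzero[OF assms] by (auto simp: vec_eq_iff all_2')
  moreover have "dd x = (cmod (chi x $ 0))\<^sup>2 + (cmod (chi x $ 1))\<^sup>2"
    unfolding dd_def cmod_power2 p_def q_def r_def s_def by (simp add: power2_eq_square)
  ultimately show ?thesis
    by (auto simp: add_pos_nonneg add_nonneg_pos)
qed

lemma smooth_di: "smooth_on V di"
  unfolding di_def[abs_def]
proof (rule smooth_on_inverse[OF V])
  show "smooth_on V dd"
    unfolding dd_def[abs_def] by (intro smooth_intros V smooth_pqrs)
  show "dd x \<noteq> 0" if "x \<in> V" for x using dd_pos[OF that] by simp
qed

lemma smooth_f: "smooth_on V (\<lambda>x. fl x i)" "smooth_on V (\<lambda>x. fn x i)" "smooth_on V (\<lambda>x. fm1 x i)" "smooth_on V (\<lambda>x. fm2 x i)"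
  unfolding fl_def fn_def fm1_def fm2_def spin_defs by (intro smooth_intros V smooth_pqrs smooth_v)+

lemma smooth_cov: "(\<And>i. smooth_on V (\<lambda>x. v x i)) \<Longrightarrow> smooth_on V (\<lambda>x. D v x \<mu> k)"
  unfolding cov_def by (intro smooth_intros V pauli.smooth_christoffel)

lemma smooth_e: "smooth_on V (\<lambda>x. e1 x \<mu>)" "smooth_on V (\<lambda>x. e2 x \<mu>)"
  unfolding e1_def e2_def ca_def cu1_def cu2_def cw1_def cw2_def
  by (intro smooth_intros V smooth_pqrs smooth_on_ctr pauli.smooth_low smooth_v smooth_cov)+

text \<open>Before normalisation \<open>fm1\<close> and \<open>fm2\<close> also change by the
  logarithmic derivative of \<open>dd\<close>; the last claim supplies the derivative of
  \<open>di\<close> that compensates for it.\<close>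

lemma cov_f:
  assumes x: "x \<in> V"
  defines "d' \<equiv> \<lambda>\<mu>. 2 * (p x * pd \<mu> p x + q x * pd \<mu> q x + r x * pd \<mu> r x + s x * pd \<mu> s x)"
  shows "D fl x \<mu> k = 0" "dd x * D fm1 x \<mu> k = e1 x \<mu> * fl x k + d' \<mu> * fm1 x k" (is ?P2)
    "dd x * D fm2 x \<mu> k = e2 x \<mu> * fl x k + d' \<mu> * fm2 x k" (is ?P3) "pd \<mu> di x = - di x * di x * d' \<mu>" (is ?P4)
proof -
  note d = smooth_pqrs[THEN pauli.diff_at, OF x]
  note dv = pauli.diffs(2-5)[OF x]
  note di = differentiable_add differentiable_diff differentiable_mult differentiable_minus differentiable_const d
  note pds = pd_add pd_diff pd_mult pd_minus di
  note key = lin_comb_deriv[OF frame_derivs[OF x] spinor_derivs[OF x], of \<mu>]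
  have c: "D (\<lambda>y i. lin_comb (f1 y) (f2 y) (f3 y) (f4 y) (vL y i) (vN y i) (vM1 y i) (vM2 y i)) x \<mu> k =
    lin_comb (f1 x) (f2 x) (f3 x) (f4 x) (D vL x \<mu> k) (D vN x \<mu> k) (D vM1 x \<mu> k) (D vM2 x \<mu> k)
    + lin_comb (pd \<mu> f1 x) (pd \<mu> f2 x) (pd \<mu> f3 x) (pd \<mu> f4 x) (vL x k) (vN x k) (vM1 x k) (vM2 x k)"
    if "f1 differentiable at x" "f2 differentiable at x" "f3 differentiable at x" "f4 differentiable at x" for f1 f2 f3 f4
    by (rule cov_lin_comb[OF that dv])
  have "D fl x \<mu> k = spin_l (p x) (q x) (r x) (s x) (D vL x \<mu> k) (D vN x \<mu> k) (D vM1 x \<mu> k) (D vM2 x \<mu> k)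
    + lin_comb (2 * (p x * pd \<mu> p x + q x * pd \<mu> q x)) (2 * (r x * pd \<mu> r x + s x * pd \<mu> s x))
      (2 * (pd \<mu> p x * r x + p x * pd \<mu> r x + (pd \<mu> q x * s x + q x * pd \<mu> s x)))
      (2 * (pd \<mu> p x * s x + p x * pd \<mu> s x - (pd \<mu> q x * r x + q x * pd \<mu> r x))) (vL x k) (vN x k) (vM1 x k) (vM2 x k)"
    unfolding fl_def[abs_def] spin_l_def by (subst c) (simp_all add: pds algebra_simps)
  then show "D fl x \<mu> k = 0" using key(1) by simp
  have "D fm1 x \<mu> k = spin_m1 (p x) (q x) (r x) (s x) (D vL x \<mu> k) (D vN x \<mu> k) (D vM1 x \<mu> k) (D vM2 x \<mu> k)
    + lin_comb (pd \<mu> q x * s x + q x * pd \<mu> s x - (pd \<mu> p x * r x + p x * pd \<mu> r x))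
      (pd \<mu> p x * r x + p x * pd \<mu> r x - (pd \<mu> q x * s x + q x * pd \<mu> s x))
      (2 * (p x * pd \<mu> p x - q x * pd \<mu> q x - r x * pd \<mu> r x + s x * pd \<mu> s x))
      (2 * - (pd \<mu> p x * q x + p x * pd \<mu> q x + (pd \<mu> r x * s x + r x * pd \<mu> s x))) (vL x k) (vN x k) (vM1 x k) (vM2 x k)"
    unfolding fm1_def[abs_def] spin_m1_def by (subst c) (simp_all add: pds algebra_simps)
  then show ?P2
    unfolding fl_def fm1_def dd_def e1_def d'_def using key(2) by simp
  have "D fm2 x \<mu> k = spin_m2 (p x) (q x) (r x) (s x) (D vL x \<mu> k) (D vN x \<mu> k) (D vM1 x \<mu> k) (D vM2 x \<mu> k)
    + lin_comb (- (pd \<mu> p x * s x + p x * pd \<mu> s x + (pd \<mu> q x * r x + q x * pd \<mu> r x)))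
      (pd \<mu> p x * s x + p x * pd \<mu> s x + (pd \<mu> q x * r x + q x * pd \<mu> r x))
      (2 * (pd \<mu> p x * q x + p x * pd \<mu> q x - (pd \<mu> r x * s x + r x * pd \<mu> s x)))
      (2 * (p x * pd \<mu> p x - q x * pd \<mu> q x + r x * pd \<mu> r x - s x * pd \<mu> s x)) (vL x k) (vN x k) (vM1 x k) (vM2 x k)"
    unfolding fm2_def[abs_def] spin_m2_def by (subst c) (simp_all add: pds algebra_simps)
  then show ?P3
    unfolding fl_def fm2_def dd_def e2_def d'_def using key(3) by simp
  have ddd: "dd differentiable at x" "pd \<mu> dd x = d' \<mu>"
    unfolding dd_def[abs_def] d'_def by (simp_all add: pds)
  have "((\<lambda>y. inverse (dd y)) has_derivative (\<lambda>h. - (inverse (dd x) * frechet_derivative dd (at x) h * inverse (dd x)))) (at x)"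
    using dd_pos[OF x] by (intro Deriv.has_derivative_inverse has_derivative_pd ddd) simp
  from pdI[OF this, of \<mu>] ddd(2) show ?P4
    unfolding di_def[abs_def] by (simp add: pd_def mult_ac)
qed

text \<open>Dividing the second spinor by \<open>dd\<close> scales \<open>n\<close>, quadratic in
  it, by two factors \<open>di\<close>, and \<open>m1\<close>, \<open>m2\<close>, linear in it, by
  one; \<open>l\<close> contains \<open>chi\<close> alone.\<close>

definition "frame_n x i = di x * di x * fn x i"
definition "frame_m1 x i = di x * fm1 x i"
definition "frame_m2 x i = di x * fm2 x i"
definition "frame_a1 x \<mu> = di x * di x * e1 x \<mu>"
definition "frame_a2 x \<mu> = di x * di x * e2 x \<mu>"

sublocale adapted: pp_frame V g "null_vector sg chi" frame_n frame_m1 frame_m2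
proof (rule pp_frame.intro[OF V smooth_g _ _ _ _ _ invertible_g])
  show "smooth_on V (\<lambda>x. null_vector sg chi x i)" for i
    using smooth_f(1) by (rule smooth_on_cong[OF V, THEN iffD2, rotated]) (rule null_vector_eq)
  show "smooth_on V (\<lambda>x. frame_n x i)" "smooth_on V (\<lambda>x. frame_m1 x i)" "smooth_on V (\<lambda>x. frame_m2 x i)" for i
    unfolding frame_n_def frame_m1_def frame_m2_def by (intro smooth_on_mult V smooth_di smooth_f)+
  fix x assume x: "x \<in> V"
  have dd: "di x * dd x = 1" using dd_pos[OF x] by (simp add: di_def)
  show "null_frame (g x) (null_vector sg chi x) (frame_n x) (frame_m1 x) (frame_m2 x)"
  proof (rule null_frameI[OF sym_g[OF x] invertible_g[OF x]])
    fix i j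
    \<comment> \<open>Two factors equal to 1 are inserted to match the scaling in
      \<open>spin_frame_metric\<close>.\<close>
    have "matrix_inv (g x) $ i $ j = (di x * dd x) * (di x * dd x) * ginv g x $ i $ j"
      by (simp add: dd ginv_def)
    also have "\<dots> = di x * di x * (dd x * dd x * ((vL x i * vN x j + vN x i * vL x j) / 2 - vM1 x i * vM1 x j - vM2 x i * vM2 x j))"
      by (simp add: ginv_eq[OF x])
    also have "\<dots> = di x * di x * ((fl x i * fn x j + fn x i * fl x j) / 2 - fm1 x i * fm1 x j - fm2 x i * fm2 x j)"
      unfolding dd_def spin_frame_metric[symmetric] fl_def fn_def fm1_def fm2_def ..
    also have "\<dots> = (fl x i * frame_n x j + frame_n x i * fl x j) / 2 - frame_m1 x i * frame_m1 x j - frame_m2 x i * frame_m2 x j"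
      unfolding frame_n_def frame_m1_def frame_m2_def by (simp add: field_simps)
    finally show "matrix_inv (g x) $ i $ j = (null_vector sg chi x i * frame_n x j + frame_n x i * null_vector sg chi x j) / 2
      - frame_m1 x i * frame_m1 x j - frame_m2 x i * frame_m2 x j"
      by (simp add: null_vector_eq[OF x])
  qed
qed

lemma smooth_frame_a: "smooth_on V (\<lambda>x. frame_a1 x \<mu>)" "smooth_on V (\<lambda>x. frame_a2 x \<mu>)"
  unfolding frame_a1_def frame_a2_def by (intro smooth_on_mult V smooth_di smooth_e)+

lemma adapted_christoffel:
  assumes x: "x \<in> V"
  shows "adapted.adapted_at (christoffel g) frame_a1 frame_a2 (\<lambda>_ _. 0) x"
proof -
  note d = pauli.diff_at[OF smooth_di x] pauli.diff_at[OF smooth_f(3) x] pauli.diff_at[OF smooth_f(4) x]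
  have dd: "di x * dd x = 1" using dd_pos[OF x] by (simp add: di_def)
  have 0: "D (null_vector sg chi) x \<mu> k = 0" for \<mu> k
  proof -
    have "D (null_vector sg chi) x \<mu> k = D fl x \<mu> k"
      by (rule cov_cong[OF V x null_vector_eq])
    then show ?thesis by (simp add: cov_f(1)[OF x])
  qed
  \<comment> \<open>The derivative of the normalising factor cancels the term with
    \<open>d'\<close>.\<close>
  have scale: "- di' * di' * d' * m + di' * X = di' * di' * E * l"
    if "dd' * X = E * l + d' * m" "di' * dd' = 1" for di' dd' X E l d' m :: real
  proof -
    have "di' * X = di' * (di' * dd') * X" using that(2) by simp
    also have "\<dots> = di' * di' * (dd' * X)" by (simp add: mult_ac)
    finally show ?thesis unfolding that(1) by (simp add: algebra_simps)
  qed
  have 1: "D frame_m1 x \<mu> k = frame_a1 x \<mu> * null_vector sg chi x k" for \<mu> k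
    unfolding frame_m1_def[abs_def] cov_scale[OF d(1,2)] cov_f(4)[OF x] frame_a1_def null_vector_eq[OF x]
    by (rule scale[OF cov_f(2)[OF x] dd])
  have 2: "D frame_m2 x \<mu> k = frame_a2 x \<mu> * null_vector sg chi x k" for \<mu> k
    unfolding frame_m2_def[abs_def] cov_scale[OF d(1,3)] cov_f(4)[OF x] frame_a2_def null_vector_eq[OF x]
    by (rule scale[OF cov_f(3)[OF x] dd])
  show ?thesis
    unfolding adapted.adapted_at_def by (simp add: 0 1 2 pauli.christoffel_compatible[OF x])
qed

end

section \<open>The field equations in every chart\<close>

theorem theorem4p1:
  fixes M :: "'m topology" and A :: "'m chart set"
    and g :: "'m chart \<Rightarrow> metric" and Gam :: "'m chart \<Rightarrow> conn"
    and sg :: "'m chart \<Rightarrow> pauli"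
    and L :: "'m chart \<Rightarrow> 'm chart \<Rightarrow> vec4 \<Rightarrow> complex ^ 2 ^ 2"
    and chi :: "'m chart \<Rightarrow> spinor" and phi :: "'m \<Rightarrow> real" and k :: "real \<Rightarrow> real"
  assumes pp: "pp_wave M A g sg L chi"
    and phase: "phase_function A g sg chi phi"
    and smooth_k: "smooth_on UNIV k"
    and connection: "affine_connection_on A Gam"
    and metric_compatible:
      "\<forall>c\<in>A. \<forall>x\<in>chart_image c. \<forall>\<mu> \<alpha> \<beta>. cov_deriv2 (Gam c) (\<lambda>y \<alpha> \<beta>. g c y $ \<alpha> $ \<beta>) x \<mu> \<alpha> \<beta> = 0"
    and axial_torsion:
      "\<forall>c\<in>A. \<forall>x\<in>chart_image c. \<forall>\<tau> \<mu> \<nu>. torsion_low (g c) (Gam c) x \<tau> \<mu> \<nu> =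
      hodge1 (g c) (\<lambda>y \<alpha>. k (phi (chart_inv c y)) * null_vector (sg c) (chi c) y \<alpha>) x \<tau> \<mu> \<nu>"
    and ricci_parallel:
      "\<forall>c\<in>A. \<forall>x\<in>chart_image c. \<forall>\<mu> \<alpha> \<beta>.
      cov_deriv2 (christoffel (g c)) (ricci (christoffel (g c))) x \<mu> \<alpha> \<beta> = 0"
  shows "\<forall>c\<in>A. EL_metric (chart_image c) (g c) (Gam c) \<and>
      EL_connection (chart_image c) (g c) (Gam c) \<and>
      (\<forall>x\<in>chart_image c. ym_equation_at (g c) (Gam c) x \<and>
      complementary_ym_equation_at (g c) (Gam c) x)"
proof
  fix c assume c: "c \<in> A"
  let ?V = "chart_image c"
  interpret parallel_spinor ?V "g c" "sg c" "chi c"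
  proof
    show "open ?V"
      using pp c by (auto simp: pp_wave_def connected_oriented_4_manifold_def is_chart_def)
    show "smooth_on ?V (\<lambda>x. g c x $ \<alpha> $ \<beta>)" "x \<in> ?V \<Longrightarrow> lorentzian (g c x)" for \<alpha> \<beta> x
      using pp c by (auto simp: pp_wave_def lorentzian_metric_on_def)
    show "smooth_on ?V (\<lambda>x. sg c x \<alpha> $ a $ b)" "x \<in> ?V \<Longrightarrow> pauli_matrices_at (g c) (sg c) x" for \<alpha> a b x
      using pp c by (auto simp: pp_wave_def spin_structure_on_def)
    show "smooth_on ?V (\<lambda>x. chi c x $ a)" for a
      using pp c by (auto simp: pp_wave_def spinor_field_on_def)
    show "chi c x \<noteq> 0" "cov_deriv_spinor (g c) (sg c) (christoffel (g c)) (chi c) x \<mu> a = 0" if "x \<in> ?V" for x \<mu> a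
      using pp c that by (auto simp: pp_wave_def)
  qed
  \<comment> \<open>The adapted frame exists on the whole chart domain, as \<open>chi\<close>
    vanishes nowhere; no smaller neighbourhoods are chosen.\<close>
  have "axial_torsion_frame ?V (g c) (null_vector (sg c) (chi c)) frame_n frame_m1 frame_m2 frame_a1 frame_a2
      (Gam c) (phi \<circ> chart_inv c) k"
  proof (intro_locales, unfold_locales)
    show "smooth_on ?V (\<lambda>x. frame_a1 x \<alpha>)" "smooth_on ?V (\<lambda>x. frame_a2 x \<alpha>)" for \<alpha>
      by (rule smooth_frame_a)+
    show "adapted.adapted_at (christoffel (g c)) frame_a1 frame_a2 (\<lambda>_ _. 0) x" if "x \<in> ?V" for x
      by (rule adapted_christoffel[OF that])
    show "cov_deriv2 (christoffel (g c)) (ricci (christoffel (g c))) x \<mu> \<alpha> \<beta> = 0" if "x \<in> ?V" for x \<mu> \<alpha> \<beta>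
      using ricci_parallel c that by blast
    show "smooth_on ?V (\<lambda>x. Gam c x \<tau> \<mu> \<nu>)" for \<tau> \<mu> \<nu>
      using connection c by (auto simp: affine_connection_on_def)
    show "metric_compatible_at (g c) (Gam c) x" if "x \<in> ?V" for x
      unfolding metric_compatible_at_def
    proof (intro allI)
      fix \<mu> \<alpha> \<beta>
      show "pd \<mu> (\<lambda>y. g c y $ \<alpha> $ \<beta>) x =
      (\<Sum>\<kappa>. Gam c x \<kappa> \<mu> \<alpha> * g c x $ \<kappa> $ \<beta>) + (\<Sum>\<kappa>. Gam c x \<kappa> \<mu> \<beta> * g c x $ \<alpha> $ \<kappa>)"
      using metric_compatible[rule_format, OF c that, of \<mu> \<alpha> \<beta>] unfolding cov_deriv2_def by linarith
    qed
    show "torsion_low (g c) (Gam c) x \<tau> \<mu> \<nu> = hodge1 (g c) (\<lambda>y \<alpha>. k ((phi \<circ> chart_inv c) y) * null_vector (sg c) (chi c) y \<alpha>) x \<tau> \<mu> \<nu>"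
      if "x \<in> ?V" for x \<tau> \<mu> \<nu>
      using axial_torsion c that by simp
    show "smooth_on ?V (phi \<circ> chart_inv c)" "x \<in> ?V \<Longrightarrow> pd \<mu> (phi \<circ> chart_inv c) x = low (g c x) (null_vector (sg c) (chi c) x) \<mu>" for x \<mu>
      using phase c by (auto simp: phase_function_def low_def)
    show "smooth_on UNIV k" by (rule smooth_k)
  qed
  then interpret axial_torsion_frame ?V "g c" "null_vector (sg c) (chi c)" frame_n frame_m1 frame_m2 frame_a1 frame_a2
      "Gam c" "phi \<circ> chart_inv c" k .
  show "EL_metric ?V (g c) (Gam c) \<and> EL_connection ?V (g c) (Gam c) \<and>
     (\<forall>x\<in>?V. ym_equation_at (g c) (Gam c) x \<and> complementary_ym_equation_at (g c) (Gam c) x)"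
    by (simp add: EL_metric_Gam EL_connection_Gam ym_equation_Gam complementary_ym_equation_at_def ym_H_Gam)
qed

end
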